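(* Let $n\ge 2$ be an integer. Let $\Phi\in C^3(0,\infty)$ be a positive and convex function with $\ddot\Phi>0$, and assume that $\chi=1/\ddot\Phi$ and its derivative extend continuously to $[0,\infty)$, with $\chi(0)=\alpha\ge 0$. Let $R>1$, let $R_\circ$ be the constant defined in the context, and let $R_\ast>1$ with $R_\ast\ge R_\circ$. Let $\mathbb{A}=\{x\in\mathbf{R}^n:1<|x|<R\}$ and $\mathbb{A}_\ast=\{y\in\mathbf{R}^n:1<|y|<R_\ast\}$, and let $H_\lambda$ be the solution, with $\dot H_\lambda(1)=\lambda\in[0,\infty)$ and $\dot H_\lambda>0$ on $(1,\infty)$, of the boundary value problem $$\ddot H(t)=(H(t)-t\dot H(t))\,M(t),\qquad H(1)=1,\quad H(R)=R_\ast .$$ Then the radial mapping $h_\lambda(x)=H_\lambda(|x|)\frac{x}{|x|}$ minimizes the energy $\mathcal{E}_\Phi$ over the class $\mathcal{R}(\mathbb{A},\mathbb{A}_\ast)$.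
   Context: Dots on $H$ denote $d/dt$; dots on $\Phi$ denote derivatives with respect to its own variable. The coefficient $M$: with $Q=(n-1)H^2+t^2\dot H^2$ and $J=t^{1-n}H^{n-1}\dot H$, $$M(t)=\frac{n-1}{t^2H}\,\frac{B+C}{D+E},$$ $$B=n\,t^{2n}H^3\Big(\tfrac{(n-1)H^2}{t^2}+\dot H^2\Big)^{n/2}\big((n-1)H^2+(n-2)tH\dot H+t^2\dot H^2\big),\qquad C=t\,H^{2n}\dot H\,Q^2\,\ddot\Phi(J),$$ $$D=(n-1)n\,t^{2n}H^2\Big(\tfrac{(n-1)H^2}{t^2}+\dot H^2\Big)^{n/2}\big(H^2+t^2\dot H^2\big),\qquad E=H^{2n}Q^2\,\ddot\Phi(J).$$ Where $\dot H=0$, $M$ is understood through the equivalent expression obtained by multiplying numerator and denominator by $\chi(J)=1/\ddot\Phi(J)$, with $\chi$ extended continuously to $0$. The constant $R_\circ=R_\circ(n,\Phi,R)$: $R_\circ=H_\circ(R)$, where $H_\circ$ is the solution on $[1,\infty)$ of $\ddot H=(H-t\dot H)M$ with $H(1)=1$, $\dot H(1)=0$. If $\alpha=0$ then $H_\circ\equiv1$ and $R_\circ=1$. The boundary value problem in the claim has a solution that is increasing (positive derivative on $(1,\infty)$) exactly when $R_\ast\ge R_\circ$; this solution is then unique on $[1,\infty)$. $\mathcal{R}(\mathbb{A},\mathbb{A}_\ast)$ is the class of all radial orientation preserving homeomorphisms $h(x)=H(|x|)\frac{x}{|x|}$ of $\mathbb{A}$ onto $\mathbb{A}_\ast$ in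 the Sobolev space $\mathcal{W}^{1,n}(\mathbb{A},\mathbb{A}_\ast)$ with $|h(x)|\to1$ as $|x|\to1$ and $|h(x)|\to R_\ast$ as $|x|\to R$. Energy: $\mathcal{E}_\Phi[h]=\int_{\mathbb{A}}\big(\|Dh\|^n+\Phi(\det Dh)\big)\,dx\in(0,\infty]$, where $\|\cdot\|$ is the Hilbert–Schmidt norm and $\Phi(0):=\lim_{s\to0^+}\Phi(s)\in[0,\infty]$. *)

theory Defs
  imports "HOL-Analysis.Analysis" "HOL-Homology.Homology"
begin

subsection \<open>Annuli and weak derivatives\<close>

definition annulus :: "real \<Rightarrow> (real ^ 'n::finite) set" where
  "annulus R = {x. 1 < norm x \<and> norm x < R}"

definition partial_deriv :: "'n::finite \<Rightarrow> (real ^ 'n \<Rightarrow> real) \<Rightarrow> real ^ 'n \<Rightarrow> real" where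
  "partial_deriv j f x = frechet_derivative f (at x) (axis j 1)"

primrec C_k :: "nat \<Rightarrow> (real ^ 'n::finite \<Rightarrow> real) \<Rightarrow> bool" where
  "C_k 0 f \<longleftrightarrow> continuous_on UNIV f"
| "C_k (Suc k) f \<longleftrightarrow> (\<forall>x. f differentiable at x) \<and> (\<forall>j. C_k k (partial_deriv j f))"

definition test_function :: "(real ^ 'n::finite) set \<Rightarrow> (real ^ 'n \<Rightarrow> real) \<Rightarrow> bool" where
  "test_function U \<phi> \<longleftrightarrow>
     (\<forall>k. C_k k \<phi>) \<and> compact (closure {x. \<phi> x \<noteq> 0}) \<and> closure {x. \<phi> x \<noteq> 0} \<subseteq> U"

definition locally_integrable_on :: "(real ^ 'n::finite) set \<Rightarrow>
    (real ^ 'n \<Rightarrow> 'b::euclidean_space) \<Rightarrow> bool" where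
  "locally_integrable_on U f \<longleftrightarrow> (\<forall>K. compact K \<and> K \<subseteq> U \<longrightarrow> set_integrable lebesgue K f)"

text \<open>The entry \<open>G x $ i $ j\<close> is the weak partial derivative in direction \<open>j\<close> of the
  component \<open>i\<close> of \<open>h\<close>.\<close>

definition has_weak_derivative_on :: "(real ^ 'n::finite \<Rightarrow> real ^ 'm::finite) \<Rightarrow>
    (real ^ 'n \<Rightarrow> real ^ 'n ^ 'm) \<Rightarrow> (real ^ 'n) set \<Rightarrow> bool" where
  "has_weak_derivative_on h G U \<longleftrightarrow>
     locally_integrable_on U h \<and> locally_integrable_on U G \<and>
     (\<forall>\<phi> i j. test_function U \<phi> \<longrightarrow>
        (LINT x:U|lebesgue. h x $ i * partial_deriv j \<phi> x)
          = - (LINT x:U|lebesgue. G x $ i $ j * \<phi> x))"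

text \<open>Weak derivatives are determined up to a null set, so the choice made here does not
  affect integrals over \<open>U\<close>.\<close>

definition weak_derivative_on :: "(real ^ 'n::finite) set \<Rightarrow> (real ^ 'n \<Rightarrow> real ^ 'm::finite) \<Rightarrow>
    real ^ 'n \<Rightarrow> real ^ 'n ^ 'm" where
  "weak_derivative_on U h = (SOME G. has_weak_derivative_on h G U)"

text \<open>The norm of the type \<open>real ^ 'n ^ 'm\<close> is the Hilbert--Schmidt norm.\<close>

definition sobolev_W1 :: "nat \<Rightarrow> (real ^ 'n::finite) set \<Rightarrow> (real ^ 'n \<Rightarrow> real ^ 'm::finite) set" where
  "sobolev_W1 p U = {h. \<exists>G. has_weak_derivative_on h G U \<and>
     set_integrable lebesgue U (\<lambda>x. norm (h x) ^ p) \<and>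
     set_integrable lebesgue U (\<lambda>x. norm (G x) ^ p)}"

subsection \<open>Orientation preserving maps\<close>

text \<open>An injective continuous map of an open set preserves orientation if its local degree is
  \<open>1\<close> at every point. The local degree at \<open>x\<close> is the degree of the self-map
  \<open>u \<mapsto> (h (x + r u) - h x) / |h (x + r u) - h x|\<close> of the unit sphere, for any \<open>r > 0\<close> such that
  the closed ball of radius \<open>r\<close> about \<open>x\<close> lies in the domain. The library defines the degree for
  self-maps of \<open>nsphere p\<close>, a subspace of \<open>nat \<Rightarrow> real\<close>; conjugating by a homeomorphism with the
  unit sphere transports it, and the result does not depend on that homeomorphism. One
  always exists, see \<open>sphere_homeomorphic_nsphere\<close>.\<close>

definition local_sphere_map :: "(real ^ 'n::finite \<Rightarrow> real ^ 'n) \<Rightarrow> real ^ 'n \<Rightarrow> real \<Rightarrow>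
    real ^ 'n \<Rightarrow> real ^ 'n" where
  "local_sphere_map h x r u = sgn (h (x + r *\<^sub>R u) - h x)"

definition orientation_preserving_on :: "(real ^ 'n::finite) set \<Rightarrow> (real ^ 'n \<Rightarrow> real ^ 'n) \<Rightarrow> bool" where
  "orientation_preserving_on U h \<longleftrightarrow>
     (\<forall>x r c c'. 0 < r \<and> cball x r \<subseteq> U \<and>
        homeomorphic_maps (nsphere (CARD('n) - 1)) (top_of_set (sphere (0 :: real ^ 'n) 1)) c c'
        \<longrightarrow> Brouwer_degree2 (CARD('n) - 1) (c' \<circ> local_sphere_map h x r \<circ> c) = 1)"

lemma sphere_homeomorphic_nsphere:
  "nsphere (CARD('n) - 1) homeomorphic_space top_of_set (sphere (0 :: real ^ 'n::finite) 1)"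
proof -
  let ?n = "CARD('n)"
  let ?N = "nsphere (?n - 1)" and ?S = "top_of_set (sphere (0 :: real ^ 'n) 1)"
  have n: "0 < ?n" by simp
  obtain s where s: "bij_betw s {..<?n} (UNIV :: 'n set)"
    using ex_bij_betw_nat_finite[of "UNIV :: 'n set"] by (auto simp: atLeast0LessThan)
  define s' where "s' = inv_into {..<?n} s"
  have ss': "s (s' j) = j" "s' j < ?n" for j
    using s by (auto simp: s'_def bij_betw_def f_inv_into_f)
      (metis UNIV_I inv_into_into lessThan_iff)
  have s's: "s' (s i) = i" if "i < ?n" for i
    using s that by (simp add: s'_def bij_betw_def)
  have ran: "{..?n - 1} = {..<?n}" "{..?n - Suc 0} = {..<?n}"
    using n by (auto simp del: zero_less_card_finite)
  have gt: "?n - Suc 0 < i \<longleftrightarrow> ?n \<le> i" for i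
    using n by linarith
  have norm1: "norm v = 1 \<longleftrightarrow> (\<Sum>j\<in>UNIV. (v $ j)\<^sup>2) = 1" for v :: "real ^ 'n"
    by (simp add: norm_vec_def L2_set_def)
  define c :: "(nat \<Rightarrow> real) \<Rightarrow> real ^ 'n" where "c u = (\<chi> j. u (s' j))" for u
  define c' :: "real ^ 'n \<Rightarrow> nat \<Rightarrow> real" where "c' v i = (if i < ?n then v $ s i else 0)" for v i
  have topN: "topspace ?N = {u. (\<Sum>i<?n. (u i)\<^sup>2) = 1 \<and> (\<forall>i\<ge>?n. u i = 0)}"
    by (auto simp: nsphere ran gt)
  have sum: "(\<Sum>j\<in>UNIV. f j) = (\<Sum>i<?n. f (s i))" for f :: "'n \<Rightarrow> real"
    by (rule sum.reindex_bij_betw[OF s, symmetric])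
  have "continuous_map ?N euclidean c"
    unfolding continuous_map_atin limitin_canonical_iff c_def
  proof (intro ballI tendsto_vec_lambda)
    fix x j assume "x \<in> topspace ?N"
    have "continuous_map ?N euclideanreal (\<lambda>u. u (s' j))"
      by (simp add: continuous_map_nsphere_projection)
    with \<open>x \<in> topspace ?N\<close> show "((\<lambda>u. u (s' j)) \<longlongrightarrow> x (s' j)) (atin ?N x)"
      unfolding continuous_map_atin limitin_canonical_iff by blast
  qed
  then have c: "continuous_map ?N ?S c"
    by (auto simp: continuous_map_in_subtopology topN[unfolded One_nat_def] norm1 c_def sum s's)
  have "continuous_map ?S euclideanreal (\<lambda>v. c' v i)" for i
    by (auto simp: c'_def intro!: continuous_intros)
  then have c': "continuous_map ?S ?N c'"
    by (auto simp: nsphere gt continuous_map_in_subtopology continuous_map_componentwise_UNIV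
        ran norm1 sum c'_def)
  have "homeomorphic_maps ?N ?S c c'"
    unfolding homeomorphic_maps_def
    using c c' by (auto simp: topN[unfolded One_nat_def] c_def c'_def ss' s's vec_eq_iff fun_eq_iff)
  then show ?thesis
    unfolding homeomorphic_space_def by blast
qed

subsection \<open>The radial class and the energy\<close>

definition radial_map :: "(real \<Rightarrow> real) \<Rightarrow> real ^ 'n::finite \<Rightarrow> real ^ 'n" where
  "radial_map H x = H (norm x) *\<^sub>R (x /\<^sub>R norm x)"

definition radial_class :: "real \<Rightarrow> real \<Rightarrow> (real ^ 'n::finite \<Rightarrow> real ^ 'n) set" where
  "radial_class R Rs = {h.
     (\<exists>H. \<forall>x\<in>annulus R. h x = radial_map H x) \<and>
     (\<exists>g. homeomorphism (annulus R) (annulus Rs) h g) \<and>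
     orientation_preserving_on (annulus R) h \<and>
     h \<in> sobolev_W1 CARD('n) (annulus R) \<and>
     ((\<lambda>x. norm (h x)) \<longlongrightarrow> 1) (filtercomap norm (at_right 1)) \<and>
     ((\<lambda>x. norm (h x)) \<longlongrightarrow> Rs) (filtercomap norm (at_left R))}"

text \<open>Only arguments \<open>s \<ge> 0\<close> matter: the Jacobian of a map in the radial class is nonnegative
  almost everywhere.\<close>

definition extend_zero :: "(real \<Rightarrow> real) \<Rightarrow> real \<Rightarrow> ennreal" where
  "extend_zero \<Phi> s = (if 0 < s then ennreal (\<Phi> s) else Lim (at_right 0) (\<lambda>s. ennreal (\<Phi> s)))"

definition energy :: "(real \<Rightarrow> real) \<Rightarrow> real \<Rightarrow> (real ^ 'n::finite \<Rightarrow> real ^ 'n) \<Rightarrow> ennreal" where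
  "energy \<Phi> R h = (\<integral>\<^sup>+x\<in>annulus R.
     (ennreal (norm (weak_derivative_on (annulus R) h x) ^ CARD('n))
       + extend_zero \<Phi> (det (weak_derivative_on (annulus R) h x))) \<partial>lebesgue)"

subsection \<open>The differential equation\<close>

definition chi :: "(real \<Rightarrow> real) \<Rightarrow> real \<Rightarrow> real" where
  "chi \<Phi> s = (if s = 0 then Lim (at_right 0) (\<lambda>s. 1 / (deriv ^^ 2) \<Phi> s)
               else 1 / (deriv ^^ 2) \<Phi> s)"

text \<open>The coefficient \<open>M\<close>, with \<open>h\<close> and \<open>k\<close> standing for the values of \<open>H\<close> and of its
  derivative at \<open>t\<close>.\<close>

definition M_coeff :: "nat \<Rightarrow> (real \<Rightarrow> real) \<Rightarrow> real \<Rightarrow> real \<Rightarrow> real \<Rightarrow> real" where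
  "M_coeff n \<Phi> t h k =
    (let Q = (real n - 1) * h\<^sup>2 + t\<^sup>2 * k\<^sup>2;
         J = t powi (1 - int n) * h ^ (n - 1) * k;
         w = ((real n - 1) * h\<^sup>2 / t\<^sup>2 + k\<^sup>2) powr (real n / 2);
         B = real n * t ^ (2 * n) * h ^ 3 * w
               * ((real n - 1) * h\<^sup>2 + (real n - 2) * t * h * k + t\<^sup>2 * k\<^sup>2);
         D = (real n - 1) * real n * t ^ (2 * n) * h\<^sup>2 * w * (h\<^sup>2 + t\<^sup>2 * k\<^sup>2);
         C0 = t * h ^ (2 * n) * k * Q\<^sup>2;
         E0 = h ^ (2 * n) * Q\<^sup>2
     in (real n - 1) / (t\<^sup>2 * h) *
        (if k = 0
         then (chi \<Phi> J * B + C0) / (chi \<Phi> J * D + E0)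
         else (B + C0 * (deriv ^^ 2) \<Phi> J) / (D + E0 * (deriv ^^ 2) \<Phi> J)))"

text \<open>\<open>dH\<close> is the derivative of \<open>H\<close> (one-sided at \<open>1\<close>). The condition \<open>0 \<le> dH t\<close> says
  that \<open>J\<close> stays in \<open>[0,\<infinity>)\<close>, outside of which the equation has no meaning.\<close>

definition solves_radial_ode :: "nat \<Rightarrow> (real \<Rightarrow> real) \<Rightarrow> (real \<Rightarrow> real) \<Rightarrow> (real \<Rightarrow> real) \<Rightarrow> bool" where
  "solves_radial_ode n \<Phi> H dH \<longleftrightarrow>
     (\<forall>t\<ge>1. 0 \<le> dH t \<and>
        (H has_real_derivative dH t) (at t within {1..}) \<and>
        (dH has_real_derivative (H t - t * dH t) * M_coeff n \<Phi> t (H t) (dH t))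
          (at t within {1..}))"

definition R_circ :: "nat \<Rightarrow> (real \<Rightarrow> real) \<Rightarrow> real \<Rightarrow> real" where
  "R_circ n \<Phi> R = (THE r. \<exists>H dH. solves_radial_ode n \<Phi> H dH \<and> H 1 = 1 \<and> dH 1 = 0 \<and> r = H R)"

end

theory Submission
  imports Defs "HOL-Computational_Algebra.Polynomial" "HOL-Probability.Distribution_Functions"
begin

text \<open>The map \<open>radial_map K\<close> stretches by the factor \<open>K'\<close> in the radial direction and by \<open>K / t\<close> in the
\<open>n - 1\<close> tangential ones, where \<open>t = |x|\<close>. Its energy is therefore the area of the unit sphere times
the integral over \<open>1 < t < R\<close> of

\<open>t^(n-1) (K'^2 + (n-1) (K/t)^2)^(n/2) + t^(n-1) \<Phi> (K' (K/t)^(n-1))\<close>.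

This is not convex in \<open>K\<close>, but it is convex in \<open>v = K^n\<close>. With \<open>y = t K' / K\<close> one has \<open>t v' = n v y\<close>;
the first summand is \<open>v g(y) / t\<close> with the convex function \<open>g(y) = (n - 1 + y^2)^(n/2)\<close>, hence the
perspective of a convex function of \<open>v'\<close>, and in the second summand \<open>\<Phi>\<close> is applied to a multiple of
\<open>v'\<close>. The differential equation is the Euler--Lagrange equation of this functional: if \<open>H\<close> solves it
and \<open>p = y q^(n-2) + \<Phi>'(J) / n\<close> with \<open>q = sqrt (n - 1 + y^2)\<close> and \<open>J = H' (H/t)^(n-1)\<close> is the partial
derivative of the integrand in \<open>v'\<close>, then \<open>p'\<close> is its partial derivative in \<open>v\<close>
(\<open>Euler_Lagrange_equation\<close>). By convexity the integrand of a competitor \<open>K\<close> exceeds the one of \<open>H\<close> by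
at least the derivative of \<open>p (K^n - H^n)\<close> (\<open>energy_density_calibration\<close>). Integration over \<open>[a, b]\<close>
leaves boundary terms, and these vanish as \<open>a\<close> tends to \<open>1\<close> and \<open>b\<close> to \<open>R\<close>: \<open>K\<close> and \<open>H\<close> agree at both
ends, and \<open>p\<close> is bounded because its derivative, in which \<open>\<Phi>\<close> no longer occurs, is bounded. This holds
even if \<open>\<Phi>'\<close> is unbounded near \<open>0\<close> and \<open>H'\<close> vanishes at \<open>1\<close> (\<open>stationary_radial_map_minimizes\<close>).

The argument needs a competitor whose profile is the primitive of an integrable function and whose
weak derivative is given by the classical formula, while membership in the class only provides a
Sobolev map. Testing the weak derivative with functions of \<open>|x|\<close> shows that the increments of
\<open>t^(n-1) K\<close> are integrals of the divergence over shells. Since \<open>K\<close> is increasing, its Stieltjes measure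
is then dominated by an absolutely continuous measure, and its Radon--Nikodym density \<open>k \<ge> 0\<close> is the
derivative that is wanted (\<open>weakly_differentiable_radial_profile\<close>). Conversely \<open>radial_gradient K k\<close>
is a weak derivative (\<open>radial_map_has_weak_derivative\<close>), and weak derivatives are unique almost
everywhere (\<open>weak_derivative_unique\<close>).

A competitor may have a negative profile, that is, equal the antipode of a map with positive
profile. Along an increasing radial map the displacement \<open>h y - h x\<close> is never opposite to \<open>y - x\<close>, so
its local degree is the one of the identity; for the antipode it is \<open>(-1)^n\<close>. Hence negative profiles
occur only for even \<open>n\<close>, and then neither the norm nor the determinant of the derivative sees the sign
(\<open>radial_class_profile\<close>). The same degree computation shows that \<open>radial_map H\<close> itself belongs to the
class.\<close>

section \<open>Smooth functions and cutoffs\<close>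

text \<open>Differentiability to order \<open>k\<close> in the recursive form of \<^const>\<open>C_k\<close>, so that both are handled by
the same inductions.\<close>

primrec smooth_order :: "nat \<Rightarrow> (real \<Rightarrow> real) \<Rightarrow> bool" where
  "smooth_order 0 f \<longleftrightarrow> continuous_on UNIV f"
| "smooth_order (Suc k) f \<longleftrightarrow>
     (\<exists>f'. (\<forall>x. (f has_real_derivative f' x) (at x)) \<and> smooth_order k f')"

lemma smooth_order_lower: "smooth_order (Suc k) f \<Longrightarrow> smooth_order k f"
proof (induction k arbitrary: f)
  case 0
  then show ?case
    by (auto simp: continuous_on_eq_continuous_at intro: DERIV_isCont)
next
  case (Suc k)
  then show ?case by (metis smooth_order.simps(2))
qed

lemma smooth_order_add:
  "smooth_order k f \<Longrightarrow> smooth_order k g \<Longrightarrow> smooth_order k (\<lambda>x. f x + g x)"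
proof (induction k arbitrary: f g)
  case 0 then show ?case by (auto intro: continuous_intros)
next
  case (Suc k)
  from Suc.prems obtain f' g' where *: "\<forall>x. (f has_real_derivative f' x) (at x)" "smooth_order k f'"
    "\<forall>x. (g has_real_derivative g' x) (at x)" "smooth_order k g'" by auto
  then show ?case
    by (auto intro!: exI[of _ "\<lambda>x. f' x + g' x"] Suc.IH derivative_intros)
qed

lemma smooth_order_mult:
  "smooth_order k f \<Longrightarrow> smooth_order k g \<Longrightarrow> smooth_order k (\<lambda>x. f x * g x)"
proof (induction k arbitrary: f g)
  case 0 then show ?case by (auto intro: continuous_intros)
next
  case (Suc k)
  from Suc.prems obtain f' g' where *: "\<forall>x. (f has_real_derivative f' x) (at x)" "smooth_order k f'"
    "\<forall>x. (g has_real_derivative g' x) (at x)" "smooth_order k g'" by auto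
  have "smooth_order k f" "smooth_order k g" using Suc.prems smooth_order_lower by blast+
  then have "smooth_order k (\<lambda>x. f x * g' x + f' x * g x)"
    using * by (intro smooth_order_add Suc.IH) auto
  moreover have "((\<lambda>x. f x * g x) has_real_derivative f x * g' x + f' x * g x) (at x)" for x
    using * by (auto intro!: derivative_eq_intros)
  ultimately show ?case by (auto intro!: exI[of _ "\<lambda>x. f x * g' x + f' x * g x"])
qed

lemma smooth_order_const: "smooth_order k (\<lambda>x. c)"
  by (induction k arbitrary: c) (auto intro!: exI[of _ "\<lambda>x. 0"])

lemma smooth_order_affine:
  "smooth_order k f \<Longrightarrow> smooth_order k (\<lambda>x. f (a * x + b))"
proof (induction k arbitrary: f)
  case 0 then show ?case by (auto intro!: continuous_intros continuous_on_compose2[of UNIV f])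
next
  case (Suc k)
  from Suc.prems obtain f' where *: "\<forall>x. (f has_real_derivative f' x) (at x)" "smooth_order k f'"
    by auto
  have "((\<lambda>x. f (a * x + b)) has_real_derivative a * f' (a * x + b)) (at x)" for x
  proof -
    have "((\<lambda>x. a * x + b) has_real_derivative a) (at x)" by (auto intro!: derivative_eq_intros)
    with * show ?thesis using DERIV_chain2[of f "f' (a*x+b)" "\<lambda>x. a*x+b" x a UNIV]
      by (simp add: mult.commute)
  qed
  moreover have "smooth_order k (\<lambda>x. a * f' (a * x + b))"
    using * by (intro smooth_order_mult smooth_order_const Suc.IH)
  ultimately show ?case by (auto intro!: exI[of _ "\<lambda>x. a * f' (a * x + b)"])
qed

text \<open>The derivatives of \<open>exp (- 1 / x)\<close> for \<open>x > 0\<close>, continued by \<open>0\<close>, are all of this form; the polynomial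
argument makes the family closed under differentiation.\<close>

definition flat :: "real poly \<Rightarrow> real \<Rightarrow> real" where
  "flat p x = (if x \<le> 0 then 0 else poly p (1 / x) * exp (- (1 / x)))"

lemma poly_exp_decay: "((\<lambda>y. poly p y * exp (- y)) \<longlongrightarrow> 0) at_top" for p :: "real poly"
proof -
  have "((\<lambda>y. \<Sum>i\<le>Polynomial.degree p. poly.coeff p i * (y ^ i / exp y)) \<longlongrightarrow> (\<Sum>i\<le>Polynomial.degree p. poly.coeff p i * 0)) at_top"
    by (intro tendsto_intros tendsto_power_div_exp_0)
  then show ?thesis
    by (simp add: poly_altdef sum_distrib_right exp_minus divide_inverse mult.assoc)
qed

text \<open>At the origin the difference quotient is a polynomial in \<open>1 / h\<close> times \<open>exp (- 1 / h)\<close>.\<close>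

lemma flat_derivative:
  "(flat p has_real_derivative flat ([:0, 0, 1:] * (p - pderiv p)) x) (at x)"
proof (cases x "0::real" rule: linorder_cases)
  case less
  have "((\<lambda>x. 0) has_real_derivative 0) (at x)" by simp
  moreover have "\<forall>\<^sub>F y in nhds x. (0::real) = flat p y"
    using eventually_nhds_in_open[of "{..<0}" x] less
    by (auto simp: flat_def elim!: eventually_mono)
  ultimately show ?thesis using less
    by (subst DERIV_cong_ev[OF refl _ refl, of _ "\<lambda>x. 0"]) (auto simp: flat_def elim!: eventually_mono)
next
  case greater
  have "((\<lambda>x. poly p (1 / x) * exp (- (1 / x))) has_real_derivative
      flat ([:0, 0, 1:] * (p - pderiv p)) x) (at x)"
  proof -
    have i: "((\<lambda>x. 1 / x) has_real_derivative - (1 / x\<^sup>2)) (at x)"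
      using greater by (auto intro!: derivative_eq_intros simp: power2_eq_square field_simps)
    have "((\<lambda>x. poly p (1 / x)) has_real_derivative poly (pderiv p) (1 / x) * - (1 / x\<^sup>2)) (at x)"
      by (rule DERIV_chain2[OF poly_DERIV i])
    moreover have "((\<lambda>x. exp (- (1 / x))) has_real_derivative exp (- (1 / x)) * (1 / x\<^sup>2)) (at x)"
      using DERIV_chain2[OF DERIV_exp DERIV_minus[OF i]] by simp
    ultimately show ?thesis
      by (rule DERIV_cong[OF DERIV_mult])
         (use greater in \<open>simp add: flat_def power2_eq_square algebra_simps\<close>)
  qed
  moreover have "\<forall>\<^sub>F y in nhds x. flat p y = poly p (1 / y) * exp (- (1 / y))"
    using eventually_nhds_in_open[of "{0<..}" x] greater
    by (auto simp: flat_def elim!: eventually_mono)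
  ultimately show ?thesis
    by (subst DERIV_cong_ev[OF refl _ refl]) auto
next
  case equal
  have "((\<lambda>h. poly (pCons 0 p) (1 / h) * exp (- (1 / h))) \<longlongrightarrow> 0) (at_right 0)"
    using filterlim_compose[OF poly_exp_decay[of "pCons 0 p"] filterlim_inverse_at_top_right]
    by (simp add: inverse_eq_divide)
  then have r: "((\<lambda>h. flat p h / h) \<longlongrightarrow> 0) (at_right 0)"
    by (rule Lim_transform_eventually)
       (auto simp: flat_def eventually_at_right_less field_simps intro!: eventually_mono[OF eventually_at_right_less])
  have l: "((\<lambda>h. flat p h / h) \<longlongrightarrow> 0) (at_left 0)"
    by (rule Lim_transform_eventually[of "\<lambda>_. 0"])
       (auto simp: flat_def eventually_at_filter)
  from l r have "((\<lambda>h. flat p h / h) \<longlongrightarrow> 0) (at 0)"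
    by (simp add: filterlim_split_at)
  then show ?thesis
    using equal by (simp add: has_field_derivative_iff flat_def)
qed

lemma smooth_order_flat: "smooth_order k (flat p)"
proof (induction k arbitrary: p)
  case 0
  then show ?case
    by (auto simp: continuous_on_eq_continuous_at intro: DERIV_isCont flat_derivative)
next
  case (Suc k)
  then show ?case using flat_derivative by auto
qed

text \<open>\<open>S\<close> rises smoothly from \<open>0\<close> to \<open>1\<close> on the unit interval, with derivative \<open>s\<close>.\<close>

definition smooth_step :: "(real \<Rightarrow> real) \<Rightarrow> (real \<Rightarrow> real) \<Rightarrow> bool" where
  "smooth_step S s \<longleftrightarrow> (\<forall>k. smooth_order k S) \<and> (\<forall>x\<le>0. S x = 0) \<and> (\<forall>x\<ge>1. S x = 1) \<and>
     (\<forall>x. 0 \<le> S x) \<and> (\<forall>x. S x \<le> 1) \<and>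
     (\<forall>x. (S has_real_derivative s x) (at x)) \<and> continuous_on UNIV s \<and>
     (\<forall>x. 0 \<le> s x) \<and> (\<forall>x. s x \<noteq> 0 \<longrightarrow> 0 < x \<and> x < 1)"

lemma smooth_stepD:
  assumes "smooth_step S s"
  shows "\<And>k. smooth_order k S" "\<And>x. x \<le> 0 \<Longrightarrow> S x = 0" "\<And>x. x \<ge> 1 \<Longrightarrow> S x = 1"
    "\<And>x. 0 \<le> S x" "\<And>x. S x \<le> 1"
    "\<And>x. (S has_real_derivative s x) (at x)" "continuous_on UNIV s" "\<And>x. 0 \<le> s x"
    "\<And>x. s x \<noteq> 0 \<Longrightarrow> 0 < x \<and> x < 1"
  using assms unfolding smooth_step_def by blast+

text \<open>Normalise an antiderivative of \<open>exp (- 1 / x) exp (- 1 / (1 - x))\<close>, continued by \<open>0\<close>.\<close>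

lemma smooth_step_exists: "\<exists>S s. smooth_step S s"
proof -
  define r where "r x = flat 1 x * flat 1 (1 - x)" for x :: real
  have r_smooth: "smooth_order k r" for k
    unfolding r_def
    using smooth_order_mult[OF smooth_order_flat smooth_order_affine[OF smooth_order_flat[of k 1], of "-1" 1]]
    by (simp add: algebra_simps)
  have r_nonneg: "0 \<le> r x" for x by (simp add: r_def flat_def)
  have r_zero: "r x = 0" if "x \<le> 0 \<or> x \<ge> 1" for x using that by (auto simp: r_def flat_def)
  have r_pos: "r x > 0" if "0 < x" "x < 1" for x using that by (auto simp: r_def flat_def)
  have cont: "continuous_on UNIV r" using r_smooth[of 0] by simp
  have "\<exists>F. \<forall>x. -\<infinity> < ereal x \<longrightarrow> ereal x < \<infinity> \<longrightarrow> (F has_vector_derivative r x) (at x)"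
    using cont by (intro einterval_antiderivative) (auto simp: continuous_on_eq_continuous_at)
  then obtain F where F: "\<And>x. (F has_real_derivative r x) (at x)"
    by (auto simp: has_real_derivative_iff_has_vector_derivative)
  have mono: "F x \<le> F y" if "x \<le> y" for x y
    using that DERIV_nonneg_imp_nondecreasing[of x y F] F r_nonneg by blast
  have low: "F x = F 0" if "x \<le> 0" for x
  proof (cases "x < 0")
    case True
    with MVT2[of x 0 F r] F obtain z where "x < z" "z < 0" "F 0 - F x = (0 - x) * r z" by blast
    then show ?thesis using r_zero[of z] by auto
  qed (use that in auto)
  have high: "F x = F 1" if "x \<ge> 1" for x
  proof (cases "x > 1")
    case True
    with MVT2[of 1 x F r] F obtain z where "1 < z" "z < x" "F x - F 1 = (x - 1) * r z" by blast
    then show ?thesis using r_zero[of z] by auto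
  qed (use that in auto)
  have "F 0 < F 1"
  proof -
    from MVT2[of 0 1 F r] F obtain z where "0 < z" "z < 1" "F 1 - F 0 = (1 - 0) * r z" by auto
    then show ?thesis using r_pos[of z] by auto
  qed
  define d where "d = F 1 - F 0"
  have d: "d > 0" using \<open>F 0 < F 1\<close> by (simp add: d_def)
  define S where "S x = (F x - F 0) / d" for x
  define s where "s x = r x / d" for x
  have S': "(S has_real_derivative s x) (at x)" for x
    unfolding S_def s_def using d by (auto intro!: derivative_eq_intros F)
  have s_smooth: "smooth_order k s" for k
    using smooth_order_mult[OF smooth_order_const[of k "1/d"] r_smooth] by (simp add: s_def[abs_def])
  have S_smooth: "smooth_order k S" for k
  proof -
    have "smooth_order (Suc k) S" using S' s_smooth by auto
    then show ?thesis by (rule smooth_order_lower)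
  qed
  have "smooth_step S s"
    unfolding smooth_step_def
  proof (intro conjI allI impI)
    show "0 \<le> S x" for x
      using mono[of 0 x] low[of x] d by (cases "0 \<le> x") (auto simp: S_def)
    show "S x \<le> 1" for x
      using mono[of x 1] high[of x] d by (cases "x \<le> 1") (auto simp: S_def d_def)
    show "S x = 0" if "x \<le> 0" for x using low[OF that] by (simp add: S_def)
    show "S x = 1" if "x \<ge> 1" for x using high[OF that] d by (simp add: S_def d_def)
    show "0 \<le> s x" for x using r_nonneg d by (simp add: s_def)
    show "continuous_on UNIV s" using s_smooth[of 0] by simp
    show "smooth_order k S" for k by (rule S_smooth)
    show "(S has_real_derivative s x) (at x)" for x by (rule S')
    show "0 < x" "x < 1" if "s x \<noteq> 0" for x using r_zero[of x] that by (force simp: s_def)+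
  qed
  then show ?thesis by blast
qed

text \<open>Steep smooth steps converge to the indicator of the positive half-line; all test functions below
approximate indicators of boxes or shells in this way.\<close>

lemma smooth_step_limit:
  assumes "smooth_step S s"
  shows "(\<lambda>m::nat. S (real m * d)) \<longlonglongrightarrow> (if 0 < d then 1 else 0)"
proof (cases "0 < d")
  case True
  obtain m0 :: nat where m0: "1 / d \<le> real m0" using real_arch_simple by auto
  have "real m * d \<ge> 1" if "m \<ge> m0" for m
  proof -
    have "1 / d \<le> real m" using m0 that by linarith
    then show ?thesis using True by (simp add: field_simps)
  qed
  then have "\<forall>\<^sub>F m in sequentially. S (real m * d) = 1"
    using smooth_stepD(3)[OF assms] by (auto simp: eventually_sequentially)
  then show ?thesis using True by (simp add: tendsto_eventually)
next
  case False
  then have "S (real m * d) = 0" for m by (intro smooth_stepD(2)[OF assms]) (simp add: mult_nonneg_nonpos)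
  then show ?thesis using False by simp
qed

lemma partial_deriv_eq: "(f has_derivative f') (at x) \<Longrightarrow> partial_deriv j f x = f' (axis j 1)"
  unfolding partial_deriv_def using frechet_derivative_at by metis

lemma C_k_lower: "C_k (Suc k) f \<Longrightarrow> C_k k f"
proof (induction k arbitrary: f)
  case 0
  then show ?case
    by (auto simp: continuous_on_eq_continuous_at intro: differentiable_imp_continuous_within)
next
  case (Suc k)
  then show ?case by (metis C_k.simps(2))
qed

lemma C_k_add: "C_k k f \<Longrightarrow> C_k k g \<Longrightarrow> C_k k (\<lambda>x. f x + g x)"
proof (induction k arbitrary: f g)
  case 0 then show ?case by (auto intro: continuous_intros)
next
  case (Suc k)
  have "partial_deriv j (\<lambda>x. f x + g x) = (\<lambda>x. partial_deriv j f x + partial_deriv j g x)" for j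
  proof
    fix x
    have "(f has_derivative frechet_derivative f (at x)) (at x)"
      "(g has_derivative frechet_derivative g (at x)) (at x)"
      using Suc.prems by (auto simp: frechet_derivative_works)
    from partial_deriv_eq[OF has_derivative_add[OF this]]
    show "partial_deriv j (\<lambda>x. f x + g x) x = partial_deriv j f x + partial_deriv j g x"
      by (simp add: partial_deriv_def)
  qed
  with Suc show ?case by auto
qed

lemma partial_deriv_mult:
  assumes "f differentiable at x" "g differentiable at x"
  shows "partial_deriv j (\<lambda>x. f x * g x) x = f x * partial_deriv j g x + partial_deriv j f x * g x"
proof -
  have "(f has_derivative frechet_derivative f (at x)) (at x)"
      "(g has_derivative frechet_derivative g (at x)) (at x)"
      using assms by (auto simp: frechet_derivative_works)
  from partial_deriv_eq[OF has_derivative_mult[OF this]]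
  show ?thesis by (simp add: partial_deriv_def)
qed

lemma C_k_mult: "C_k k f \<Longrightarrow> C_k k g \<Longrightarrow> C_k k (\<lambda>x. f x * g x)"
proof (induction k arbitrary: f g)
  case 0 then show ?case by (auto intro: continuous_intros)
next
  case (Suc k)
  have "partial_deriv j (\<lambda>x. f x * g x) = (\<lambda>x. f x * partial_deriv j g x + partial_deriv j f x * g x)" for j
    using Suc.prems by (auto simp: partial_deriv_mult)
  moreover have "C_k k f" "C_k k g" using Suc.prems C_k_lower by blast+
  ultimately show ?case using Suc by (auto intro!: C_k_add)
qed

lemma C_k_const: "C_k k (\<lambda>x::real^'n::finite. c)"
proof (induction k arbitrary: c)
  case (Suc k)
  have "partial_deriv j (\<lambda>x. c) = (\<lambda>x. 0)" for j :: 'n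
    by (rule ext, subst partial_deriv_eq[of _ "\<lambda>_. 0"]) auto
  with Suc show ?case by auto
qed auto

lemma C_k_coord: "C_k k (\<lambda>x::real^'n::finite. x $ i)"
proof (cases k)
  case (Suc m)
  have d: "((\<lambda>x::real^'n. x $ i) has_derivative (\<lambda>x. x $ i)) (at x)" for x
    by (rule bounded_linear_imp_has_derivative[OF bounded_linear_vec_nth])
  have "partial_deriv j (\<lambda>x. x $ i) = (\<lambda>x. axis j 1 $ i)" for j :: 'n
    by (rule ext, subst partial_deriv_eq[OF d]) auto
  with d C_k_const Suc show ?thesis by (auto simp: differentiable_def)
qed (auto intro: continuous_intros)

lemma partial_deriv_compose:
  assumes "(F has_real_derivative F') (at (g x))" "g differentiable at x"
  shows "(\<lambda>x. F (g x)) differentiable at x"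
    "partial_deriv j (\<lambda>x. F (g x)) x = F' * partial_deriv j g x"
proof -
  have g: "(g has_derivative frechet_derivative g (at x)) (at x)"
      using assms by (auto simp: frechet_derivative_works)
  have F: "(F has_derivative (\<lambda>h. F' * h)) (at (g x))"
    using assms by (simp add: has_field_derivative_def)
  have "((\<lambda>x. F (g x)) has_derivative (\<lambda>h. F' * frechet_derivative g (at x) h)) (at x)"
    using has_derivative_compose[OF g F] .
  from this partial_deriv_eq[OF this]
  show "partial_deriv j (\<lambda>x. F (g x)) x = F' * partial_deriv j g x"
    "(\<lambda>x. F (g x)) differentiable at x"
    by (auto simp: differentiable_def partial_deriv_def[of _ g])
qed

lemma C_k_compose: "smooth_order k F \<Longrightarrow> (\<And>j. C_k j g) \<Longrightarrow> C_k k (\<lambda>x. F (g x))"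
proof (induction k arbitrary: F)
  case 0
  from 0(2)[of 0] 0(1) show ?case
    by (auto intro: continuous_on_compose2)
next
  case (Suc k)
  then obtain F' where F': "\<And>x. (F has_real_derivative F' x) (at x)" "smooth_order k F'" by auto
  have g: "g differentiable at x" for x using Suc(3)[of "Suc 0"] by auto
  have "partial_deriv j (\<lambda>x. F (g x)) = (\<lambda>x. F' (g x) * partial_deriv j g x)" for j
    using partial_deriv_compose[OF F'(1) g] by auto
  moreover have "C_k k (partial_deriv j g)" for j using Suc(3)[of "Suc k"] by auto
  ultimately show ?case
    using partial_deriv_compose(1)[OF F'(1) g] Suc.IH[OF F'(2) Suc(3)] by (auto intro!: C_k_mult)
qed

lemma C_k_prod: "finite I \<Longrightarrow> (\<And>i. i \<in> I \<Longrightarrow> C_k k (f i)) \<Longrightarrow> C_k k (\<lambda>x. \<Prod>i\<in>I. f i x)"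
  by (induction I rule: finite_induct) (auto intro: C_k_mult C_k_const)

lemma C_k_sum: "finite I \<Longrightarrow> (\<And>i. i \<in> I \<Longrightarrow> C_k k (f i)) \<Longrightarrow> C_k k (\<lambda>x. \<Sum>i\<in>I. f i x)"
  by (induction I rule: finite_induct) (auto intro: C_k_add C_k_const)

lemma C_k_inner: "C_k k (\<lambda>x. x \<bullet> x)"
  unfolding inner_vec_def by (auto intro!: C_k_sum C_k_mult C_k_coord)

lemma test_functionI:
  assumes "\<And>k. C_k k \<phi>" "compact K" "K \<subseteq> U" "\<And>x. x \<notin> K \<Longrightarrow> \<phi> x = 0"
  shows "test_function U \<phi>"
proof -
  have "closure {x. \<phi> x \<noteq> 0} \<subseteq> K"
    using assms by (intro closure_minimal compact_imp_closed) auto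
  moreover from this have "compact (closure {x. \<phi> x \<noteq> 0})"
    using compact_Int_closed[OF assms(2) closed_closure[of "{x. \<phi> x \<noteq> 0}"]]
    by (simp add: Int_absorb1)
  ultimately show ?thesis
    unfolding test_function_def using assms by blast
qed

section \<open>Integrals of radial functions\<close>

text \<open>The area of the sphere of radius \<open>t\<close> in dimension \<open>n\<close>. It is \<open>0\<close> for \<open>t < 0\<close>, so that it can serve as
a density on the whole line.\<close>

definition sphere_area :: "nat \<Rightarrow> real \<Rightarrow> real" where
  "sphere_area n t = (if 0 \<le> t then real n * unit_ball_vol n * t ^ (n - 1) else 0)"

lemma sphere_area_nonneg: "0 \<le> sphere_area n t"
  by (auto simp: sphere_area_def intro!: mult_nonneg_nonneg)

lemma sphere_area_pos: "n > 0 \<Longrightarrow> t > 0 \<Longrightarrow> 0 < sphere_area n t"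
  by (auto simp: sphere_area_def intro!: mult_pos_pos)

lemma borel_measurable_sphere_area [measurable]: "sphere_area n \<in> borel_measurable borel"
  unfolding sphere_area_def[abs_def] by measurable

lemma measurable_lebesgueI: "f \<in> borel \<rightarrow>\<^sub>M N \<Longrightarrow> f \<in> lebesgue \<rightarrow>\<^sub>M N"
  by (rule measurable_completion) simp

text \<open>Both measures give the volume of a ball to a half-line \<open>{..x}\<close>. This is the only form of polar
coordinates that radial integrands require.\<close>

lemma distr_norm:
  "distr lebesgue borel (norm :: 'a::euclidean_space \<Rightarrow> real) =
     density lborel (\<lambda>t. ennreal (sphere_area DIM('a) t))" (is "?M = ?N")
proof (rule measure_eqI_generator_eq)
  let ?n = "DIM('a)" and ?w = "unit_ball_vol DIM('a)"
  have n: "norm \<in> lebesgue \<rightarrow>\<^sub>M (borel :: real measure)"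
    by (rule measurable_lebesgueI) simp
  show "Int_stable (range (atMost :: real \<Rightarrow> _))"
    by (auto simp: Int_stable_def)
  show "sets ?M = sigma_sets UNIV (range atMost)" "sets ?N = sigma_sets UNIV (range atMost)"
    by (auto simp: borel_eq_atMost)
  show "(\<Union>i::nat. {..real i}) = UNIV"
    by (auto intro: real_arch_simple)
  have M: "emeasure ?M {..x} = (if 0 \<le> x then ennreal (?w * x ^ ?n) else 0)" for x
  proof -
    have "emeasure ?M {..x} = emeasure lebesgue (norm -` {..x} :: 'a set)"
      using n by (subst emeasure_distr) auto
    also have "norm -` {..x} = (cball 0 x :: 'a set)"
      by (auto simp: dist_norm)
    also have "emeasure lebesgue (cball 0 x :: 'a set) = emeasure lborel (cball 0 x :: 'a set)"
      by (simp add: emeasure_completion)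
    also have "\<dots> = (if 0 \<le> x then ennreal (?w * x ^ ?n) else 0)"
      by (simp add: emeasure_cball)
    finally show ?thesis .
  qed
  have N: "emeasure ?N {..x} = (if 0 \<le> x then ennreal (?w * x ^ ?n) else 0)" for x
  proof (cases "0 \<le> x")
    case True
    have "emeasure ?N {..x} = (\<integral>\<^sup>+t. ennreal (?n * ?w * t ^ (?n - 1)) * indicator {0..x} t \<partial>lborel)"
      by (subst emeasure_density) (auto intro!: nn_integral_cong simp: sphere_area_def indicator_def)
    also have "\<dots> = ?w * x ^ ?n - ?w * 0 ^ ?n"
      using True
      by (intro nn_integral_FTC_Icc) (auto intro!: derivative_eq_intros mult_nonneg_nonneg simp: ac_simps)
    finally show ?thesis using True by simp
  next
    case False
    have "emeasure ?N {..x} = (\<integral>\<^sup>+t. ennreal (sphere_area ?n t) * indicator {..x} t \<partial>lborel)"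
      by (subst emeasure_density) auto
    also have "\<dots> = (\<integral>\<^sup>+t. 0 \<partial>(lborel :: real measure))"
      using False by (intro nn_integral_cong) (auto simp: sphere_area_def indicator_def)
    finally show ?thesis using False by simp
  qed
  show "emeasure ?M X = emeasure ?N X" if "X \<in> range atMost" for X
    using that M N by auto
  show "emeasure ?M {..real i} \<noteq> \<infinity>" for i by (simp add: M)
qed auto

lemma measurable_norm_lebesgue [measurable]:
  "(norm :: 'a::euclidean_space \<Rightarrow> real) \<in> lebesgue \<rightarrow>\<^sub>M borel"
  by (rule measurable_lebesgueI) simp

lemma nn_integral_norm:
  assumes "f \<in> borel_measurable borel"
  shows "(\<integral>\<^sup>+x. f (norm (x::'a::euclidean_space)) \<partial>lebesgue) =
    (\<integral>\<^sup>+t. ennreal (sphere_area DIM('a) t) * f t \<partial>lborel)"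
proof -
  have "(\<integral>\<^sup>+x. f (norm (x::'a)) \<partial>lebesgue) = (\<integral>\<^sup>+t. f t \<partial>distr lebesgue borel (norm :: 'a \<Rightarrow> real))"
    using assms by (subst nn_integral_distr) auto
  then show ?thesis
    using assms by (simp add: distr_norm nn_integral_density)
qed

lemma
  fixes f :: "real \<Rightarrow> real"
  assumes "f \<in> borel_measurable borel"
  shows integrable_norm_iff: "integrable lebesgue (\<lambda>x::'a::euclidean_space. f (norm x)) \<longleftrightarrow>
      integrable lborel (\<lambda>t. sphere_area DIM('a) t * f t)"
    and integral_norm: "(\<integral>x. f (norm (x::'a)) \<partial>lebesgue) =
      (\<integral>t. sphere_area DIM('a) t * f t \<partial>lborel)"
proof -
  have "integrable lebesgue (\<lambda>x::'a. f (norm x)) \<longleftrightarrow>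
      integrable (distr lebesgue borel (norm :: 'a \<Rightarrow> real)) f"
    using assms by (subst integrable_distr_eq) auto
  then show "integrable lebesgue (\<lambda>x::'a::euclidean_space. f (norm x)) \<longleftrightarrow>
      integrable lborel (\<lambda>t. sphere_area DIM('a) t * f t)"
    using assms by (simp add: distr_norm integrable_density sphere_area_nonneg)
  have "(\<integral>x. f (norm (x::'a)) \<partial>lebesgue) = (\<integral>t. f t \<partial>distr lebesgue borel (norm :: 'a \<Rightarrow> real))"
    using assms by (subst integral_distr) auto
  then show "(\<integral>x. f (norm (x::'a)) \<partial>lebesgue) =
      (\<integral>t. sphere_area DIM('a) t * f t \<partial>lborel)"
    using assms by (simp add: distr_norm integral_density sphere_area_nonneg)
qed

text \<open>Integration in polar coordinates turns null sets of radii into null sets of points.\<close>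

lemma AE_norm:
  assumes "AE t in lborel. P t"
  shows "AE x in lebesgue. P (norm (x::'a::euclidean_space))"
proof -
  obtain N where N: "N \<in> null_sets lborel" "\<And>t. \<not> P t \<Longrightarrow> t \<in> N"
    using assms by (auto simp: eventually_ae_filter)
  have "emeasure (distr lebesgue borel (norm :: 'a \<Rightarrow> real)) N = 0"
  proof -
    have [measurable]: "N \<in> sets borel" using N(1) by auto
    have "(\<integral>\<^sup>+t. ennreal (sphere_area DIM('a) t) * indicator N t \<partial>lborel) = 0"
      using AE_not_in[OF N(1)]
      by (subst nn_integral_0_iff_AE) (auto elim!: eventually_mono)
    then show ?thesis unfolding distr_norm by (subst emeasure_density) auto
  qed
  then have "emeasure lebesgue (norm -` N :: 'a set) = 0"
    using N(1) by (subst (asm) emeasure_distr) auto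
  moreover have "(norm -` N :: 'a set) \<in> sets lebesgue"
    using N(1) measurable_sets[OF measurable_norm_lebesgue, of N] by auto
  ultimately have "(norm -` N :: 'a set) \<in> null_sets lebesgue" by auto
  then show ?thesis by (rule AE_I') (use N(2) in auto)
qed

section \<open>Integrable functions tested on boxes, and their continuous approximation\<close>

text \<open>The positive and the negative part of the function are densities of two finite measures that
agree on boxes, and boxes form an intersection-stable generator of the Borel sets. The function is first changed on a
null set to make it Borel measurable.\<close>

lemma AE_eq_0_if_box_integrals_0:
  fixes f :: "'a::euclidean_space \<Rightarrow> real"
  assumes f: "integrable lebesgue f" and z: "\<And>a b. (\<integral>x. indicator (box a b) x * f x \<partial>lebesgue) = 0"
  shows "AE x in lebesgue. f x = 0"
proof -
  obtain g where g: "g \<in> borel_measurable lborel" and fg: "AE x in lborel. f x = g x"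
    using completion_ex_borel_measurable_real[of f lborel] f by auto
  have fg': "AE x in lebesgue. f x = g x" using fg by (rule AE_completion)
  have g_meas [measurable]: "g \<in> borel_measurable borel" using g by simp
  have measurable_lebesgue_g: "g \<in> borel_measurable lebesgue" by (rule measurable_completion[OF g])
  have gL: "integrable lebesgue g"
    by (rule integrable_cong_AE_imp[OF f measurable_lebesgue_g]) (use fg' in eventually_elim, simp)
  have gi: "integrable lborel g" using gL by (simp add: integrable_completion)
  have zg: "(\<integral>x. indicator (box a b) x * g x \<partial>lborel) = 0" for a b
  proof -
    have "(\<integral>x. indicator (box a b) x * g x \<partial>lborel) = (\<integral>x. indicator (box a b) x * g x \<partial>lebesgue)"
      by (subst integral_completion) auto
    also have "\<dots> = (\<integral>x. indicator (box a b) x * f x \<partial>lebesgue)"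
    proof (rule integral_cong_AE)
      show "AE x in lebesgue. indicator (box a b) x * g x = indicator (box a b) x * f x"
        using fg' by eventually_elim simp
    qed (use f measurable_lebesgue_g in \<open>auto intro!: borel_measurable_times borel_measurable_indicator\<close>)
    finally show ?thesis using z by simp
  qed
  \<comment> \<open>the two measures whose equality is to be shown\<close>
  define P where "P = density lborel (\<lambda>x. ennreal (g x))"
  define N where "N = density lborel (\<lambda>x. ennreal (- g x))"
  have box: "emeasure P (box a b) = emeasure N (box a b)" for a b
  proof -
    have i: "integrable lborel (\<lambda>x. indicator (box a b) x * g x)"
      using gi integrable_mult_indicator[of "box a b" lborel g] by simp
    have 1: "(\<integral>\<^sup>+x. ennreal (indicator (box a b) x * g x) \<partial>lborel) = emeasure P (box a b)"
      unfolding P_def by (subst emeasure_density) (auto intro!: nn_integral_cong simp: indicator_def)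
    have 2: "(\<integral>\<^sup>+x. ennreal (- (indicator (box a b) x * g x)) \<partial>lborel) = emeasure N (box a b)"
      unfolding N_def by (subst emeasure_density) (auto intro!: nn_integral_cong simp: indicator_def)
    have "enn2real (emeasure P (box a b)) = enn2real (emeasure N (box a b))"
      using zg[of a b] real_lebesgue_integral_def[OF i] by (simp add: 1 2)
    moreover have "emeasure P (box a b) < \<infinity>" "emeasure N (box a b) < \<infinity>"
      using i unfolding real_integrable_def 1 2 by (simp_all add: less_top)
    ultimately show ?thesis
      by (cases "emeasure P (box a b)"; cases "emeasure N (box a b)") auto
  qed
  have fin: "emeasure P (box a b) \<noteq> \<infinity>" for a b
  proof -
    have i: "integrable lborel (\<lambda>x. indicator (box a b) x * g x)"
      using gi integrable_mult_indicator[of "box a b" lborel g] by simp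
    have 1: "(\<integral>\<^sup>+x. ennreal (indicator (box a b) x * g x) \<partial>lborel) = emeasure P (box a b)"
      unfolding P_def by (subst emeasure_density) (auto intro!: nn_integral_cong simp: indicator_def)
    show ?thesis using i unfolding real_integrable_def 1 by auto
  qed
  have "P = N"
  proof (rule measure_eqI_generator_eq)
    show "Int_stable (range (\<lambda>(a, b). box a b :: 'a set))"
      by (auto simp: Int_stable_def box_Int_box)
    show "emeasure P X = emeasure N X" if "X \<in> range (\<lambda>(a, b). box a b :: 'a set)" for X
      using that box by auto
    show "sets P = sigma_sets UNIV (range (\<lambda>(a, b). box a b))"
      "sets N = sigma_sets UNIV (range (\<lambda>(a, b). box a b))"
      by (auto simp: P_def N_def borel_eq_box)
    show "(\<Union>i::nat. box (- (real i *\<^sub>R One)) (real i *\<^sub>R One)) = (UNIV :: 'a set)"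
      by (rule UN_box_eq_UNIV)
    show "range (\<lambda>i::nat. box (- (real i *\<^sub>R One)) (real i *\<^sub>R One)) \<subseteq> range (\<lambda>(a, b). box a b :: 'a set)"
      by auto
  qed (use fin in auto)
  then have "AE x in lborel. ennreal (g x) = ennreal (- g x)"
    unfolding P_def N_def
    by (intro sigma_finite_measure.density_unique[OF sigma_finite_lborel]) auto
  then have "AE x in lborel. g x = 0"
  proof eventually_elim
    case (elim x)
    then show ?case by (cases "0 \<le> g x") (auto simp: ennreal_neg ennreal_eq_0_iff)
  qed
  with fg have "AE x in lborel. f x = 0" by eventually_elim simp
  then show ?thesis by (rule AE_completion)
qed

text \<open>A measurable function is an almost everywhere limit of continuous functions. For a bounded one these
can be truncated at the same bound, after which dominated convergence gives convergence in the mean.\<close>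

lemma L1_approx_bounded:
  fixes f :: "real \<Rightarrow> real"
  assumes f: "integrable lborel f" "\<And>x. \<bar>f x\<bar> \<le> C" "\<And>x. x \<notin> {a..b} \<Longrightarrow> f x = 0" and "e > 0"
  obtains g where "continuous_on UNIV g" "(\<integral>x. indicator {a..b} x * \<bar>g x - f x\<bar> \<partial>lborel) < e"
proof -
  have "f \<in> borel_measurable lebesgue"
    using f(1) by (intro measurable_completion) auto
  then have "f measurable_on UNIV"
    by (intro lebesgue_measurable_imp_measurable_on_real) auto
  then obtain N g where N: "negligible N" and g: "\<And>n. continuous_on UNIV (g n)"
    and lim: "\<And>x. x \<notin> N \<Longrightarrow> (\<lambda>n. g n x) \<longlonglongrightarrow> f x"
    unfolding measurable_on_def by auto
  define h where "h n x = max (- C) (min C (g n x))" for n x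
  have h: "continuous_on UNIV (h n)" for n
    unfolding h_def by (intro continuous_intros g)
  have C: "0 \<le> C" using f(2)[of 0] by auto
  have AE: "AE x in lebesgue. x \<notin> N"
    using N by (simp add: AE_not_in negligible_iff_null_sets)
  have [measurable]: "h n \<in> borel_measurable borel" for n
    by (rule borel_measurable_continuous_onI[OF h])
  have [measurable]: "f \<in> borel_measurable borel" using f(1) by auto
  have "(\<lambda>n. \<integral>x. indicator {a..b} x * \<bar>h n x - f x\<bar> \<partial>lebesgue) \<longlonglongrightarrow> (\<integral>x. 0 \<partial>(lebesgue :: real measure))"
  proof (rule integral_dominated_convergence)
    show "AE x in lebesgue. (\<lambda>n. indicator {a..b} x * \<bar>h n x - f x\<bar>) \<longlonglongrightarrow> 0"
      using AE
    proof eventually_elim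
      case (elim x)
      have "(\<lambda>n. h n x) \<longlonglongrightarrow> max (- C) (min C (f x))"
        unfolding h_def by (intro tendsto_intros lim elim)
      moreover have "max (- C) (min C (f x)) = f x" using f(2)[of x] by auto
      ultimately have "(\<lambda>n. indicator {a..b} x * \<bar>h n x - f x\<bar>) \<longlonglongrightarrow> indicator {a..b} x * \<bar>f x - f x\<bar>"
        by (intro tendsto_intros) simp
      then show ?case by simp
    qed
    show "AE x in lebesgue. norm (indicator {a..b} x * \<bar>h n x - f x\<bar>) \<le> indicator {a..b} x * (2 * C)" for n
    proof (rule AE_I2)
      fix x
      have "\<bar>h n x\<bar> \<le> C" using C by (auto simp: h_def)
      then show "norm (indicator {a..b} x * \<bar>h n x - f x\<bar>) \<le> indicator {a..b} x * (2 * C)"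
        using f(2)[of x] by (auto simp: indicator_def)
    qed
    show "integrable lebesgue (\<lambda>x. indicator {a..b} x * (2 * C))"
    proof -
      have "integrable lborel (indicat_real {a..b})"
        by (rule integrable_real_indicator) (auto simp: emeasure_lborel_Icc_eq)
      then show ?thesis by (subst integrable_completion) auto
    qed
  qed (auto intro!: measurable_completion)
  then have "\<forall>\<^sub>F n in sequentially. (\<integral>x. indicator {a..b} x * \<bar>h n x - f x\<bar> \<partial>lebesgue) < e"
    using \<open>e > 0\<close> by (simp add: order_tendsto_iff)
  then obtain n where "(\<integral>x. indicator {a..b} x * \<bar>h n x - f x\<bar> \<partial>lebesgue) < e"
    by (auto simp: eventually_sequentially)
  then have "(\<integral>x. indicator {a..b} x * \<bar>h n x - f x\<bar> \<partial>lborel) < e"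
    by (subst (asm) integral_completion) auto
  with h show thesis by (rule that)
qed

text \<open>Truncation reduces the claim to bounded functions.\<close>

lemma L1_approx:
  fixes f :: "real \<Rightarrow> real"
  assumes f: "integrable lborel f" "\<And>x. x \<notin> {a..b} \<Longrightarrow> f x = 0" and "e > 0"
  obtains g where "continuous_on UNIV g" "(\<integral>x. indicator {a..b} x * \<bar>g x - f x\<bar> \<partial>lborel) < e"
proof -
  have [measurable]: "f \<in> borel_measurable borel" using f(1) by auto
  define F where "F n x = max (- real n) (min (real n) (f x))" for n x
  have "(\<lambda>n. \<integral>x. \<bar>F n x - f x\<bar> \<partial>lborel) \<longlonglongrightarrow> (\<integral>x. 0 \<partial>(lborel :: real measure))"
  proof (rule integral_dominated_convergence)
    show "AE x in lborel. (\<lambda>n. \<bar>F n x - f x\<bar>) \<longlonglongrightarrow> 0"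
    proof (rule AE_I2)
      fix x
      obtain m :: nat where "\<bar>f x\<bar> \<le> m" using real_arch_simple by blast
      then have "\<bar>F n x - f x\<bar> = 0" if "n \<ge> m" for n using that by (auto simp: F_def)
      then show "(\<lambda>n. \<bar>F n x - f x\<bar>) \<longlonglongrightarrow> 0"
        by (intro tendsto_eventually) (auto simp: eventually_sequentially)
    qed
    show "integrable lborel (\<lambda>x. \<bar>f x\<bar>)" using f by auto
    show "AE x in lborel. norm \<bar>F n x - f x\<bar> \<le> \<bar>f x\<bar>" for n
      by (rule AE_I2) (auto simp: F_def)
  qed (auto simp: F_def)
  then have "\<forall>\<^sub>F n in sequentially. (\<integral>x. \<bar>F n x - f x\<bar> \<partial>lborel) < e / 2"
    using \<open>e > 0\<close> by (intro order_tendstoD(2)[of _ 0]) auto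
  then obtain n where n: "(\<integral>x. \<bar>F n x - f x\<bar> \<partial>lborel) < e / 2"
    by (auto simp: eventually_sequentially)
  have Fi: "integrable lborel (F n)"
    by (rule Bochner_Integration.integrable_bound[OF f(1)]) (auto simp: F_def[abs_def])
  obtain g where g: "continuous_on UNIV g" "(\<integral>x. indicator {a..b} x * \<bar>g x - F n x\<bar> \<partial>lborel) < e / 2"
    by (rule L1_approx_bounded[OF Fi, of "real n" a b "e/2"])
       (use f \<open>e > 0\<close> in \<open>auto simp: F_def\<close>)
  have [measurable]: "g \<in> borel_measurable borel" by (rule borel_measurable_continuous_onI[OF g(1)])
  have gi: "integrable lborel (\<lambda>x. indicator {a..b} x * g x)"
    using borel_integrable_compact[of "{a..b}" g] continuous_on_subset[OF g(1)] by (auto simp: mult.commute)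
  have i1: "integrable lborel (\<lambda>x. indicator {a..b} x * \<bar>g x - F n x\<bar>)"
  proof -
    have "(\<lambda>x. indicator {a..b} x * \<bar>g x - F n x\<bar>) =
        (\<lambda>x. \<bar>indicator {a..b} x * g x - indicator {a..b} x * F n x\<bar>)"
      by (auto simp: indicator_def fun_eq_iff)
    then show ?thesis
      using gi integrable_mult_indicator[OF _ Fi, of "{a..b}"] by simp
  qed
  have i2: "integrable lborel (\<lambda>x. \<bar>F n x - f x\<bar>)" using Fi f by auto
  have "(\<integral>x. indicator {a..b} x * \<bar>g x - f x\<bar> \<partial>lborel) \<le>
      (\<integral>x. indicator {a..b} x * \<bar>g x - F n x\<bar> + \<bar>F n x - f x\<bar> \<partial>lborel)"
    by (rule integral_mono') (use i1 i2 in \<open>auto simp: indicator_def\<close>)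
  also have "\<dots> < e" using i1 i2 g n by simp
  finally show thesis using g that by blast
qed

section \<open>Primitives of integrable functions\<close>

text \<open>\<open>F\<close> is absolutely continuous on \<open>[a, b]\<close> with derivative \<open>f\<close>, expressed through the integral because
\<open>F\<close> need not be differentiable at any given point.\<close>

definition is_primitive :: "real \<Rightarrow> real \<Rightarrow> (real \<Rightarrow> real) \<Rightarrow> (real \<Rightarrow> real) \<Rightarrow> bool" where
  "is_primitive a b F f \<longleftrightarrow> continuous_on {a..b} F \<and> set_integrable lborel {a..b} f \<and>
     (\<forall>t\<in>{a..b}. F t - F a = (LINT s:{a..t}|lborel. f s))"

lemma is_primitive_subinterval:
  assumes "is_primitive a b F f" "a \<le> c" "c \<le> d" "d \<le> b"
  shows "is_primitive c d F f"
proof -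
  have i: "set_integrable lborel {a..b} f" and F: "\<And>t. t \<in> {a..b} \<Longrightarrow> F t - F a = (LINT s:{a..t}|lborel. f s)"
    using assms by (auto simp: is_primitive_def)
  have "F t - F c = (LINT s:{c..t}|lborel. f s)" if "t \<in> {c..d}" for t
  proof -
    have "{a..t} = {a..c} \<union> {c<..t}" using that assms by auto
    then have "(LINT s:{a..t}|lborel. f s) = (LINT s:{a..c} \<union> {c<..t}|lborel. f s)" by simp
    also have "\<dots> = (LINT s:{a..c}|lborel. f s) + (LINT s:{c<..t}|lborel. f s)"
      by (rule set_integral_Un) (use that assms in \<open>auto intro: set_integrable_subset[OF i]\<close>)
    also have "(LINT s:{c<..t}|lborel. f s) = (LINT s:{c..t}|lborel. f s)"
      unfolding set_lebesgue_integral_def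
    proof (rule integral_cong_AE)
      show "AE x in lborel. indicat_real {c<..t} x *\<^sub>R f x = indicat_real {c..t} x *\<^sub>R f x"
        using AE_lborel_singleton[of c] by eventually_elim (auto simp: indicator_def)
      have "set_integrable lborel {c<..t} f" "set_integrable lborel {c..t} f"
        using that assms by (auto intro: set_integrable_subset[OF i])
      then show "(\<lambda>x. indicat_real {c<..t} x *\<^sub>R f x) \<in> borel_measurable lborel"
         "(\<lambda>x. indicat_real {c..t} x *\<^sub>R f x) \<in> borel_measurable lborel"
        by (auto simp: set_integrable_def)
    qed
    finally show ?thesis using F[of t] F[of c] that assms by auto
  qed
  moreover have "set_integrable lborel {c..d} f"
    using assms by (auto intro: set_integrable_subset[OF i])
  moreover have "continuous_on {c..d} F"
    using assms by (auto simp: is_primitive_def intro: continuous_on_subset)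
  ultimately show ?thesis by (auto simp: is_primitive_def)
qed

lemma is_primitive_C1:
  assumes "\<And>t. t \<in> {a..b} \<Longrightarrow> (F has_real_derivative f t) (at t within {a..b})" "continuous_on {a..b} f"
  shows "is_primitive a b F f"
  unfolding is_primitive_def
proof (intro conjI ballI)
  show "continuous_on {a..b} F"
    by (rule DERIV_continuous_on) (rule assms(1))
  show "set_integrable lborel {a..b} f"
    using assms(2) by (rule borel_integrable_atLeastAtMost')
  show "F t - F a = (LINT s:{a..t}|lborel. f s)" if "t \<in> {a..b}" for t
  proof -
    have "(F has_vector_derivative f x) (at x within {a..t})" if "a \<le> x" "x \<le> t" for x
      using assms(1)[of x] that \<open>t \<in> {a..b}\<close>
      by (auto simp: has_real_derivative_iff_has_vector_derivative intro: has_vector_derivative_within_subset)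
    moreover have "continuous_on {a..t} f"
      by (rule continuous_on_subset[OF assms(2)]) (use that in auto)
    ultimately show ?thesis
      using integral_FTC_Icc[of a t F f] that by (auto simp: set_lebesgue_integral_def)
  qed
qed

text \<open>Fubini on the square: \<open>f s * u r\<close> is integrated over the triangles \<open>r \<le> s\<close> and \<open>s < r\<close>. Each gives one of
the two summands of the product rule, and together they give \<open>(F b - F a) * (U b - U a)\<close>.\<close>

lemma primitive_product_endpoint:
  assumes F: "is_primitive a b F f" and U: "is_primitive a b U u" and ab: "a \<le> b"
  shows "F b * U b - F a * U a = (LINT t:{a..b}|lborel. f t * U t + F t * u t)"
proof -
  define f0 where "f0 t = indicator {a..b} t * f t" for t
  define u0 where "u0 t = indicator {a..b} t * u t" for t
  have f0: "integrable lborel f0" and u0: "integrable lborel u0"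
    using F U by (auto simp: is_primitive_def set_integrable_def f0_def[abs_def] u0_def[abs_def])
  then have [measurable]: "f0 \<in> borel_measurable borel" "u0 \<in> borel_measurable borel" by auto
  have Fd: "F t - F a = (\<integral>s. indicator {s. s \<le> t} s * f0 s \<partial>lborel)" if "t \<in> {a..b}" for t
  proof -
    have "F t - F a = (\<integral>s. indicator {a..t} s *\<^sub>R f s \<partial>lborel)"
      using F that by (simp add: is_primitive_def set_lebesgue_integral_def)
    also have "(\<lambda>s. indicator {a..t} s *\<^sub>R f s) = (\<lambda>s. indicator {s. s \<le> t} s * f0 s)"
      using that by (auto simp: f0_def indicator_def fun_eq_iff)
    finally show ?thesis .
  qed
  have Ud: "U t - U a = (\<integral>s. indicator {s. s \<le> t} s * u0 s \<partial>lborel)" if "t \<in> {a..b}" for t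
  proof -
    have "U t - U a = (\<integral>s. indicator {a..t} s *\<^sub>R u s \<partial>lborel)"
      using U that by (simp add: is_primitive_def set_lebesgue_integral_def)
    also have "(\<lambda>s. indicator {a..t} s *\<^sub>R u s) = (\<lambda>s. indicator {s. s \<le> t} s * u0 s)"
      using that by (auto simp: u0_def indicator_def fun_eq_iff)
    finally show ?thesis .
  qed
  have Fd': "F t - F a = (\<integral>s. indicator {s. s < t} s * f0 s \<partial>lborel)" if "t \<in> {a..b}" for t
    unfolding Fd[OF that]
  proof (rule integral_cong_AE)
    show "AE s in lborel. indicator {s. s \<le> t} s * f0 s = indicator {s. s < t} s * f0 s"
      using AE_lborel_singleton[of t] by eventually_elim (auto simp: indicator_def)
  qed auto
  have Fb: "F b - F a = (\<integral>s. f0 s \<partial>lborel)" and Ub: "U b - U a = (\<integral>s. u0 s \<partial>lborel)"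
    using Fd[of b] Ud[of b] ab
    by (auto intro!: Bochner_Integration.integral_cong simp: f0_def u0_def indicator_def)
  have P: "integrable (lborel \<Otimes>\<^sub>M lborel) (\<lambda>(s, r). f0 s * u0 r)"
  proof (rule lborel_pair.Fubini_integrable)
    show "integrable lborel (\<lambda>x. LBINT y. norm (case (x, y) of (s, r) \<Rightarrow> f0 s * u0 r))"
      using integrable_mult_left[OF integrable_norm[OF f0], of "\<integral>y. \<bar>u0 y\<bar> \<partial>lborel"] by (simp add: abs_mult)
    show "AE x in lborel. integrable lborel (\<lambda>y. case (x, y) of (s, r) \<Rightarrow> f0 s * u0 r)"
      using u0 by auto
  qed auto
  have P1: "integrable (lborel \<Otimes>\<^sub>M lborel) (\<lambda>(s, r). indicator {x. x \<le> s} r * (f0 s * u0 r))"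
    by (rule Bochner_Integration.integrable_bound[OF P]) (auto simp: indicator_def split: prod.split)
  have P2: "integrable (lborel \<Otimes>\<^sub>M lborel) (\<lambda>(s, r). indicator {x. x < r} s * (f0 s * u0 r))"
    by (rule Bochner_Integration.integrable_bound[OF P]) (auto simp: indicator_def split: prod.split)
  have I1: "integrable lborel (\<lambda>s. f0 s * (U s - U a))"
    "(\<integral>s. f0 s * (U s - U a) \<partial>lborel) = (\<integral>p. (case p of (s, r) \<Rightarrow> indicator {x. x \<le> s} r * (f0 s * u0 r)) \<partial>(lborel \<Otimes>\<^sub>M lborel))"
  proof -
    have eq: "f0 s * (U s - U a) = (\<integral>r. indicator {x. x \<le> s} r * (f0 s * u0 r) \<partial>lborel)" for s
    proof (cases "s \<in> {a..b}")
      case True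
      then show ?thesis by (simp add: Ud mult.left_commute)
    qed (simp add: f0_def)
    show "integrable lborel (\<lambda>s. f0 s * (U s - U a))"
      unfolding eq using lborel_pair.integrable_fst[OF P1] by simp
    show "(\<integral>s. f0 s * (U s - U a) \<partial>lborel) = (\<integral>p. (case p of (s, r) \<Rightarrow> indicator {x. x \<le> s} r * (f0 s * u0 r)) \<partial>(lborel \<Otimes>\<^sub>M lborel))"
      unfolding eq using lborel_pair.integral_fst[OF P1] by simp
  qed
  have I2: "integrable lborel (\<lambda>r. (F r - F a) * u0 r)"
    "(\<integral>r. (F r - F a) * u0 r \<partial>lborel) = (\<integral>p. (case p of (s, r) \<Rightarrow> indicator {x. x < r} s * (f0 s * u0 r)) \<partial>(lborel \<Otimes>\<^sub>M lborel))"
  proof -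
    have eq: "(F r - F a) * u0 r = (\<integral>s. indicator {x. x < r} s * (f0 s * u0 r) \<partial>lborel)" for r
    proof (cases "r \<in> {a..b}")
      case True
      then show ?thesis by (simp add: Fd' flip: mult.assoc)
    qed (simp add: u0_def)
    show "integrable lborel (\<lambda>r. (F r - F a) * u0 r)"
      unfolding eq using lborel_pair.integrable_snd[OF P2] by simp
    show "(\<integral>r. (F r - F a) * u0 r \<partial>lborel) = (\<integral>p. (case p of (s, r) \<Rightarrow> indicator {x. x < r} s * (f0 s * u0 r)) \<partial>(lborel \<Otimes>\<^sub>M lborel))"
      unfolding eq using lborel_pair.integral_snd[OF P2] by simp
  qed
  have "(\<integral>s. f0 s * (U s - U a) \<partial>lborel) + (\<integral>r. (F r - F a) * u0 r \<partial>lborel) =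
      (\<integral>p. (case p of (s, r) \<Rightarrow> f0 s * u0 r) \<partial>(lborel \<Otimes>\<^sub>M lborel))"
    unfolding I1(2) I2(2) Bochner_Integration.integral_add[OF P1 P2, symmetric]
    by (rule Bochner_Integration.integral_cong) (auto simp: indicator_def)
  also have "\<dots> = (F b - F a) * (U b - U a)"
    using lborel_pair.integral_fst[OF P] by (simp add: Fb Ub)
  finally have main: "(\<integral>s. f0 s * (U s - U a) \<partial>lborel) + (\<integral>r. (F r - F a) * u0 r \<partial>lborel) = (F b - F a) * (U b - U a)" .
  have "(LINT t:{a..b}|lborel. f t * U t + F t * u t) =
      (\<integral>t. (f0 t * (U t - U a) + (F t - F a) * u0 t) + (f0 t * U a + F a * u0 t) \<partial>lborel)"
    unfolding set_lebesgue_integral_def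
    by (intro Bochner_Integration.integral_cong) (auto simp: f0_def u0_def indicator_def algebra_simps)
  also have "\<dots> = (F b - F a) * (U b - U a) + ((F b - F a) * U a + F a * (U b - U a))"
    using I1(1) I2(1) f0 u0 main by (simp add: Fb Ub)
  finally show ?thesis by (simp add: algebra_simps)
qed

lemma set_integrable_mult_continuous:
  fixes f U :: "real \<Rightarrow> real"
  assumes "set_integrable lborel {a..b} f" "continuous_on {a..b} U"
  shows "set_integrable lborel {a..b} (\<lambda>t. f t * U t)"
proof -
  have "compact (U ` {a..b})" using assms by (intro compact_continuous_image) auto
  then have "bounded (U ` {a..b})" by (rule compact_imp_bounded)
  then obtain C where "\<forall>x\<in>U ` {a..b}. norm x \<le> C"
    by (auto simp only: bounded_iff)
  then have C: "\<bar>U t\<bar> \<le> C" if "t \<in> {a..b}" for t using that by auto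
  have m: "(\<lambda>t. indicator {a..b} t * U t) \<in> borel_measurable lborel"
    using borel_measurable_continuous_on_indicator[OF _ assms(2)] by simp
  show ?thesis
    unfolding set_integrable_def
  proof (rule Bochner_Integration.integrable_bound)
    show "integrable lborel (\<lambda>t. C * (indicator {a..b} t *\<^sub>R f t))"
      using assms(1) by (auto simp: set_integrable_def)
    have "(\<lambda>t. (indicator {a..b} t *\<^sub>R f t) * (indicator {a..b} t * U t)) \<in> borel_measurable lborel"
      using assms(1) m by (auto simp: set_integrable_def)
    then show "(\<lambda>t. indicator {a..b} t *\<^sub>R (f t * U t)) \<in> borel_measurable lborel"
      by (rule measurable_cong[THEN iffD1, rotated]) (auto simp: indicator_def)
    have "norm (indicator {a..b} t *\<^sub>R (f t * U t)) \<le> norm (C * (indicator {a..b} t *\<^sub>R f t))" for t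
      using C[of t] mult_left_mono[of "\<bar>U t\<bar>" C "\<bar>f t\<bar>"] by (auto simp: indicator_def abs_mult mult.commute)
    then show "AE t in lborel. norm (indicator {a..b} t *\<^sub>R (f t * U t)) \<le> norm (C * (indicator {a..b} t *\<^sub>R f t))"
      by auto
  qed
qed

lemma is_primitive_mult:
  assumes F: "is_primitive a b F f" and U: "is_primitive a b U u"
  shows "is_primitive a b (\<lambda>t. F t * U t) (\<lambda>t. f t * U t + F t * u t)"
  unfolding is_primitive_def
proof (intro conjI ballI)
  show "continuous_on {a..b} (\<lambda>t. F t * U t)"
    using F U by (auto simp: is_primitive_def intro!: continuous_intros)
  show "set_integrable lborel {a..b} (\<lambda>t. f t * U t + F t * u t)"
  proof (rule set_integral_add)
    show "set_integrable lborel {a..b} (\<lambda>t. f t * U t)"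
      using F U by (intro set_integrable_mult_continuous) (auto simp: is_primitive_def)
    have "set_integrable lborel {a..b} (\<lambda>t. u t * F t)"
      using F U by (intro set_integrable_mult_continuous) (auto simp: is_primitive_def)
    moreover have "(\<lambda>t. F t * u t) = (\<lambda>t. u t * F t)" by (simp add: fun_eq_iff)
    ultimately show "set_integrable lborel {a..b} (\<lambda>t. F t * u t)" by simp
  qed
  fix t assume "t \<in> {a..b}"
  then show "F t * U t - F a * U a = (LINT s:{a..t}|lborel. f s * U s + F s * u s)"
    by (intro primitive_product_endpoint is_primitive_subinterval[OF F] is_primitive_subinterval[OF U]) auto
qed

lemma is_primitive_power:
  assumes F: "is_primitive a b F f"
  shows "is_primitive a b (\<lambda>t. F t ^ k) (\<lambda>t. real k * F t ^ (k - 1) * f t)"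
proof (induction k)
  case 0
  show ?case by (rule is_primitive_C1) auto
next
  case (Suc k)
  have "(\<lambda>t. f t * F t ^ k + F t * (real k * F t ^ (k - 1) * f t)) = (\<lambda>t. real (Suc k) * F t ^ (Suc k - 1) * f t)"
    by (cases k) (auto simp: algebra_simps)
  with is_primitive_mult[OF F Suc] show ?case by simp
qed

lemma is_primitive_diff:
  assumes F: "is_primitive a b F f" and U: "is_primitive a b U u"
  shows "is_primitive a b (\<lambda>t. F t - U t) (\<lambda>t. f t - u t)"
  unfolding is_primitive_def
proof (intro conjI ballI)
  show "continuous_on {a..b} (\<lambda>t. F t - U t)"
    using F U by (auto simp: is_primitive_def intro!: continuous_intros)
  show "set_integrable lborel {a..b} (\<lambda>t. f t - u t)"
    using F U by (intro set_integral_diff(1)) (auto simp: is_primitive_def)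
  fix t assume t: "t \<in> {a..b}"
  then have "set_integrable lborel {a..t} f" "set_integrable lborel {a..t} u"
    using F U by (auto simp: is_primitive_def intro: set_integrable_subset)
  then have "(LINT s:{a..t}|lborel. f s - u s) =
      (LINT s:{a..t}|lborel. f s) - (LINT s:{a..t}|lborel. u s)"
    by (rule set_integral_diff(2))
  moreover have "F t - F a = (LINT s:{a..t}|lborel. f s)" "U t - U a = (LINT s:{a..t}|lborel. u s)"
    using F U t by (auto simp only: is_primitive_def)
  ultimately show "(F t - U t) - (F a - U a) = (LINT s:{a..t}|lborel. f s - u s)" by simp
qed

section \<open>Integration by parts against test functions\<close>

lemma integral_lborel_shift:
  fixes f :: "'a::euclidean_space \<Rightarrow> real"
  assumes [measurable]: "f \<in> borel_measurable borel"
  shows "(\<integral>x. f (x + c) \<partial>lborel) = (\<integral>x. f x \<partial>lborel)"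
proof -
  have "(\<integral>x. f x \<partial>lborel) = (\<integral>x. f x \<partial>(distr lborel borel ((+) c)))"
    by (simp add: lborel_distr_plus)
  also have "\<dots> = (\<integral>x. f (c + x) \<partial>lborel)"
    by (subst integral_distr) auto
  finally show ?thesis by (simp add: add.commute)
qed

lemma has_derivative_along_line:
  fixes u :: "'a::euclidean_space \<Rightarrow> real"
  assumes "(u has_derivative D) (at x)"
  shows "((\<lambda>s. u (x + s *\<^sub>R e)) has_real_derivative D e) (at 0)"
proof -
  have 1: "((\<lambda>s. x + s *\<^sub>R e) has_derivative (\<lambda>s. s *\<^sub>R e)) (at (0::real))"
    by (auto intro!: derivative_eq_intros)
  have 2: "(u has_derivative D) (at (x + 0 *\<^sub>R e))" using assms by simp
  have "((\<lambda>s. u (x + s *\<^sub>R e)) has_derivative (\<lambda>s. D (s *\<^sub>R e))) (at (0::real))"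
    using has_derivative_compose[OF 1 2] .
  moreover have "(\<lambda>s. D (s *\<^sub>R e)) = (*) (D e)"
  proof
    fix s
    show "D (s *\<^sub>R e) = D e * s"
      using linear_scale[OF has_derivative_linear[OF assms], of s e] by (simp add: mult.commute)
  qed
  ultimately show ?thesis by (simp add: has_field_derivative_def)
qed

lemma continuous_compact_support:
  fixes w :: "'a::euclidean_space \<Rightarrow> real"
  assumes c: "continuous_on UNIV w" and z: "\<And>x. norm x > r \<Longrightarrow> w x = 0"
  obtains C where "\<And>x. \<bar>w x\<bar> \<le> C" "0 \<le> C" "integrable lborel w"
proof -
  have "compact (w ` cball 0 r)"
    using c by (intro compact_continuous_image) (auto intro: continuous_on_subset)
  then have "bounded (w ` cball 0 r)" by (rule compact_imp_bounded)
  then obtain C where C: "\<forall>y\<in>w ` cball 0 r. norm y \<le> C" by (auto simp only: bounded_iff)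
  have b: "\<bar>w x\<bar> \<le> max 0 C" for x
  proof (cases "norm x \<le> r")
    case True
    then have "w x \<in> w ` cball 0 r" by auto
    with C have "norm (w x) \<le> C" by blast
    then show ?thesis by simp
  qed (use z[of x] in auto)
  have "integrable lborel (\<lambda>x. indicator (cball 0 r) x *\<^sub>R w x)"
    by (rule borel_integrable_compact) (auto intro: continuous_on_subset[OF c])
  moreover have "(\<lambda>x. indicator (cball 0 r) x *\<^sub>R w x) = w"
    using z by (auto simp: indicator_def fun_eq_iff)
  ultimately have "integrable lborel w" by simp
  with b show thesis using that[of "max 0 C"] by auto
qed

text \<open>Translation does not change the integral of \<open>u\<close>, so all difference quotients of \<open>u\<close> have integral \<open>0\<close>;
they converge to \<open>w\<close> and are dominated because \<open>w\<close> is bounded with bounded support.\<close>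

lemma integral_directional_derivative_zero:
  fixes u w :: "'a::euclidean_space \<Rightarrow> real"
  assumes d: "\<And>x. ((\<lambda>s. u (x + s *\<^sub>R e)) has_real_derivative w x) (at 0)"
    and cu: "continuous_on UNIV u" and cw: "continuous_on UNIV w"
    and u0: "\<And>x. norm x > r \<Longrightarrow> u x = 0" and w0: "\<And>x. norm x > r \<Longrightarrow> w x = 0"
  shows "(\<integral>x. w x \<partial>lborel) = 0"
proof -
  obtain C where C: "\<And>x. \<bar>w x\<bar> \<le> C" "0 \<le> C" using continuous_compact_support[OF cw w0] by blast
  have ui: "integrable lborel u" using continuous_compact_support[OF cu u0] by blast
  have [measurable]: "u \<in> borel_measurable borel" "w \<in> borel_measurable borel"
    using cu cw by (auto intro: borel_measurable_continuous_onI)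
  define s where "s m = inverse (real (Suc m))" for m
  have s: "0 < s m" "s m \<le> 1" for m by (auto simp: s_def inverse_le_1_iff)
  define D where "D m x = (u (x + s m *\<^sub>R e) - u x) / s m" for m x
  have d': "((\<lambda>t. u (x + t *\<^sub>R e)) has_real_derivative w (x + z *\<^sub>R e)) (at z)" for x z
  proof -
    have "((\<lambda>t. u (x + (t + z) *\<^sub>R e)) has_real_derivative w (x + z *\<^sub>R e)) (at 0)"
      using d[of "x + z *\<^sub>R e"] by (simp add: algebra_simps)
    then show ?thesis using DERIV_shift[of "\<lambda>t. u (x + t *\<^sub>R e)" "w (x + z *\<^sub>R e)" 0 z] by simp
  qed
  have bound: "\<bar>D m x\<bar> \<le> C * indicator (cball 0 (r + norm e)) x" for m x
  proof (cases "norm x \<le> r + norm e")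
    case True
    have "\<exists>z. 0 < z \<and> z < s m \<and> u (x + s m *\<^sub>R e) - u (x + 0 *\<^sub>R e) = (s m - 0) * w (x + z *\<^sub>R e)"
      by (rule MVT2[OF s(1)]) (rule d')
    then obtain z where "u (x + s m *\<^sub>R e) - u x = s m * w (x + z *\<^sub>R e)" by auto
    then have "D m x = w (x + z *\<^sub>R e)" using s(1)[of m] by (simp add: D_def)
    then show ?thesis using C(1)[of "x + z *\<^sub>R e"] True by (auto simp: indicator_def)
  next
    case False
    have "norm x \<le> norm (x + s m *\<^sub>R e) + norm (s m *\<^sub>R e)"
      using norm_triangle_ineq4[of "x + s m *\<^sub>R e" "s m *\<^sub>R e"] by simp
    moreover have "norm (s m *\<^sub>R e) \<le> norm e"
      using s[of m] mult_right_mono[of "s m" 1 "norm e"] by simp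
    ultimately have "norm (x + s m *\<^sub>R e) > r" using False by linarith
    moreover have "norm x > r" using False norm_ge_zero[of e] by linarith
    ultimately show ?thesis using u0 C(2) by (simp add: D_def)
  qed
  have lim: "(\<lambda>m. D m x) \<longlonglongrightarrow> w x" for x
  proof -
    have "((\<lambda>h. (u (x + h *\<^sub>R e) - u x) / h) \<longlongrightarrow> w x) (at 0)"
      using d[of x] by (simp add: has_field_derivative_iff)
    moreover have "filterlim s (at 0) sequentially"
      using LIMSEQ_inverse_real_of_nat s(1)
      by (auto simp: filterlim_at s_def[abs_def] simp del: of_nat_Suc)
    ultimately show ?thesis unfolding D_def by (rule filterlim_compose)
  qed
  have "(\<lambda>m. \<integral>x. D m x \<partial>lborel) \<longlonglongrightarrow> (\<integral>x. w x \<partial>lborel)"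
  proof (rule integral_dominated_convergence)
    show "integrable lborel (\<lambda>x::'a. C * indicator (cball 0 (r + norm e)) x :: real)"
      by (intro integrable_mult_right integrable_real_indicator) (use emeasure_bounded_finite[OF bounded_cball[of "0::'a" "r + norm e"]] in auto)
    show "AE x in lborel. norm (D m x) \<le> C * indicator (cball 0 (r + norm e)) x" for m
      using bound by auto
    show "AE x in lborel. (\<lambda>m. D m x) \<longlonglongrightarrow> w x" using lim by auto
  qed (auto simp: D_def[abs_def])
  moreover have "(\<integral>x. D m x \<partial>lborel) = 0" for m
  proof -
    have "integrable lborel (\<lambda>x. u (x + s m *\<^sub>R e))"
    proof -
      have "integrable (distr lborel borel ((+) (s m *\<^sub>R e))) u" using ui by (simp add: lborel_distr_plus)
      then show ?thesis by (subst (asm) integrable_distr_eq) (auto simp: add.commute)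
    qed
    then have "(\<integral>x. D m x \<partial>lborel) = ((\<integral>x. u (x + s m *\<^sub>R e) \<partial>lborel) - (\<integral>x. u x \<partial>lborel)) / s m"
      unfolding D_def using ui by simp
    then show ?thesis by (simp add: integral_lborel_shift)
  qed
  ultimately show ?thesis using LIMSEQ_unique[OF tendsto_const] by force
qed

lemma test_function_facts:
  assumes "test_function U \<phi>" and S_def: "S = closure {x. \<phi> x \<noteq> 0}"
  shows "compact S" "S \<subseteq> U" "\<And>x. x \<notin> S \<Longrightarrow> \<phi> x = 0"
    "\<And>x j. x \<notin> S \<Longrightarrow> partial_deriv j \<phi> x = 0"
    "\<And>x. \<phi> differentiable at x" "continuous_on UNIV \<phi>" "\<And>j. continuous_on UNIV (partial_deriv j \<phi>)"
proof -
  have C: "C_k 0 \<phi>" "C_k (Suc 0) \<phi>" using assms by (auto simp only: test_function_def)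
  show z: "\<phi> x = 0" if "x \<notin> S" for x
    using that closure_subset[of "{x. \<phi> x \<noteq> 0}"] by (auto simp: S_def)
  show "partial_deriv j \<phi> x = 0" if "x \<notin> S" for x j
  proof -
    have "((\<lambda>x. 0::real) has_derivative (\<lambda>x. 0)) (at x)" by simp
    then have "(\<phi> has_derivative (\<lambda>x. 0)) (at x)"
    proof (rule has_derivative_transform_within_open[of _ _ _ _ "- S"])
      show "open (- S)" unfolding S_def by (simp add: open_Compl)
      show "0 = \<phi> y" if "y \<in> - S" for y using z[of y] that by simp
    qed (use that in simp)
    then show ?thesis by (simp add: partial_deriv_eq)
  qed
  show "compact S" "S \<subseteq> U" using assms by (auto simp: test_function_def)
  show "\<phi> differentiable at x" "continuous_on UNIV \<phi>" "continuous_on UNIV (partial_deriv j \<phi>)" for x j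
    using C by auto
qed

text \<open>The product of \<open>f\<close> and \<open>\<phi>\<close>, continued by \<open>0\<close> outside \<open>U\<close>, is differentiable everywhere and has compact
support, so the integral of its partial derivative vanishes.\<close>

lemma integration_by_parts_test_function:
  fixes f :: "real ^ 'n::finite \<Rightarrow> real"
  assumes U: "open U" and f: "\<And>x. x \<in> U \<Longrightarrow> (f has_derivative f' x) (at x)"
    and f': "continuous_on U (\<lambda>x. f' x (axis j 1))" and \<phi>: "test_function U \<phi>"
  shows "(\<integral>x. indicator U x * (f x * partial_deriv j \<phi> x + f' x (axis j 1) * \<phi> x) \<partial>lborel) = 0"
proof -
  define S where "S = closure {x. \<phi> x \<noteq> 0}"
  note S = test_function_facts[OF \<phi> S_def]
  define u where "u x = (if x \<in> U then f x * \<phi> x else 0)" for x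
  define w where "w x = (if x \<in> U then f x * partial_deriv j \<phi> x + f' x (axis j 1) * \<phi> x else 0)" for x
  have cf: "continuous_on U f"
  proof -
    have "isCont f x" if "x \<in> U" for x using f[OF that] by (rule has_derivative_continuous)
    then show ?thesis by (simp add: continuous_at_imp_continuous_on)
  qed
  have zero: "u x = 0" "w x = 0" if "x \<notin> S" for x using S that by (auto simp: u_def w_def)
  have glue: "continuous_on UNIV v"
    if "continuous_on U v" "\<And>x. x \<notin> S \<Longrightarrow> v x = 0" for v :: "real ^ 'n \<Rightarrow> real"
  proof -
    have "continuous_on (- S) v"
      using that(2) by (subst continuous_on_cong[OF refl, of _ _ "\<lambda>_. 0"]) auto
    with that(1) have "continuous_on (U \<union> - S) v"
      using U S(1) by (intro continuous_on_open_Un) (auto simp: compact_imp_closed open_Compl)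
    moreover have "U \<union> - S = UNIV" using S(2) by blast
    ultimately show ?thesis by simp
  qed
  have c\<phi>: "continuous_on U \<phi>" "continuous_on U (partial_deriv j \<phi>)"
    using S(6,7) continuous_on_subset by blast+
  have "continuous_on U (\<lambda>x. f x * \<phi> x)"
    by (rule continuous_on_mult[OF cf c\<phi>(1)])
  then have "continuous_on U u"
    by (rule continuous_on_cong[THEN iffD1, rotated -1]) (auto simp: u_def)
  then have cu: "continuous_on UNIV u" by (rule glue) (rule zero(1))
  have "continuous_on U (\<lambda>x. f x * partial_deriv j \<phi> x + f' x (axis j 1) * \<phi> x)"
    by (rule continuous_on_add[OF continuous_on_mult[OF cf c\<phi>(2)] continuous_on_mult[OF f' c\<phi>(1)]])
  then have "continuous_on U w"
    by (rule continuous_on_cong[THEN iffD1, rotated -1]) (auto simp: w_def)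
  then have cw: "continuous_on UNIV w" by (rule glue) (rule zero(2))
  have d: "((\<lambda>s. u (x + s *\<^sub>R axis j 1)) has_real_derivative w x) (at 0)" for x
  proof (cases "x \<in> U")
    case True
    have "(\<phi> has_derivative frechet_derivative \<phi> (at x)) (at x)"
      using S(5) by (simp add: frechet_derivative_works)
    then have "((\<lambda>x. f x * \<phi> x) has_derivative (\<lambda>h. f x * frechet_derivative \<phi> (at x) h + f' x h * \<phi> x)) (at x)"
      by (rule has_derivative_mult[OF f[OF True]])
    then have "(u has_derivative (\<lambda>h. f x * frechet_derivative \<phi> (at x) h + f' x h * \<phi> x)) (at x)"
      by (rule has_derivative_transform_within_open[OF _ U True]) (simp add: u_def)
    from has_derivative_along_line[OF this, of "axis j 1"] True show ?thesis
      by (simp add: w_def partial_deriv_def)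
  next
    case False
    then have x: "x \<in> - S" "open (- S)" using S by (auto simp: compact_imp_closed open_Compl)
    have "((\<lambda>x. 0::real) has_derivative (\<lambda>x. 0)) (at x)" by simp
    then have "(u has_derivative (\<lambda>x. 0)) (at x)"
      by (rule has_derivative_transform_within_open[OF _ x(2,1)]) (use zero in auto)
    from has_derivative_along_line[OF this, of "axis j 1"] False show ?thesis
      by (simp add: w_def)
  qed
  obtain r where r: "\<forall>x\<in>S. norm x \<le> r"
    using compact_imp_bounded[OF S(1)] by (auto simp only: bounded_iff)
  have "(\<integral>x. w x \<partial>lborel) = 0"
  proof (rule integral_directional_derivative_zero[OF d cu cw, of r])
    fix x :: "real ^ 'n" assume "norm x > r"
    then have "x \<notin> S" using r by force
    then show "u x = 0" "w x = 0" using zero by auto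
  qed
  moreover have "w = (\<lambda>x. indicator U x * (f x * partial_deriv j \<phi> x + f' x (axis j 1) * \<phi> x))"
    by (auto simp: w_def indicator_def)
  ultimately show ?thesis by simp
qed

section \<open>Uniqueness of weak derivatives\<close>

lemma locally_integrable_times_test_function:
  fixes f :: "real ^ 'n::finite \<Rightarrow> real"
  assumes f: "locally_integrable_on U f" and \<phi>: "test_function U \<phi>"
  shows "set_integrable lebesgue U (\<lambda>x. f x * \<phi> x)"
proof -
  define S where "S = closure {x. \<phi> x \<noteq> 0}"
  note S = test_function_facts[OF \<phi> S_def]
  have fS: "integrable lebesgue (\<lambda>x. indicator S x *\<^sub>R f x)"
    using f S(1,2) by (auto simp: locally_integrable_on_def set_integrable_def)
  obtain r where r: "\<forall>x\<in>S. norm x \<le> r"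
    using compact_imp_bounded[OF S(1)] by (auto simp only: bounded_iff)
  have "\<phi> x = 0" if "norm x > r" for x using S(3)[of x] r that by force
  then obtain C where C: "\<And>x. \<bar>\<phi> x\<bar> \<le> C" "0 \<le> C"
    using continuous_compact_support[OF S(6), of r] by blast
  have \<phi>m: "\<phi> \<in> borel_measurable lebesgue"
    by (rule measurable_lebesgueI) (rule borel_measurable_continuous_onI[OF S(6)])
  have eq: "(\<lambda>x. indicator U x *\<^sub>R (f x * \<phi> x)) = (\<lambda>x. (indicator S x *\<^sub>R f x) * \<phi> x)"
  proof
    fix x show "indicator U x *\<^sub>R (f x * \<phi> x) = (indicator S x *\<^sub>R f x) * \<phi> x"
      using S(2) S(3)[of x] by (cases "x \<in> S") (auto simp: indicator_def)
  qed
  show ?thesis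
    unfolding set_integrable_def eq
  proof (rule Bochner_Integration.integrable_bound)
    show "integrable lebesgue (\<lambda>x. C * (indicator S x *\<^sub>R f x))" using fS by simp
    show "(\<lambda>x. indicator S x *\<^sub>R f x * \<phi> x) \<in> borel_measurable lebesgue"
      by (rule borel_measurable_times[OF borel_measurable_integrable[OF fS] \<phi>m])
    show "AE x in lebesgue. norm (indicator S x *\<^sub>R f x * \<phi> x) \<le> norm (C * (indicator S x *\<^sub>R f x))"
    proof (rule AE_I2)
      fix x
      have "\<bar>\<phi> x\<bar> \<le> \<bar>C\<bar>" using C(1)[of x] by linarith
      then show "norm (indicator S x *\<^sub>R f x * \<phi> x) \<le> norm (C * (indicator S x *\<^sub>R f x))"
        using mult_right_mono[of "\<bar>\<phi> x\<bar>" "\<bar>C\<bar>" "\<bar>indicator S x *\<^sub>R f x\<bar>"]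
        by (simp add: abs_mult mult.commute)
    qed
  qed
qed

text \<open>Products of steep smooth steps in the coordinates.\<close>

lemma box_bump_exists:
  fixes a b :: "real ^ 'n::finite"
  obtains \<phi> where "\<And>m k. C_k k (\<phi> m)" "\<And>m x. x \<notin> cbox a b \<Longrightarrow> \<phi> m x = 0" "\<And>m x. \<bar>\<phi> m x\<bar> \<le> 1"
    "\<And>x. (\<lambda>m::nat. \<phi> m x) \<longlonglongrightarrow> indicator (box a b) x"
proof -
  obtain S s where "smooth_step S s" using smooth_step_exists by blast
  note S = smooth_stepD[OF this] and lim = smooth_step_limit[OF this]
  define \<phi> where "\<phi> m x = (\<Prod>i\<in>UNIV. S (real m * (x $ i - a $ i)) * S (real m * (b $ i - x $ i)))"
    for m :: nat and x :: "real ^ 'n"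
  show thesis
  proof (rule that[of \<phi>])
    have 1: "C_k k (\<lambda>x::real^'n. c * (x $ i - d))" for k c d i
    proof -
      have "C_k k (\<lambda>x::real^'n. c * (x $ i + - d))" by (intro C_k_mult C_k_const C_k_add C_k_coord)
      then show ?thesis by simp
    qed
    have 2: "C_k k (\<lambda>x::real^'n. c * (d - x $ i))" for k c d i
    proof -
      have "C_k k (\<lambda>x::real^'n. c * (d + (- 1) * x $ i))" by (intro C_k_mult C_k_const C_k_add C_k_coord)
      then show ?thesis by simp
    qed
    show "C_k k (\<phi> m)" for k m
      unfolding \<phi>_def by (intro C_k_prod C_k_mult C_k_compose[OF S(1) 1] C_k_compose[OF S(1) 2]) auto
    show "\<phi> m x = 0" if x: "x \<notin> cbox a b" for m x
    proof -
      obtain i where "x $ i < a $ i \<or> b $ i < x $ i"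
        using x by (auto simp: mem_box_cart not_le)
      then have "S (real m * (x $ i - a $ i)) * S (real m * (b $ i - x $ i)) = 0"
        using S(2)[of "real m * (x $ i - a $ i)"] S(2)[of "real m * (b $ i - x $ i)"]
        by (auto simp: mult_nonneg_nonpos)
      then show ?thesis unfolding \<phi>_def by (intro prod_zero) auto
    qed
    show "\<bar>\<phi> m x\<bar> \<le> 1" for m x
      unfolding \<phi>_def abs_prod by (rule prod_le_1) (auto simp: abs_mult S(4,5) mult_le_one)
    show "(\<lambda>m. \<phi> m x) \<longlonglongrightarrow> indicator (box a b) x" for x
    proof -
      have "(\<lambda>m. \<phi> m x) \<longlonglongrightarrow> (\<Prod>i\<in>UNIV. (if 0 < x $ i - a $ i then 1 else 0) * (if 0 < b $ i - x $ i then 1 else 0))"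
        unfolding \<phi>_def by (intro tendsto_intros lim)
      also have "(\<Prod>i\<in>UNIV. (if 0 < x $ i - a $ i then 1 else 0) * (if 0 < b $ i - x $ i then 1 else 0)) =
          (indicator (box a b) x :: real)"
      proof (cases "x \<in> box a b")
        case True
        then show ?thesis by (simp add: mem_box_cart)
      next
        case False
        then obtain i where "\<not> (a $ i < x $ i \<and> x $ i < b $ i)" by (auto simp: mem_box_cart)
        then have "(\<Prod>i\<in>UNIV. (if 0 < x $ i - a $ i then 1 else 0) * (if 0 < b $ i - x $ i then 1 else 0)) = (0::real)"
          by (intro prod_zero) auto
        then show ?thesis using False by simp
      qed
      finally show ?thesis .
    qed
  qed
qed

text \<open>Bumps converging to the indicator of a box show that the integral over every box with closure in \<open>U\<close>
vanishes, and \<open>U\<close> is a countable union of closed boxes.\<close>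

lemma fundamental_lemma_calculus_of_variations:
  fixes f :: "real ^ 'n::finite \<Rightarrow> real"
  assumes U: "open U" and f: "locally_integrable_on U f"
    and z: "\<And>\<phi>. test_function U \<phi> \<Longrightarrow> (LINT x:U|lebesgue. f x * \<phi> x) = 0"
  shows "AE x in lebesgue. x \<in> U \<longrightarrow> f x = 0"
proof -
  have box: "(\<integral>x. indicator (box a b) x * f x \<partial>lebesgue) = 0" if ab: "cbox a b \<subseteq> U" for a b
  proof -
    obtain \<phi> where \<phi>: "\<And>m k. C_k k (\<phi> m)" "\<And>m x. x \<notin> cbox a b \<Longrightarrow> \<phi> m x = 0" "\<And>m x. \<bar>\<phi> m x\<bar> \<le> 1"
      "\<And>x. (\<lambda>m::nat. \<phi> m x) \<longlonglongrightarrow> indicator (box a b) x"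
      using box_bump_exists[of a b] by blast
    have t: "test_function U (\<phi> m)" for m
      by (rule test_functionI[OF \<phi>(1) compact_cbox ab \<phi>(2)])
    have fi: "integrable lebesgue (\<lambda>x. indicator (cbox a b) x *\<^sub>R f x)"
      using f ab compact_cbox by (auto simp: locally_integrable_on_def set_integrable_def)
    have eq: "indicator U x *\<^sub>R (f x * \<phi> m x) = (indicator (cbox a b) x *\<^sub>R f x) * \<phi> m x" for m x
      using ab \<phi>(2)[of x m] by (cases "x \<in> cbox a b") (auto simp: indicator_def)
    have \<phi>m: "\<phi> m \<in> borel_measurable lebesgue" for m
      using \<phi>(1)[of 0 m] by (intro measurable_lebesgueI borel_measurable_continuous_onI) simp
    have "(\<lambda>m. \<integral>x. (indicator (cbox a b) x *\<^sub>R f x) * \<phi> m x \<partial>lebesgue) \<longlonglongrightarrow>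
        (\<integral>x. (indicator (cbox a b) x *\<^sub>R f x) * indicator (box a b) x \<partial>lebesgue)"
    proof (rule integral_dominated_convergence)
      show "integrable lebesgue (\<lambda>x. \<bar>indicator (cbox a b) x *\<^sub>R f x\<bar>)" using fi by (rule integrable_abs)
      show "AE x in lebesgue. (\<lambda>m. indicator (cbox a b) x *\<^sub>R f x * \<phi> m x) \<longlonglongrightarrow>
          indicator (cbox a b) x *\<^sub>R f x * indicator (box a b) x"
        by (intro AE_I2 tendsto_intros \<phi>(4))
      show "AE x in lebesgue. norm (indicator (cbox a b) x *\<^sub>R f x * \<phi> m x) \<le> \<bar>indicator (cbox a b) x *\<^sub>R f x\<bar>" for m
      proof (rule AE_I2)
        fix x show "norm (indicator (cbox a b) x *\<^sub>R f x * \<phi> m x) \<le> \<bar>indicator (cbox a b) x *\<^sub>R f x\<bar>"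
          using mult_left_mono[OF \<phi>(3)[of m x], of "\<bar>indicator (cbox a b) x *\<^sub>R f x\<bar>"]
          by (simp add: abs_mult)
      qed
      show "(\<lambda>x. indicator (cbox a b) x *\<^sub>R f x * \<phi> m x) \<in> borel_measurable lebesgue" for m
        by (rule borel_measurable_times[OF borel_measurable_integrable[OF fi] \<phi>m])
      show "(\<lambda>x. indicator (cbox a b) x *\<^sub>R f x * indicator (box a b) x) \<in> borel_measurable lebesgue"
        by (rule borel_measurable_times[OF borel_measurable_integrable[OF fi]])
          (simp add: borel_measurable_indicator)
    qed
    moreover have "(\<integral>x. (indicator (cbox a b) x *\<^sub>R f x) * \<phi> m x \<partial>lebesgue) = 0" for m
      using z[OF t[of m]] unfolding set_lebesgue_integral_def eq .
    ultimately have "(\<integral>x. (indicator (cbox a b) x *\<^sub>R f x) * indicator (box a b) x \<partial>lebesgue) = 0"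
      using LIMSEQ_unique[OF tendsto_const] by force
    moreover have "(indicator (cbox a b) x *\<^sub>R f x) * indicator (box a b) x = indicator (box a b) x * f x" for x
      using box_subset_cbox[of a b] by (auto simp: indicator_def)
    ultimately show ?thesis by (simp only:)
  qed
  have cb: "AE x in lebesgue. x \<in> cbox c d \<longrightarrow> f x = 0" if cd: "cbox c d \<subseteq> U" for c d
  proof -
    have fi: "integrable lebesgue (\<lambda>x. indicator (cbox c d) x *\<^sub>R f x)"
      using f cd compact_cbox by (auto simp: locally_integrable_on_def set_integrable_def)
    have "integrable lebesgue (\<lambda>x. indicator (box c d) x *\<^sub>R (indicator (cbox c d) x *\<^sub>R f x))"
      by (rule integrable_mult_indicator[OF _ fi]) simp
    moreover have "indicator (box c d) x *\<^sub>R (indicator (cbox c d) x *\<^sub>R f x) = indicator (box c d) x * f x" for x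
      using box_subset_cbox[of c d] by (auto simp: indicator_def)
    ultimately have fi': "integrable lebesgue (\<lambda>x. indicator (box c d) x * f x)" by (simp only:)
    have "(\<integral>x. indicator (box a b) x * (indicator (box c d) x * f x) \<partial>lebesgue) = 0" for a b
    proof -
      define a' b' :: "real ^ 'n" where "a' = (\<chi> i. max (a $ i) (c $ i))" and "b' = (\<chi> i. min (b $ i) (d $ i))"
      have "cbox a' b' \<subseteq> cbox c d" by (auto simp: mem_box_cart a'_def b'_def)
      then have "cbox a' b' \<subseteq> U" using cd by blast
      moreover have "indicator (box a b) x * (indicator (box c d) x * f x) = indicator (box a' b') x * f x" for x
      proof -
        have "x \<in> box a' b' \<longleftrightarrow> x \<in> box a b \<and> x \<in> box c d"
          unfolding mem_box_cart a'_def b'_def by auto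
        then show ?thesis by (auto simp: indicator_def)
      qed
      ultimately show ?thesis using box[of a' b'] by (simp only:)
    qed
    then have "AE x in lebesgue. indicator (box c d) x * f x = 0"
      by (rule AE_eq_0_if_box_integrals_0[OF fi'])
    moreover have "AE x in lebesgue. x \<notin> cbox c d - box c d"
    proof (rule AE_not_in)
      show "cbox c d - box c d \<in> null_sets lebesgue"
        using negligible_frontier_interval[of c d] by (simp only: negligible_iff_null_sets)
    qed
    ultimately show ?thesis by eventually_elim (auto simp: indicator_def)
  qed
  obtain D where D: "countable D" "\<And>X. X \<in> D \<Longrightarrow> X \<subseteq> U" "\<And>X. X \<in> D \<Longrightarrow> \<exists>a b. X = cbox a b" "\<Union>D = U"
    using open_countable_Union_open_cbox[OF U] by (metis Pow_iff subsetD)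
  have "AE x in lebesgue. \<forall>X\<in>D. x \<in> X \<longrightarrow> f x = 0"
    unfolding AE_ball_countable[OF D(1)]
  proof
    fix X assume X: "X \<in> D"
    then obtain c d where "X = cbox c d" using D(3) by blast
    then show "AE x in lebesgue. x \<in> X \<longrightarrow> f x = 0" using cb D(2)[OF X] by blast
  qed
  then show ?thesis by eventually_elim (use D(4) in blast)
qed

lemma locally_integrable_on_component:
  fixes G :: "real ^ 'n::finite \<Rightarrow> real ^ 'n ^ 'm::finite"
  assumes "locally_integrable_on U G"
  shows "locally_integrable_on U (\<lambda>x. G x $ i $ j)"
  unfolding locally_integrable_on_def set_integrable_def
proof (intro allI impI)
  fix K assume "compact K \<and> K \<subseteq> U"
  then have "integrable lebesgue (\<lambda>x. indicator K x *\<^sub>R G x)"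
    using assms by (simp add: locally_integrable_on_def set_integrable_def)
  then have "integrable lebesgue (\<lambda>x. (indicator K x *\<^sub>R G x) $ i $ j)"
    by (intro integrable_bounded_linear[OF bounded_linear_vec_nth]
        integrable_bounded_linear[OF bounded_linear_vec_nth[where 'a="real^'n"]])
  then show "integrable lebesgue (\<lambda>x. indicator K x *\<^sub>R G x $ i $ j)" by simp
qed

lemma weak_derivative_unique:
  fixes h :: "real ^ 'n::finite \<Rightarrow> real ^ 'm::finite"
  assumes U: "open U" and G: "has_weak_derivative_on h G U" and G': "has_weak_derivative_on h G' U"
  shows "AE x in lebesgue. x \<in> U \<longrightarrow> G x = G' x"
proof -
  have "AE x in lebesgue. x \<in> U \<longrightarrow> G x $ i $ j - G' x $ i $ j = 0" for i j
  proof (rule fundamental_lemma_calculus_of_variations[OF U])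
    have l: "locally_integrable_on U (\<lambda>x. G x $ i $ j)" "locally_integrable_on U (\<lambda>x. G' x $ i $ j)"
      using G G' by (auto simp: has_weak_derivative_on_def intro!: locally_integrable_on_component)
    then show "locally_integrable_on U (\<lambda>x. G x $ i $ j - G' x $ i $ j)"
      by (auto simp: locally_integrable_on_def intro!: set_integral_diff(1))
    fix \<phi> assume \<phi>: "test_function U \<phi>"
    have "(LINT x:U|lebesgue. (G x $ i $ j - G' x $ i $ j) * \<phi> x) =
        (LINT x:U|lebesgue. G x $ i $ j * \<phi> x - G' x $ i $ j * \<phi> x)"
      by (simp add: left_diff_distrib)
    also have "\<dots> = (LINT x:U|lebesgue. G x $ i $ j * \<phi> x) - (LINT x:U|lebesgue. G' x $ i $ j * \<phi> x)"
      by (rule set_integral_diff(2)) (rule locally_integrable_times_test_function[OF l(1) \<phi>]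
        locally_integrable_times_test_function[OF l(2) \<phi>])+
    also have "\<dots> = 0" using G G' \<phi> by (simp add: has_weak_derivative_on_def)
    finally show "(LINT x:U|lebesgue. (G x $ i $ j - G' x $ i $ j) * \<phi> x) = 0" .
  qed
  then have "AE x in lebesgue. \<forall>i\<in>UNIV. \<forall>j\<in>UNIV. x \<in> U \<longrightarrow> G x $ i $ j - G' x $ i $ j = 0"
    by (intro AE_finite_allI) auto
  then show ?thesis by eventually_elim (auto simp: vec_eq_iff)
qed

section \<open>Integrals over spherical shells\<close>

lemma sphere_area_mono: "0 < n \<Longrightarrow> s \<le> t \<Longrightarrow> sphere_area n s \<le> sphere_area n t"
  by (auto simp: sphere_area_def intro!: mult_left_mono power_mono mult_nonneg_nonneg)

text \<open>The integral of a radial factor against a bounded function supported in a shell is controlled by the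
one-dimensional integral of the radial factor.\<close>

lemma shell_integrable:
  fixes \<alpha> :: "'a::euclidean_space \<Rightarrow> real"
  assumes f: "set_integrable lborel {a..b} f" and [measurable]: "f \<in> borel_measurable borel" "\<alpha> \<in> borel_measurable borel"
    and C: "\<And>x. \<bar>\<alpha> x\<bar> \<le> C" and z: "\<And>x. \<not> (a \<le> norm x \<and> norm x \<le> b) \<Longrightarrow> \<alpha> x = 0"
  shows "integrable lebesgue (\<lambda>x. f (norm x) * \<alpha> x)"
    and "\<bar>\<integral>x. f (norm x) * \<alpha> x \<partial>lebesgue\<bar> \<le>
      C * (sphere_area DIM('a) b * (LINT t:{a..b}|lborel. \<bar>f t\<bar>))"
proof -
  have C0: "0 \<le> C" using C[of 0] by linarith
  define h where "h t = indicator {a..b} t * \<bar>f t\<bar>" for t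
  have [measurable]: "h \<in> borel_measurable borel" by (simp add: h_def[abs_def])
  have fi: "integrable lborel (\<lambda>t. indicator {a..b} t * f t)"
    using f by (simp add: set_integrable_def)
  have hi: "integrable lborel h"
  proof -
    have "h = (\<lambda>t. \<bar>indicator {a..b} t * f t\<bar>)" by (auto simp: h_def fun_eq_iff indicator_def)
    then show ?thesis using integrable_abs[OF fi] by (simp only:)
  qed
  have hb: "sphere_area DIM('a) t * h t \<le> sphere_area DIM('a) b * h t" for t
    using sphere_area_mono[of "DIM('a)" t b]
    by (cases "t \<le> b") (auto simp: h_def intro!: mult_right_mono)
  have h0: "0 \<le> h t" for t by (simp add: h_def)
  have ahi: "integrable lborel (\<lambda>t. sphere_area DIM('a) t * h t)"
  proof (rule Bochner_Integration.integrable_bound)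
    show "integrable lborel (\<lambda>t. sphere_area DIM('a) b * h t)" using hi by simp
    have "norm (sphere_area DIM('a) t * h t) \<le> norm (sphere_area DIM('a) b * h t)" for t
      using hb[of t] h0[of t] sphere_area_nonneg[of "DIM('a)" t] sphere_area_nonneg[of "DIM('a)" b]
      by (simp add: abs_mult)
    then show "AE t in lborel. norm (sphere_area DIM('a) t * h t) \<le> norm (sphere_area DIM('a) b * h t)"
      by simp
  qed simp
  have hn: "integrable lebesgue (\<lambda>x::'a. h (norm x))"
    using ahi by (subst integrable_norm_iff) auto
  have Chn: "integrable lebesgue (\<lambda>x::'a. C * h (norm x))" using hn by simp
  have le: "\<bar>f (norm x) * \<alpha> x\<bar> \<le> C * h (norm x)" for x
  proof (cases "a \<le> norm x \<and> norm x \<le> b")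
    case True
    then show ?thesis using mult_left_mono[OF C[of x], of "\<bar>f (norm x)\<bar>"]
      by (simp add: h_def abs_mult mult.commute)
  next
    case False
    then show ?thesis using z[OF False] C0 h0[of "norm x"] by simp
  qed
  have m: "(\<lambda>x. f (norm x) * \<alpha> x) \<in> borel_measurable lebesgue"
    by (rule measurable_lebesgueI) measurable
  show i: "integrable lebesgue (\<lambda>x. f (norm x) * \<alpha> x)"
  proof (rule Bochner_Integration.integrable_bound[OF Chn m])
    show "AE x in lebesgue. norm (f (norm x) * \<alpha> x) \<le> norm (C * h (norm x))"
      using le C0 h0 by (intro AE_I2) (simp add: abs_mult)
  qed
  have "abs (\<integral>x. f (norm x) * \<alpha> x \<partial>lebesgue) \<le> (\<integral>x. abs (f (norm x) * \<alpha> x) \<partial>lebesgue)"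
    by (rule integral_abs_bound)
  also have "\<dots> \<le> (\<integral>x. C * h (norm (x::'a)) \<partial>lebesgue)"
    by (rule integral_mono[OF integrable_abs[OF i] Chn]) (rule le)
  also have "\<dots> = C * (\<integral>t. sphere_area DIM('a) t * h t \<partial>lborel)"
    by (simp add: integral_norm)
  also have "\<dots> \<le> C * (\<integral>t. sphere_area DIM('a) b * h t \<partial>lborel)"
    using C0 hi ahi by (intro mult_left_mono integral_mono hb) auto
  also have "\<dots> = C * (sphere_area DIM('a) b * (LINT t:{a..b}|lborel. \<bar>f t\<bar>))"
    by (simp add: h_def set_lebesgue_integral_def)
  finally show "\<bar>\<integral>x. f (norm x) * \<alpha> x \<partial>lebesgue\<bar> \<le>
      C * (sphere_area DIM('a) b * (LINT t:{a..b}|lborel. \<bar>f t\<bar>))" .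
qed

text \<open>Both sides of the weak derivative identity for a radial map are, for a fixed test function, linear in
the pair \<open>(K, k)\<close> and continuous with respect to the maximum norm of \<open>K\<close> and the mean of \<open>k\<close>. It is therefore
enough to know the identity for continuously differentiable \<open>K\<close>: if \<open>g\<close> is continuous and close to \<open>k\<close> in
the mean, the primitive of \<open>g\<close> with the same value at \<open>a\<close> is uniformly close to \<open>K\<close>.\<close>

lemma radial_functional_zero:
  fixes \<alpha> \<beta> :: "'a::euclidean_space \<Rightarrow> real"
  assumes [measurable]: "\<alpha> \<in> borel_measurable borel" "\<beta> \<in> borel_measurable borel"
    and C: "\<And>x. \<bar>\<alpha> x\<bar> \<le> C" "\<And>x. \<bar>\<beta> x\<bar> \<le> C"
    and z: "\<And>x. \<not> (a \<le> norm x \<and> norm x \<le> b) \<Longrightarrow> \<alpha> x = 0" "\<And>x. \<not> (a \<le> norm x \<and> norm x \<le> b) \<Longrightarrow> \<beta> x = 0"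
    and ab: "a \<le> b"
    and C1: "\<And>K k. (\<And>t. (K has_real_derivative k t) (at t)) \<Longrightarrow> continuous_on UNIV k \<Longrightarrow>
      (\<integral>x. K (norm x) * \<alpha> x + k (norm x) * \<beta> x \<partial>lebesgue) = 0"
    and K: "is_primitive a b K k" "continuous_on UNIV K" "k \<in> borel_measurable borel"
  shows "(\<integral>x. K (norm x) * \<alpha> x + k (norm x) * \<beta> x \<partial>lebesgue) = 0"
proof -
  define I where "I = (\<integral>x. K (norm x) * \<alpha> x + k (norm x) * \<beta> x \<partial>lebesgue)"
  define B where "B = C * (sphere_area DIM('a) b * (b - a + 1))"
  have C0: "0 \<le> C" using C(1)[of 0] by linarith
  note [measurable] = K(3)
  have Km [measurable]: "K \<in> borel_measurable borel" by (rule borel_measurable_continuous_onI[OF K(2)])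
  have ki: "set_integrable lborel {a..b} k" using K(1) by (simp add: is_primitive_def)
  have Ki: "set_integrable lborel {a..b} K"
    by (rule borel_integrable_atLeastAtMost') (rule continuous_on_subset[OF K(2)], simp)
  have "\<bar>I\<bar> \<le> B * e" if e: "e > 0" for e
  proof -
    define k0 where "k0 t = indicator {a..b} t * k t" for t
    have k0: "integrable lborel k0" using ki by (simp add: k0_def[abs_def] set_integrable_def)
    obtain g where g: "continuous_on UNIV g" "(\<integral>t. indicator {a..b} t * \<bar>g t - k0 t\<bar> \<partial>lborel) < e"
      by (rule L1_approx[OF k0 _ e]) (auto simp: k0_def)
    have [measurable]: "g \<in> borel_measurable borel" by (rule borel_measurable_continuous_onI[OF g(1)])
    have "\<exists>F. \<forall>x. -\<infinity> < ereal x \<longrightarrow> ereal x < \<infinity> \<longrightarrow> (F has_vector_derivative g x) (at x)"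
      using g(1) by (intro einterval_antiderivative) (auto simp: continuous_on_eq_continuous_at)
    then obtain F where F: "\<And>x. (F has_real_derivative g x) (at x)"
      by (auto simp: has_real_derivative_iff_has_vector_derivative)
    define G where "G t = F t - F a + K a" for t
    have G: "(G has_real_derivative g t) (at t)" for t
      unfolding G_def by (auto intro!: derivative_eq_intros F)
    have Gc: "continuous_on UNIV G" by (rule DERIV_continuous_on) (rule has_field_derivative_at_within[OF G])
    have [measurable]: "G \<in> borel_measurable borel" by (rule borel_measurable_continuous_onI[OF Gc])
    have Gp: "is_primitive a b G g"
      by (rule is_primitive_C1) (auto intro: has_field_derivative_at_within[OF G] continuous_on_subset[OF g(1)])
    have D: "is_primitive a b (\<lambda>t. K t - G t) (\<lambda>t. k t - g t)" by (rule is_primitive_diff[OF K(1) Gp])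
    have kg: "set_integrable lborel {a..b} (\<lambda>t. k t - g t)" using D by (simp add: is_primitive_def)
    have small: "(LINT t:{a..b}|lborel. \<bar>k t - g t\<bar>) \<le> e"
    proof -
      have "(LINT t:{a..b}|lborel. \<bar>k t - g t\<bar>) = (\<integral>t. indicator {a..b} t * \<bar>g t - k0 t\<bar> \<partial>lborel)"
        unfolding set_lebesgue_integral_def
        by (intro Bochner_Integration.integral_cong) (auto simp: k0_def indicator_def)
      then show ?thesis using g(2) by simp
    qed
    have unif: "\<bar>K t - G t\<bar> \<le> e" if t: "t \<in> {a..b}" for t
    proof -
      have "K t - G t = (LINT s:{a..t}|lborel. k s - g s)"
        using D t by (auto simp: is_primitive_def G_def)
      also have "\<bar>\<dots>\<bar> \<le> (LINT s:{a..t}|lborel. \<bar>k s - g s\<bar>)"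
        using set_integral_norm_bound[of lborel "{a..t}" "\<lambda>s. k s - g s"] set_integrable_subset[OF kg, of "{a..t}"] t
        by auto
      also have "\<dots> \<le> (LINT s:{a..b}|lborel. \<bar>k s - g s\<bar>)"
        unfolding set_lebesgue_integral_def
      proof (rule integral_mono)
        show "integrable lborel (\<lambda>s. indicator {a..t} s *\<^sub>R \<bar>k s - g s\<bar>)"
          using set_integrable_abs[OF set_integrable_subset[OF kg, of "{a..t}"]] t by (auto simp: set_integrable_def)
        show "integrable lborel (\<lambda>s. indicator {a..b} s *\<^sub>R \<bar>k s - g s\<bar>)"
          using set_integrable_abs[OF kg] by (simp add: set_integrable_def)
        show "indicator {a..t} s *\<^sub>R \<bar>k s - g s\<bar> \<le> indicator {a..b} s *\<^sub>R \<bar>k s - g s\<bar>" for s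
          using t by (auto simp: indicator_def)
      qed
      finally show ?thesis using small by linarith
    qed
    have KGi: "set_integrable lborel {a..b} (\<lambda>t. K t - G t)"
      by (rule borel_integrable_atLeastAtMost')
        (intro continuous_on_diff continuous_on_subset[OF K(2)] continuous_on_subset[OF Gc], auto)
    have KGs: "(LINT t:{a..b}|lborel. \<bar>K t - G t\<bar>) \<le> (b - a) * e"
    proof -
      have "(LINT t:{a..b}|lborel. \<bar>K t - G t\<bar>) \<le> (LINT t:{a..b}|lborel. e)"
      proof (rule set_integral_mono)
        show "set_integrable lborel {a..b} (\<lambda>t. \<bar>K t - G t\<bar>)" by (rule set_integrable_abs[OF KGi])
        show "set_integrable lborel {a..b} (\<lambda>t. e)"
          by (rule borel_integrable_atLeastAtMost') simp
      qed (rule unif)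
      also have "\<dots> = (b - a) * e" using ab by (simp add: set_lebesgue_integral_def)
      finally show ?thesis .
    qed
    note i1 = shell_integrable(1)[OF Ki Km assms(1) C(1) z(1)]
    note i2 = shell_integrable(1)[OF ki K(3) assms(2) C(2) z(2)]
    have mD: "(\<lambda>t. K t - G t) \<in> borel_measurable borel" "(\<lambda>t. k t - g t) \<in> borel_measurable borel"
      by measurable
    note j1 = shell_integrable[OF KGi mD(1) assms(1) C(1) z(1)]
    note j2 = shell_integrable[OF kg mD(2) assms(2) C(2) z(2)]
    have Gi: "integrable lebesgue (\<lambda>x. G (norm x) * \<alpha> x + g (norm x) * \<beta> x)"
    proof -
      have "integrable lebesgue (\<lambda>x. (K (norm x) * \<alpha> x - (K (norm x) - G (norm x)) * \<alpha> x) + (k (norm x) * \<beta> x - (k (norm x) - g (norm x)) * \<beta> x))"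
        by (intro Bochner_Integration.integrable_add Bochner_Integration.integrable_diff i1 i2 j1(1) j2(1)) auto
      then show ?thesis by (simp add: algebra_simps)
    qed
    have "I = I - (\<integral>x. G (norm x) * \<alpha> x + g (norm x) * \<beta> x \<partial>lebesgue)"
      using C1[OF G g(1)] by simp
    also have "\<dots> = (\<integral>x. (K (norm x) * \<alpha> x + k (norm x) * \<beta> x) - (G (norm x) * \<alpha> x + g (norm x) * \<beta> x) \<partial>lebesgue)"
      unfolding I_def by (rule Bochner_Integration.integral_diff[symmetric, OF Bochner_Integration.integrable_add[OF i1 i2] Gi]) auto
    also have "\<dots> = (\<integral>x. (K (norm x) - G (norm x)) * \<alpha> x + (k (norm x) - g (norm x)) * \<beta> x \<partial>lebesgue)"
      by (rule Bochner_Integration.integral_cong) (auto simp: algebra_simps)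
    also have "\<dots> = (\<integral>x. (K (norm x) - G (norm x)) * \<alpha> x \<partial>lebesgue) + (\<integral>x. (k (norm x) - g (norm x)) * \<beta> x \<partial>lebesgue)"
      by (rule Bochner_Integration.integral_add[OF j1(1) j2(1)]) auto
    finally have "\<bar>I\<bar> \<le> \<bar>\<integral>x. (K (norm x) - G (norm x)) * \<alpha> x \<partial>lebesgue\<bar> + \<bar>\<integral>x. (k (norm x) - g (norm x)) * \<beta> x \<partial>lebesgue\<bar>"
      by linarith
    also have "\<dots> \<le> C * (sphere_area DIM('a) b * ((b - a) * e)) + C * (sphere_area DIM('a) b * e)"
    proof (rule add_mono)
      show "\<bar>\<integral>x. (K (norm x) - G (norm x)) * \<alpha> x \<partial>lebesgue\<bar> \<le> C * (sphere_area DIM('a) b * ((b - a) * e))"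
        by (rule order_trans[OF j1(2)]) (auto intro!: mult_left_mono KGs sphere_area_nonneg C0)
      show "\<bar>\<integral>x. (k (norm x) - g (norm x)) * \<beta> x \<partial>lebesgue\<bar> \<le> C * (sphere_area DIM('a) b * e)"
        by (rule order_trans[OF j2(2)]) (auto intro!: mult_left_mono small sphere_area_nonneg C0)
    qed
    also have "\<dots> = B * e" by (simp add: B_def algebra_simps)
    finally show ?thesis .
  qed note bound = this
  have "I = 0"
  proof (rule ccontr)
    assume "I \<noteq> 0"
    have B0: "0 \<le> B" using C0 sphere_area_nonneg ab by (auto simp: B_def intro!: mult_nonneg_nonneg)
    have "\<bar>I\<bar> \<le> B * (\<bar>I\<bar> / (2 * (B + 1)))" by (rule bound) (use \<open>I \<noteq> 0\<close> B0 in auto)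
    also have "\<dots> \<le> \<bar>I\<bar> / 2"
      using B0 by (simp add: field_simps)
    finally show False using \<open>I \<noteq> 0\<close> by simp
  qed
  then show ?thesis by (simp add: I_def)
qed

section \<open>Radial maps and their weak derivatives\<close>

text \<open>With \<open>t = |x|\<close> this is the matrix with eigenvalue \<open>k t\<close> in the direction of \<open>x\<close> and \<open>K t / t\<close> on its
orthogonal complement.\<close>

definition radial_gradient :: "(real \<Rightarrow> real) \<Rightarrow> (real \<Rightarrow> real) \<Rightarrow> real ^ 'n::finite \<Rightarrow> real ^ 'n ^ 'n" where
  "radial_gradient K k x = (\<chi> i j. K (norm x) / norm x * (if i = j then 1 else 0)
     + (k (norm x) - K (norm x) / norm x) * (x $ i * x $ j / (norm x)\<^sup>2))"

lemma norm_rank_one_update: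
  fixes e :: "real ^ 'n::finite"
  assumes "norm e = 1"
  shows "(norm (\<chi> i j. q * (if i = j then 1 else 0) + (p - q) * (e $ i * e $ j) :: real ^ 'n ^ 'n))\<^sup>2 =
    p\<^sup>2 + (real CARD('n) - 1) * q\<^sup>2"
proof -
  have s: "(\<Sum>i\<in>UNIV. (e $ i)\<^sup>2) = 1"
    using assms by (simp add: norm_vec_def L2_set_def)
  have "(norm (\<chi> i j. q * (if i = j then 1 else 0) + (p - q) * (e $ i * e $ j) :: real ^ 'n ^ 'n))\<^sup>2 =
     (\<Sum>i\<in>UNIV. \<Sum>j\<in>UNIV. (q * (if i = j then 1 else 0) + (p - q) * (e $ i * e $ j))\<^sup>2)"
    unfolding power2_norm_eq_inner inner_vec_def by (simp add: power2_eq_square)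
  also have "\<dots> = (\<Sum>i\<in>UNIV. \<Sum>j\<in>UNIV. (if i = j then q\<^sup>2 + 2 * q * (p - q) * (e $ i)\<^sup>2 else 0) + (p - q)\<^sup>2 * ((e $ i)\<^sup>2 * (e $ j)\<^sup>2))"
    by (intro sum.cong refl) (auto simp: power2_eq_square algebra_simps)
  also have "\<dots> = (\<Sum>i\<in>UNIV. q\<^sup>2 + 2 * q * (p - q) * (e $ i)\<^sup>2 + (p - q)\<^sup>2 * (e $ i)\<^sup>2)"
    by (simp add: sum.distrib sum_distrib_left[symmetric] s)
  also have "\<dots> = real CARD('n) * q\<^sup>2 + 2 * q * (p - q) + (p - q)\<^sup>2"
    by (simp add: sum.distrib sum_distrib_left[symmetric] s)
  finally show ?thesis by (simp add: power2_eq_square algebra_simps)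
qed

text \<open>After a rotation taking \<open>e\<close> to a coordinate vector the matrix is diagonal.\<close>

lemma det_rank_one_update:
  fixes e :: "real ^ 'n::finite"
  assumes "norm e = 1"
  shows "det (\<chi> i j. q * (if i = j then 1 else 0) + (p - q) * (e $ i * e $ j) :: real ^ 'n ^ 'n) =
    p * q ^ (CARD('n) - 1)"
proof -
  let ?A = "(\<chi> i j. q * (if i = j then 1 else 0) + (p - q) * (e $ i * e $ j)) :: real ^ 'n ^ 'n"
  fix a :: 'n
  obtain f :: "real ^ 'n \<Rightarrow> real ^ 'n" where f: "orthogonal_transformation f" "f e = axis a 1"
    using orthogonal_transformation_exists[of e "axis a 1 :: real ^ 'n"] assms by auto
  define Q where "Q = matrix f"
  have Q: "orthogonal_matrix Q" and fQ: "f = (*v) Q"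
    using f(1) orthogonal_transformation_matrix[of f] matrix_works[of f] orthogonal_transformation_linear[of f]
    by (auto simp: Q_def fun_eq_iff)
  have QQ: "Q ** transpose Q = mat 1" using Q by (simp add: orthogonal_matrix_def)
  have QQ': "(\<Sum>k\<in>UNIV. Q $ i $ k * Q $ j $ k) = (if i = j then 1 else 0)" for i j
  proof -
    have "(Q ** transpose Q) $ i $ j = (mat 1 :: real ^ 'n ^ 'n) $ i $ j" by (simp only: QQ)
    then show ?thesis by (simp add: matrix_matrix_mult_def transpose_def mat_def)
  qed
  have Qe: "(\<Sum>k\<in>UNIV. Q $ i $ k * e $ k) = (if i = a then 1 else 0)" for i
  proof -
    have "(Q *v e) $ i = (axis a 1 :: real ^ 'n) $ i" using f(2) by (simp add: fQ)
    then show ?thesis by (simp add: matrix_vector_mult_def axis_def)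
  qed
  define B where "B = Q ** ?A ** transpose Q"
  have B: "B $ i $ j = (if i = j then (if i = a then p else q) else 0)" for i j
  proof -
    have QA: "(Q ** ?A) $ i $ l = q * Q $ i $ l + (p - q) * (if i = a then 1 else 0) * e $ l" for l
    proof -
      have "(Q ** ?A) $ i $ l = (\<Sum>k\<in>UNIV. (if k = l then q * Q $ i $ l else 0) + (p - q) * e $ l * (Q $ i $ k * e $ k))"
        unfolding matrix_matrix_mult_def by (auto intro!: sum.cong simp: algebra_simps)
      then show ?thesis by (simp add: sum.distrib sum_distrib_left[symmetric] Qe)
    qed
    have "B $ i $ j = (\<Sum>l\<in>UNIV. (Q ** ?A) $ i $ l * Q $ j $ l)"
      by (simp add: B_def matrix_matrix_mult_def[of "Q ** ?A"] transpose_def)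
    also have "\<dots> = (\<Sum>l\<in>UNIV. q * (Q $ i $ l * Q $ j $ l) + (p - q) * (if i = a then 1 else 0) * (Q $ j $ l * e $ l))"
      unfolding QA by (rule sum.cong) (simp_all add: algebra_simps)
    also have "\<dots> = q * (if i = j then 1 else 0) + (p - q) * (if i = a then 1 else 0) * (if j = a then 1 else 0)"
      by (simp only: sum.distrib sum_distrib_left[symmetric] Qe QQ')
    finally show ?thesis by auto
  qed
  have "det B = (\<Prod>i\<in>UNIV. B $ i $ i)" by (rule det_diagonal) (simp add: B)
  also have "\<dots> = (\<Prod>i\<in>insert a (UNIV - {a}). if i = a then p else q)"
    by (simp add: B insert_absorb)
  also have "\<dots> = p * q ^ (CARD('n) - 1)"
    by (subst prod.insert) (auto simp: card_Diff_singleton)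
  finally have "det B = p * q ^ (CARD('n) - 1)" .
  moreover have "det B = det ?A"
  proof -
    have "det Q * det Q = 1"
      using det_orthogonal_matrix[OF Q] by auto
    then show ?thesis unfolding B_def det_mul det_transpose by (simp add: mult.commute mult.left_commute)
  qed
  ultimately show ?thesis by simp
qed

lemma radial_gradient_rank_one:
  "radial_gradient K k x = (\<chi> i j. K (norm x) / norm x * (if i = j then 1 else 0)
    + (k (norm x) - K (norm x) / norm x) * ((x /\<^sub>R norm x) $ i * (x /\<^sub>R norm x) $ j))"
  unfolding radial_gradient_def by (simp add: power2_eq_square divide_inverse mult_ac)

lemma norm_radial_gradient:
  fixes x :: "real ^ 'n::finite"
  assumes "x \<noteq> 0"
  shows "norm (radial_gradient K k x) = sqrt ((k (norm x))\<^sup>2 + (real CARD('n) - 1) * (K (norm x) / norm x)\<^sup>2)"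
proof -
  have e: "norm (x /\<^sub>R norm x) = 1" using assms by simp
  show ?thesis
    using norm_rank_one_update[OF e, of "K (norm x) / norm x" "k (norm x)"]
    unfolding radial_gradient_rank_one[symmetric] by (metis norm_ge_zero real_sqrt_unique)
qed

lemma det_radial_gradient:
  fixes x :: "real ^ 'n::finite"
  assumes "x \<noteq> 0"
  shows "det (radial_gradient K k x) = k (norm x) * (K (norm x) / norm x) ^ (CARD('n) - 1)"
proof -
  have e: "norm (x /\<^sub>R norm x) = 1" using assms by simp
  show ?thesis
    using det_rank_one_update[OF e, of "K (norm x) / norm x" "k (norm x)"]
    unfolding radial_gradient_rank_one[symmetric] .
qed

lemma radial_map_nth: "radial_map K x $ i = K (norm x) / norm x * x $ i"
  by (simp add: radial_map_def divide_inverse)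

lemma norm_radial_map: "x \<noteq> 0 \<Longrightarrow> norm (radial_map K x) = \<bar>K (norm x)\<bar>"
proof -
  assume "x \<noteq> 0"
  then have "norm (x /\<^sub>R norm x) = 1" by simp
  then show ?thesis by (simp only: radial_map_def norm_scaleR mult_1_right)
qed

text \<open>Component \<open>i\<close> is the radial function \<open>K |x| / |x|\<close> times the linear function \<open>x $ i\<close>.\<close>

lemma radial_map_has_derivative:
  fixes x :: "real ^ 'n::finite"
  assumes K: "(K has_real_derivative k (norm x)) (at (norm x))" and x: "x \<noteq> 0"
  shows "((\<lambda>x. radial_map K x $ i) has_derivative (\<lambda>h. radial_gradient K k x $ i \<bullet> h)) (at x)"
proof -
  let ?t = "norm x"
  have t: "?t > 0" using x by simp
  have n: "(norm has_derivative (\<lambda>h. h \<bullet> sgn x)) (at x)"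
    using has_derivative_norm[OF x] by (simp add: inner_commute)
  have "((\<lambda>t. K t / t) has_real_derivative (k ?t - K ?t / ?t) / ?t) (at ?t)"
    using t by (auto intro!: derivative_eq_intros K simp: field_simps)
  then have "((\<lambda>t. K t / t) has_derivative (\<lambda>d. (k ?t - K ?t / ?t) / ?t * d)) (at ?t)"
    by (simp only: has_field_derivative_def)
  from has_derivative_compose[OF n this]
  have 1: "((\<lambda>x. K (norm x) / norm x) has_derivative (\<lambda>h. (k ?t - K ?t / ?t) / ?t * (h \<bullet> sgn x))) (at x)" .
  have 2: "((\<lambda>x. x $ i) has_derivative (\<lambda>h. h $ i)) (at x)"
    by (rule bounded_linear_imp_has_derivative[OF bounded_linear_vec_nth])
  from has_derivative_mult[OF 1 2]
  have "((\<lambda>x. radial_map K x $ i) has_derivative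
      (\<lambda>h. K ?t / ?t * h $ i + (k ?t - K ?t / ?t) / ?t * (h \<bullet> sgn x) * x $ i)) (at x)"
    unfolding radial_map_nth .
  moreover have "K ?t / ?t * h $ i + (k ?t - K ?t / ?t) / ?t * (h \<bullet> sgn x) * x $ i = radial_gradient K k x $ i \<bullet> h" for h
  proof -
    have "radial_gradient K k x $ i \<bullet> h =
       (\<Sum>j\<in>UNIV. (if i = j then K ?t / ?t * h $ i else 0) + (k ?t - K ?t / ?t) * (x $ i / ?t\<^sup>2) * (x $ j * h $ j))"
      unfolding inner_vec_def radial_gradient_def by (auto intro!: sum.cong simp: algebra_simps)
    also have "\<dots> = K ?t / ?t * h $ i + (k ?t - K ?t / ?t) * (x $ i / ?t\<^sup>2) * (x \<bullet> h)"
      by (simp only: sum.distrib sum_distrib_left[symmetric] inner_vec_def inner_real_def) simp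
    finally show ?thesis using t
      by (simp add: sgn_div_norm inner_commute power2_eq_square divide_inverse mult_ac)
  qed
  ultimately show ?thesis by simp
qed

lemma compact_subset_annulus:
  fixes S :: "(real ^ 'n::finite) set"
  assumes "compact S" "S \<subseteq> annulus R" "1 < R"
  obtains a b where "1 < a" "a \<le> b" "b < R" "\<And>x. x \<in> S \<Longrightarrow> a \<le> norm x \<and> norm x \<le> b"
proof (cases "S = {}")
  case True
  then show thesis using that[of "(1+R)/2" "(1+R)/2"] assms(3) by simp
next
  case False
  have c: "continuous_on S norm" by (intro continuous_intros)
  obtain x where x: "x \<in> S" "\<forall>y\<in>S. norm x \<le> norm y" using continuous_attains_inf[OF assms(1) False c] by auto
  obtain y where y: "y \<in> S" "\<forall>z\<in>S. norm z \<le> norm y" using continuous_attains_sup[OF assms(1) False c] by auto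
  show thesis
    by (rule that[of "norm x" "norm y"]) (use x y assms(2) in \<open>auto simp: annulus_def\<close>)
qed

lemma open_annulus: "open (annulus R :: (real ^ 'n::finite) set)"
proof -
  have "(annulus R :: (real ^ 'n) set) = {x. 1 < norm x} \<inter> {x. norm x < R}" by (auto simp: annulus_def)
  then show ?thesis by (auto intro!: open_Int open_Collect_less continuous_intros)
qed

lemma locally_integrable_on_annulusI:
  fixes f :: "real ^ 'n::finite \<Rightarrow> 'b::euclidean_space"
  assumes f: "f \<in> borel_measurable borel" and le: "\<And>x. x \<in> annulus R \<Longrightarrow> norm (f x) \<le> h (norm x)"
    and h: "h \<in> borel_measurable borel" "\<And>a b. 1 < a \<Longrightarrow> a \<le> b \<Longrightarrow> b < R \<Longrightarrow> set_integrable lborel {a..b} h"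
    and R: "1 < R"
  shows "locally_integrable_on (annulus R) f"
  unfolding locally_integrable_on_def
proof (intro allI impI)
  fix S :: "(real ^ 'n) set" assume "compact S \<and> S \<subseteq> annulus R"
  then have S: "compact S" "S \<subseteq> annulus R" by auto
  obtain a b where ab: "1 < a" "a \<le> b" "b < R" "\<And>x. x \<in> S \<Longrightarrow> a \<le> norm x \<and> norm x \<le> b"
    using compact_subset_annulus[OF S R] by blast
  define \<alpha> :: "real ^ 'n \<Rightarrow> real" where "\<alpha> = (\<lambda>x. indicator {a..b} (norm x))"
  have \<alpha>: "\<alpha> \<in> borel_measurable borel" unfolding \<alpha>_def by measurable
  have i: "integrable lebesgue (\<lambda>x. h (norm x) * \<alpha> x)"
    by (rule shell_integrable(1)[OF h(2)[OF ab(1-3)] h(1) \<alpha>, of 1]) (auto simp: \<alpha>_def indicator_def)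
  have [measurable]: "S \<in> sets borel" using S(1) by (simp add: borel_compact)
  note [measurable] = f
  show "set_integrable lebesgue S f"
    unfolding set_integrable_def
  proof (rule Bochner_Integration.integrable_bound[OF i])
    show "(\<lambda>x. indicator S x *\<^sub>R f x) \<in> borel_measurable lebesgue"
      by (rule measurable_lebesgueI) measurable
    have "norm (indicator S x *\<^sub>R f x) \<le> norm (h (norm x) * \<alpha> x)" for x
    proof (cases "x \<in> S")
      case True
      then show ?thesis using le[of x] S(2) ab(4)[OF True] by (auto simp: \<alpha>_def)
    qed simp
    then show "AE x in lebesgue. norm (indicator S x *\<^sub>R f x) \<le> norm (h (norm x) * \<alpha> x)" by simp
  qed
qed

lemma borel_measurable_radial_map:
  fixes K :: "real \<Rightarrow> real"
  assumes [measurable]: "K \<in> borel_measurable borel"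
  shows "radial_map K \<in> borel_measurable borel"
  unfolding radial_map_def[abs_def] by measurable

lemma borel_measurable_radial_gradient_nth:
  fixes K k :: "real \<Rightarrow> real"
  assumes [measurable]: "K \<in> borel_measurable borel" "k \<in> borel_measurable borel"
  shows "(\<lambda>x :: real ^ 'n::finite. radial_gradient K k x $ i $ j) \<in> borel_measurable borel"
proof -
  have [measurable]: "(\<lambda>x :: real ^ 'n. x $ l) \<in> borel_measurable borel" for l
    by (intro borel_measurable_continuous_onI continuous_intros)
  show ?thesis unfolding radial_gradient_def by simp
qed

lemma borel_measurable_radial_gradient:
  fixes K k :: "real \<Rightarrow> real"
  assumes "K \<in> borel_measurable borel" "k \<in> borel_measurable borel"
  shows "(radial_gradient K k :: real ^ 'n::finite \<Rightarrow> _) \<in> borel_measurable borel"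
proof (subst borel_measurable_euclidean_space, intro ballI)
  fix b :: "real ^ 'n ^ 'n" assume "b \<in> Basis"
  then obtain i j where "b = axis i (axis j 1)" by (auto simp: Basis_vec_def)
  then show "(\<lambda>x. radial_gradient K k x \<bullet> b) \<in> borel_measurable borel"
    using borel_measurable_radial_gradient_nth[OF assms, of i j] by (simp add: inner_axis)
qed

text \<open>For continuously differentiable \<open>K\<close> this is integration by parts; \<open>radial_functional_zero\<close> extends it to
primitives of integrable functions. The functions \<open>\<alpha>1\<close>, \<open>\<alpha>2\<close> and \<open>\<beta>\<close> in the proof collect the factors of
\<open>K\<close> and \<open>k\<close> for a fixed test function.\<close>

lemma radial_map_has_weak_derivative:
  fixes K k :: "real \<Rightarrow> real"
  assumes R: "1 < R" and K: "continuous_on UNIV K" and k: "k \<in> borel_measurable borel"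
    and prim: "\<And>a b. 1 < a \<Longrightarrow> a \<le> b \<Longrightarrow> b < R \<Longrightarrow> is_primitive a b K k"
  shows "has_weak_derivative_on (radial_map K :: real ^ 'n::finite \<Rightarrow> _) (radial_gradient K k) (annulus R)"
  unfolding has_weak_derivative_on_def
proof (intro conjI allI impI)
  have Km: "K \<in> borel_measurable borel" by (rule borel_measurable_continuous_onI[OF K])
  note [measurable] = Km k
  show "locally_integrable_on (annulus R) (radial_map K :: real ^ 'n \<Rightarrow> _)"
  proof (rule locally_integrable_on_annulusI[OF borel_measurable_radial_map[OF Km] _ _ _ R])
    show "norm (radial_map K x) \<le> \<bar>K (norm x)\<bar>" if "x \<in> annulus R" for x :: "real ^ 'n"
      using that norm_radial_map[of x K] by (cases "x = 0") (auto simp: annulus_def)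
    show "set_integrable lborel {a..b} (\<lambda>t. \<bar>K t\<bar>)" for a b
      by (rule borel_integrable_atLeastAtMost') (intro continuous_intros continuous_on_subset[OF K], simp)
  qed measurable
  show "locally_integrable_on (annulus R) (radial_gradient K k :: real ^ 'n \<Rightarrow> _)"
  proof (rule locally_integrable_on_annulusI[OF borel_measurable_radial_gradient[OF Km k] _ _ _ R])
    show "norm (radial_gradient K k x) \<le> \<bar>k (norm x)\<bar> + real CARD('n) * \<bar>K (norm x)\<bar>"
      if x: "x \<in> annulus R" for x :: "real ^ 'n"
    proof -
      have t: "norm x > 1" "x \<noteq> 0" using x by (auto simp: annulus_def)
      have c: "1 \<le> real CARD('n)" using one_le_card_finite[where 'a='n] by simp
      have "(real CARD('n) - 1) * (K (norm x) / norm x)\<^sup>2 \<le> (real CARD('n))\<^sup>2 * (K (norm x))\<^sup>2"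
      proof (rule mult_mono)
        have "real CARD('n) * 1 \<le> real CARD('n) * real CARD('n)" by (rule mult_left_mono) (use c in auto)
        then show "real CARD('n) - 1 \<le> (real CARD('n))\<^sup>2" unfolding power2_eq_square by linarith
        have "\<bar>K (norm x)\<bar> / norm x \<le> \<bar>K (norm x)\<bar> / 1"
          by (rule divide_left_mono) (use t in auto)
        moreover have "\<bar>K (norm x) / norm x\<bar> = \<bar>K (norm x)\<bar> / norm x"
          by (simp only: abs_divide abs_norm_cancel)
        ultimately have "\<bar>K (norm x) / norm x\<bar> \<le> \<bar>K (norm x)\<bar>" by simp
        then show "(K (norm x) / norm x)\<^sup>2 \<le> (K (norm x))\<^sup>2" by (rule abs_le_square_iff[THEN iffD1])
      qed auto
      then have "norm (radial_gradient K k x) \<le> sqrt ((k (norm x))\<^sup>2 + (real CARD('n) * \<bar>K (norm x)\<bar>)\<^sup>2)"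
        unfolding norm_radial_gradient[OF t(2)] by (simp add: power_mult_distrib)
      also have "\<dots> \<le> \<bar>k (norm x)\<bar> + \<bar>real CARD('n) * \<bar>K (norm x)\<bar>\<bar>"
        by (rule sqrt_sum_squares_le_sum_abs)
      finally show ?thesis by (simp add: abs_mult)
    qed
    show "set_integrable lborel {a..b} (\<lambda>t. \<bar>k t\<bar> + real CARD('n) * \<bar>K t\<bar>)" if "1 < a" "a \<le> b" "b < R" for a b
    proof (rule set_integral_add(1))
      show "set_integrable lborel {a..b} (\<lambda>t. \<bar>k t\<bar>)"
        using prim[OF that] by (intro set_integrable_abs) (simp add: is_primitive_def)
      show "set_integrable lborel {a..b} (\<lambda>t. real CARD('n) * \<bar>K t\<bar>)"
        by (rule borel_integrable_atLeastAtMost') (intro continuous_intros continuous_on_subset[OF K], simp)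
    qed
  qed measurable
  fix \<phi> :: "real ^ 'n \<Rightarrow> real" and i j :: 'n
  assume \<phi>: "test_function (annulus R) \<phi>"
  define S where "S = closure {x. \<phi> x \<noteq> 0}"
  note S = test_function_facts[OF \<phi> S_def]
  obtain a b where ab: "1 < a" "a \<le> b" "b < R" "\<And>x. x \<in> S \<Longrightarrow> a \<le> norm x \<and> norm x \<le> b"
    using compact_subset_annulus[OF S(1,2) R] by blast
  have out: "\<phi> x = 0" "partial_deriv j \<phi> x = 0" if "\<not> (a \<le> norm x \<and> norm x \<le> b)" for x
  proof -
    have "x \<notin> S" using ab(4)[of x] that by blast
    then show "\<phi> x = 0" "partial_deriv j \<phi> x = 0" by (simp_all add: S(3,4))
  qed
  have out': "\<phi> x = 0" "partial_deriv j \<phi> x = 0" if "norm x > b" for x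
    using out[of x] that by auto
  obtain C0 where C0: "\<And>x. \<bar>\<phi> x\<bar> \<le> C0" "0 \<le> C0"
    using continuous_compact_support[OF S(6) out'(1)] by blast
  obtain C1 where C1: "\<And>x. \<bar>partial_deriv j \<phi> x\<bar> \<le> C1" "0 \<le> C1"
    using continuous_compact_support[OF S(7) out'(2)] by blast
  define e where "e x = x $ i * x $ j / (norm x)\<^sup>2" for x :: "real ^ 'n"
  define \<delta> :: real where "\<delta> = (if i = j then 1 else 0)"
  define \<alpha>1 where "\<alpha>1 x = x $ i / norm x * partial_deriv j \<phi> x" for x
  define \<alpha>2 where "\<alpha>2 x = (\<delta> - e x) / norm x * \<phi> x" for x
  define \<beta> where "\<beta> x = e x * \<phi> x" for x
  have [measurable]: "(\<lambda>x :: real ^ 'n. x $ l) \<in> borel_measurable borel" for l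
    by (intro borel_measurable_continuous_onI continuous_intros)
  have [measurable]: "\<phi> \<in> borel_measurable borel" "partial_deriv j \<phi> \<in> borel_measurable borel"
    by (rule borel_measurable_continuous_onI[OF S(6)] borel_measurable_continuous_onI[OF S(7)])+
  have m: "\<alpha>1 \<in> borel_measurable borel" "\<alpha>2 \<in> borel_measurable borel" "\<beta> \<in> borel_measurable borel"
    unfolding \<alpha>1_def[abs_def] \<alpha>2_def[abs_def] \<beta>_def[abs_def] e_def[abs_def] by measurable
  have xi: "\<bar>x $ l / norm x\<bar> \<le> 1" for x :: "real ^ 'n" and l
    using component_le_norm_cart[of x l] by (cases "x = 0") (auto simp: divide_le_eq_1)
  have e1: "\<bar>e x\<bar> \<le> 1" for x
  proof -
    have "\<bar>e x\<bar> = \<bar>x $ i / norm x\<bar> * \<bar>x $ j / norm x\<bar>"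
      by (simp add: e_def power2_eq_square abs_mult)
    also have "\<dots> \<le> 1 * 1" by (intro mult_mono xi) auto
    finally show ?thesis by simp
  qed
  define C where "C = C1 + 2 * C0"
  have b1: "\<bar>\<alpha>1 x\<bar> \<le> C1" for x
    using mult_mono[OF xi[of x i] C1(1)[of x]] C1(2) by (simp add: \<alpha>1_def abs_mult)
  have b2: "\<bar>\<alpha>2 x\<bar> \<le> 2 * C0" for x
  proof (cases "1 \<le> norm x")
    case True
    have d: "\<bar>\<delta> - e x\<bar> \<le> 2" using e1[of x] by (auto simp: \<delta>_def)
    have "\<bar>(\<delta> - e x) / norm x\<bar> \<le> 2"
      using True d by (simp add: divide_le_eq)
    from mult_mono[OF this C0(1)[of x]] show ?thesis using C0(2) by (simp add: \<alpha>2_def abs_mult)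
  next
    case False
    then show ?thesis using out(1)[of x] ab(1) C0(2) by (simp add: \<alpha>2_def)
  qed
  have b3: "\<bar>\<beta> x\<bar> \<le> C0" for x
    using mult_mono[OF e1[of x] C0(1)[of x]] C0(2) by (simp add: \<beta>_def abs_mult)
  have z: "\<alpha>1 x = 0" "\<alpha>2 x = 0" "\<beta> x = 0" if "\<not> (a \<le> norm x \<and> norm x \<le> b)" for x
    using out[OF that] by (simp_all add: \<alpha>1_def \<alpha>2_def \<beta>_def)
  have supp: "indicator (annulus R) x *\<^sub>R v = v" if "\<not> (a \<le> norm x \<and> norm x \<le> b) \<Longrightarrow> v = 0" for x :: "real ^ 'n" and v :: real
    using that ab(1-3) by (cases "a \<le> norm x \<and> norm x \<le> b") (auto simp: annulus_def indicator_def)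
  have h1: "indicator (annulus R) x *\<^sub>R (radial_map K x $ i * partial_deriv j \<phi> x) = K (norm x) * \<alpha>1 x" for x K
    using out(2)[of x] by (subst supp) (auto simp: radial_map_nth \<alpha>1_def)
  have h2: "indicator (annulus R) x *\<^sub>R (radial_gradient K k x $ i $ j * \<phi> x) = K (norm x) * \<alpha>2 x + k (norm x) * \<beta> x" for x K k
    using out(1)[of x] by (subst supp) (auto simp: radial_gradient_def \<alpha>2_def \<beta>_def \<delta>_def e_def algebra_simps diff_divide_distrib add_divide_distrib)
  have zero: "(\<integral>x. K (norm x) * (\<alpha>1 x + \<alpha>2 x) + k (norm x) * \<beta> x \<partial>lebesgue) = 0"
  proof (rule radial_functional_zero[of "\<lambda>x. \<alpha>1 x + \<alpha>2 x" \<beta> C a b K k])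
    show "(\<lambda>x. \<alpha>1 x + \<alpha>2 x) \<in> borel_measurable borel" "\<beta> \<in> borel_measurable borel"
      using m by (auto intro: borel_measurable_add)
    show "\<bar>\<alpha>1 x + \<alpha>2 x\<bar> \<le> C" for x using b1[of x] b2[of x] by (auto simp: C_def)
    show "\<bar>\<beta> x\<bar> \<le> C" for x using b3[of x] C1(2) C0(2) by (auto simp: C_def)
    show "is_primitive a b K k" by (rule prim[OF ab(1-3)])
    fix F f assume F: "\<And>t. (F has_real_derivative f t) (at t)" and f: "continuous_on UNIV f"
    have Fc: "continuous_on UNIV F" by (rule DERIV_continuous_on) (rule has_field_derivative_at_within[OF F])
    have [measurable]: "F \<in> borel_measurable borel" "f \<in> borel_measurable borel"
      by (rule borel_measurable_continuous_onI[OF f] borel_measurable_continuous_onI[OF Fc])+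
    note [measurable] = m
    have "(\<integral>x. indicator (annulus R) x * (radial_map F x $ i * partial_deriv j \<phi> x +
        (radial_gradient F f x $ i \<bullet> axis j 1) * \<phi> x) \<partial>lborel) = 0"
    proof (rule integration_by_parts_test_function[OF open_annulus _ _ \<phi>, where f' = "\<lambda>x h. radial_gradient F f x $ i \<bullet> h"])
      show "((\<lambda>x. radial_map F x $ i) has_derivative (\<bullet>) (radial_gradient F f x $ i)) (at x)" if "x \<in> annulus R" for x
        using radial_map_has_derivative[of F f x i] F that by (cases "x = 0") (auto simp: annulus_def)
      have cn: "continuous_on (annulus R) (\<lambda>x. F (norm x))" "continuous_on (annulus R) (\<lambda>x. f (norm x))"
        by (rule continuous_on_compose2[OF Fc] continuous_on_compose2[OF f]; auto intro: continuous_intros)+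
      show "continuous_on (annulus R) (\<lambda>x. radial_gradient F f x $ i \<bullet> axis j 1)"
        by (auto simp: inner_axis radial_gradient_def annulus_def[abs_def]
            intro!: continuous_intros cn[unfolded annulus_def])
    qed
    also have "(\<lambda>x. indicator (annulus R) x * (radial_map F x $ i * partial_deriv j \<phi> x +
        (radial_gradient F f x $ i \<bullet> axis j 1) * \<phi> x)) = (\<lambda>x. F (norm x) * (\<alpha>1 x + \<alpha>2 x) + f (norm x) * \<beta> x)"
    proof
      fix x
      show "indicator (annulus R) x * (radial_map F x $ i * partial_deriv j \<phi> x +
        (radial_gradient F f x $ i \<bullet> axis j 1) * \<phi> x) = F (norm x) * (\<alpha>1 x + \<alpha>2 x) + f (norm x) * \<beta> x"
        using h1[of x F] h2[of x F f] by (simp add: inner_axis distrib_left)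
    qed
    finally show "(\<integral>x. F (norm x) * (\<alpha>1 x + \<alpha>2 x) + f (norm x) * \<beta> x \<partial>lebesgue) = 0"
      by (subst integral_completion) auto
  qed (use K k ab z in auto)
  have Kab: "set_integrable lborel {a..b} K" "set_integrable lborel {a..b} k"
    using prim[OF ab(1-3)] borel_integrable_atLeastAtMost'[OF continuous_on_subset[OF K], of a b]
    by (auto simp: is_primitive_def)
  have i1: "integrable lebesgue (\<lambda>x. K (norm x) * \<alpha>1 x)"
    by (rule shell_integrable(1)[OF Kab(1) Km m(1) b1]) (rule z(1))
  have i2: "integrable lebesgue (\<lambda>x. K (norm x) * \<alpha>2 x)"
    by (rule shell_integrable(1)[OF Kab(1) Km m(2) b2]) (rule z(2))
  have i3: "integrable lebesgue (\<lambda>x. k (norm x) * \<beta> x)"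
    by (rule shell_integrable(1)[OF Kab(2) k m(3) b3]) (rule z(3))
  have "(LINT x:annulus R|lebesgue. radial_map K x $ i * partial_deriv j \<phi> x) = (\<integral>x. K (norm x) * \<alpha>1 x \<partial>lebesgue)"
    unfolding set_lebesgue_integral_def h1 ..
  moreover have "(LINT x:annulus R|lebesgue. radial_gradient K k x $ i $ j * \<phi> x) =
      (\<integral>x. K (norm x) * \<alpha>2 x + k (norm x) * \<beta> x \<partial>lebesgue)"
    unfolding set_lebesgue_integral_def h2 ..
  moreover have "(\<integral>x. K (norm x) * (\<alpha>1 x + \<alpha>2 x) + k (norm x) * \<beta> x \<partial>lebesgue) =
      (\<integral>x. K (norm x) * \<alpha>1 x \<partial>lebesgue) + (\<integral>x. K (norm x) * \<alpha>2 x + k (norm x) * \<beta> x \<partial>lebesgue)"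
    unfolding Bochner_Integration.integral_add[OF i1 Bochner_Integration.integrable_add[OF i2 i3], symmetric]
    by (rule Bochner_Integration.integral_cong) (auto simp: algebra_simps)
  ultimately show "(LINT x:annulus R|lebesgue. radial_map K x $ i * partial_deriv j \<phi> x) =
      - (LINT x:annulus R|lebesgue. radial_gradient K k x $ i $ j * \<phi> x)"
    using zero by linarith
qed

section \<open>Two tools for the regularity of radial profiles\<close>

text \<open>A bound on half-open intervals is not stable under complements, so it cannot be carried to Borel sets
directly. Instead, the difference of the distribution functions is itself a distribution function; the
measure that belongs to it and the Stieltjes measure of \<open>K\<close> add up to \<open>N\<close> on half-lines, and this
equality does extend to all Borel sets.\<close>

lemma finite_borel_measure_null_if_Ioc_le:
  fixes K :: "real \<Rightarrow> real"
  assumes N: "finite_borel_measure N" and K: "mono K" "continuous_on UNIV K" "(K \<longlongrightarrow> 0) at_bot"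
    and le: "\<And>a b. a < b \<Longrightarrow> K b - K a \<le> measure N {a<..b}"
    and top: "K b0 = m" "\<And>t. b0 \<le> t \<Longrightarrow> K t = m"
    and A: "A \<in> sets borel" "measure N A = 0"
  shows "measure (interval_measure K) A = 0"
proof -
  interpret N: finite_borel_measure N by fact
  have Kc: "continuous (at_right a) K" for a
    using K(2) by (auto simp: continuous_on_eq_continuous_at intro: continuous_at_imp_continuous_within)
  have Kmono: "x \<le> y \<Longrightarrow> K x \<le> K y" for x y using K(1) by (auto simp: mono_def)
  define F where "F x = cdf N x - K x" for x
  have Fmono: "F x \<le> F y" if "x \<le> y" for x y
  proof (cases "x = y")
    case False
    then have "K y - K x \<le> measure N {x<..y}" using that by (intro le) auto
    also have "\<dots> = cdf N y - cdf N x" using False that by (subst N.cdf_diff_eq) auto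
    finally show ?thesis by (simp add: F_def)
  qed simp
  have Fc: "continuous (at_right a) F" for a
    unfolding F_def using N.cdf_is_right_cont Kc by (intro continuous_diff)
  have Fbot: "(F \<longlongrightarrow> 0) at_bot"
    using tendsto_diff[OF N.cdf_lim_at_bot K(3)] by (simp add: F_def[abs_def])
  have Ktop: "(K \<longlongrightarrow> m) at_top"
    using top(2) by (intro tendsto_eventually) (auto simp: eventually_at_top_linorder)
  have Ftop: "(F \<longlongrightarrow> measure N UNIV - m) at_top"
    using tendsto_diff[OF N.cdf_lim_at_top Ktop] by (simp add: F_def[abs_def] N.borel_UNIV)
  have m0: "0 \<le> m"
    by (rule tendsto_upperbound[OF K(3)]) (use Kmono top in \<open>auto simp: eventually_at_bot_linorder intro!: exI[of _ b0]\<close>)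
  have F0: "0 \<le> measure N UNIV - m"
  proof (rule tendsto_lowerbound[OF Ftop])
    have "0 \<le> F x" for x
      by (rule tendsto_upperbound[OF Fbot]) (use Fmono in \<open>auto simp: eventually_at_bot_linorder intro!: exI[of _ x]\<close>)
    then show "\<forall>\<^sub>F x in at_top. 0 \<le> F x" by simp
  qed simp
  interpret IK: finite_borel_measure "interval_measure K"
    by (rule finite_borel_measure_interval_measure[OF Kmono Kc K(3) Ktop m0])
  interpret IF: finite_borel_measure "interval_measure F"
    by (rule finite_borel_measure_interval_measure[OF Fmono Fc Fbot Ftop F0])
  have sb: "sets (borel :: real measure) = sigma_sets UNIV (range atMost)"
    by (simp add: borel_eq_atMost)
  have Asig: "A \<in> sigma_sets UNIV (range atMost)" using A(1) sb by blast
  then have "measure (interval_measure K) A + measure (interval_measure F) A = measure N A"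
  proof (induction rule: sigma_sets_induct_disjoint[of "range atMost" UNIV, consumes 0, case_names stable Pow sets basic empty compl union])
    case (basic A)
    then obtain x where "A = {..x}" by auto
    then show ?case
      using measure_interval_measure_Iic[OF Kmono Kc K(3), of x] measure_interval_measure_Iic[OF Fmono Fc Fbot, of x]
      by (simp add: F_def[of x] cdf_def)
  next
    case (compl A)
    then have A: "A \<in> sets borel" using sb by blast
    have "measure (interval_measure K) UNIV = m" "measure (interval_measure F) UNIV = measure N UNIV - m"
      using interval_measure_UNIV[OF Kmono Kc K(3) Ktop m0] interval_measure_UNIV[OF Fmono Fc Fbot Ftop F0] m0 F0
      by (simp_all add: measure_def)
    moreover have "measure (interval_measure K) A + measure (interval_measure F) A = measure N A"
      using compl by simp
    ultimately show ?case
      using N.finite_measure_compl[of A] IK.finite_measure_compl[of A] IF.finite_measure_compl[of A] A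
      by (simp add: N.borel_UNIV N.M_is_borel)
  next
    case (union A)
    then have A: "range A \<subseteq> sets borel" using sb by blast
    have "(\<lambda>i. measure (interval_measure K) (A i) + measure (interval_measure F) (A i)) sums
        (measure (interval_measure K) (\<Union>i. A i) + measure (interval_measure F) (\<Union>i. A i))"
      using A union(1) by (intro sums_add IK.finite_measure_UNION IF.finite_measure_UNION) auto
    moreover have "(\<lambda>i. measure N (A i)) sums measure N (\<Union>i. A i)"
      using A union(1) by (intro N.finite_measure_UNION) (auto simp: N.M_is_borel)
    moreover have "measure (interval_measure K) (A i) + measure (interval_measure F) (A i) = measure N (A i)" for i
    proof -
      have "A i \<in> sigma_sets UNIV (range atMost)" using union(2) by blast
      then show ?thesis by (rule union.IH)
    qed
    ultimately show ?case using sums_unique2 by (simp only:)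
  qed (use Asig in \<open>auto simp: Int_stable_def\<close>)
  then show ?thesis
    using A(2) measure_nonneg[of "interval_measure K" A] measure_nonneg[of "interval_measure F" A] by linarith
qed

text \<open>The weight \<open>2 m t s (m (t^2 - a^2))\<close> is the derivative of a smooth step in \<open>t^2\<close>: it has integral \<open>1\<close> and
is supported in \<open>[a, c m]\<close>, where \<open>c m\<close> tends to \<open>a\<close>. Monotonicity of \<open>w\<close> confines the integral between
\<open>w a\<close> and \<open>w (c m)\<close>.\<close>

lemma smooth_step_kernel:
  fixes w :: "real \<Rightarrow> real"
  assumes S: "smooth_step S s" and a: "0 < a"
    and w: "continuous_on {0..} w" "\<And>x y. 0 \<le> x \<Longrightarrow> x \<le> y \<Longrightarrow> w x \<le> w y" "\<And>x. x < 0 \<Longrightarrow> w x = 0"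
  shows "integrable lborel (\<lambda>t. w t * (2 * real (Suc m) * t * s (real (Suc m) * (t\<^sup>2 - a\<^sup>2))))"
    and "(\<lambda>m. \<integral>t. w t * (2 * real (Suc m) * t * s (real (Suc m) * (t\<^sup>2 - a\<^sup>2))) \<partial>lborel) \<longlonglongrightarrow> w a"
proof -
  note S = smooth_stepD[OF S]
  define c where "c m = sqrt (a\<^sup>2 + 1 / real (Suc m))" for m
  have ca: "a \<le> c m" for m
    unfolding c_def using a by (intro real_le_rsqrt) auto
  have csq: "(c m)\<^sup>2 = a\<^sup>2 + 1 / real (Suc m)" for m by (simp add: c_def add_nonneg_nonneg)
  have cS: "real (Suc m) * ((c m)\<^sup>2 - a\<^sup>2) = 1" for m
    unfolding csq by (simp del: of_nat_Suc)
  define u where "u m t = 2 * real (Suc m) * t * s (real (Suc m) * (t\<^sup>2 - a\<^sup>2))" for m t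
  have uc: "continuous_on X (u m)" for m X
    unfolding u_def by (intro continuous_intros continuous_on_compose2[OF S(7)]) auto
  have u0: "0 \<le> u m t" if "0 \<le> t" for m t using that S(8) by (simp add: u_def)
  have uz: "w t * u m t = indicator {a..c m} t * (w t * u m t)" for m t
  proof (cases "t < 0 \<or> t \<in> {a..c m}")
    case True
    then show ?thesis using w(3)[of t] by (auto simp: indicator_def)
  next
    case False
    then have t: "0 \<le> t" "t < a \<or> c m < t" by auto
    have "s (real (Suc m) * (t\<^sup>2 - a\<^sup>2)) = 0"
    proof (rule ccontr)
      assume "s (real (Suc m) * (t\<^sup>2 - a\<^sup>2)) \<noteq> 0"
      then have *: "0 < real (Suc m) * (t\<^sup>2 - a\<^sup>2)" "real (Suc m) * (t\<^sup>2 - a\<^sup>2) < 1" using S(9) by blast+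
      then have "a\<^sup>2 < t\<^sup>2" by (simp add: zero_less_mult_iff del: of_nat_Suc)
      moreover have "t\<^sup>2 < (c m)\<^sup>2"
      proof -
        have "real (Suc m) * (t\<^sup>2 - a\<^sup>2) < real (Suc m) * ((c m)\<^sup>2 - a\<^sup>2)" using *(2) cS by simp
        then show ?thesis by (simp del: of_nat_Suc)
      qed
      ultimately have "a < t" "t < c m"
        using t(1) a ca[of m] by (auto intro: power2_less_imp_less)
      then show False using t(2) by simp
    qed
    then show ?thesis by (simp add: u_def)
  qed
  have wc: "continuous_on {a..c m} w" for m
    by (rule continuous_on_subset[OF w(1)]) (use a in auto)
  have i: "integrable lborel (\<lambda>t. indicator {a..c m} t * (w t * u m t))" for m
    using borel_integrable_atLeastAtMost'[OF continuous_on_mult[OF wc uc], of m m]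
    by (simp add: set_integrable_def)
  then have i': "integrable lborel (\<lambda>t. w t * u m t)" for m by (simp only: uz[symmetric])
  then show "integrable lborel (\<lambda>t. w t * (2 * real (Suc m) * t * s (real (Suc m) * (t\<^sup>2 - a\<^sup>2))))"
    by (simp only: u_def)
  have one: "(\<integral>t. indicator {a..c m} t * u m t \<partial>lborel) = 1" "integrable lborel (\<lambda>t. indicator {a..c m} t * u m t)" for m
  proof -
    have d: "((\<lambda>t. S (real (Suc m) * (t\<^sup>2 - a\<^sup>2))) has_real_derivative u m t) (at t)" for t
    proof -
      have "((\<lambda>t. real (Suc m) * (t\<^sup>2 - a\<^sup>2)) has_real_derivative real (Suc m) * (2 * t)) (at t)"
        by (auto intro!: derivative_eq_intros)
      from DERIV_chain2[OF S(6) this] show ?thesis by (simp add: u_def mult_ac)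
    qed
    have "is_primitive a (c m) (\<lambda>t. S (real (Suc m) * (t\<^sup>2 - a\<^sup>2))) (u m)"
      by (rule is_primitive_C1[OF has_field_derivative_at_within[OF d] uc])
    then have "S (real (Suc m) * ((c m)\<^sup>2 - a\<^sup>2)) - S (real (Suc m) * (a\<^sup>2 - a\<^sup>2)) = (LINT t:{a..c m}|lborel. u m t)"
      "set_integrable lborel {a..c m} (u m)"
      using ca[of m] by (auto simp: is_primitive_def simp del: of_nat_Suc)
    then show "(\<integral>t. indicator {a..c m} t * u m t \<partial>lborel) = 1" "integrable lborel (\<lambda>t. indicator {a..c m} t * u m t)"
      unfolding cS using S(2)[of 0] S(3)[of 1] by (simp_all add: set_lebesgue_integral_def set_integrable_def)
  qed
  have low: "w a \<le> (\<integral>t. w t * u m t \<partial>lborel)" for m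
  proof -
    have "w a = (\<integral>t. w a * (indicator {a..c m} t * u m t) \<partial>lborel)" by (simp add: one)
    also have "\<dots> \<le> (\<integral>t. indicator {a..c m} t * (w t * u m t) \<partial>lborel)"
    proof (rule integral_mono)
      show "w a * (indicator {a..c m} t * u m t) \<le> indicator {a..c m} t * (w t * u m t)" for t
        using w(2)[of a t] u0[of t m] a by (auto simp: indicator_def intro!: mult_right_mono)
    qed (use one i in auto)
    finally show ?thesis by (simp only: uz[symmetric])
  qed
  have up: "(\<integral>t. w t * u m t \<partial>lborel) \<le> w (c m)" for m
  proof -
    have "(\<integral>t. indicator {a..c m} t * (w t * u m t) \<partial>lborel) \<le> (\<integral>t. w (c m) * (indicator {a..c m} t * u m t) \<partial>lborel)"
    proof (rule integral_mono)
      show "indicator {a..c m} t * (w t * u m t) \<le> w (c m) * (indicator {a..c m} t * u m t)" for t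
        using w(2)[of t "c m"] u0[of t m] a by (auto simp: indicator_def intro!: mult_right_mono)
    qed (use one i in auto)
    then show ?thesis by (simp add: one uz[symmetric])
  qed
  have "c \<longlonglongrightarrow> sqrt (a\<^sup>2 + 0)"
    unfolding c_def using LIMSEQ_inverse_real_of_nat
    by (intro tendsto_intros) (simp add: inverse_eq_divide)
  then have cl: "c \<longlonglongrightarrow> a" using a by simp
  have wl: "((\<lambda>m. w (c m)) \<longlongrightarrow> w a) sequentially"
    by (rule continuous_on_tendsto_compose[OF w(1) cl]) (use a ca in \<open>auto intro!: always_eventually intro: order_trans[OF less_imp_le[OF a]]\<close>)
  have "(\<lambda>m. \<integral>t. w t * u m t \<partial>lborel) \<longlonglongrightarrow> w a"
    by (rule tendsto_sandwich[OF _ _ tendsto_const wl]) (use low up in auto)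
  then show "(\<lambda>m. \<integral>t. w t * (2 * real (Suc m) * t * s (real (Suc m) * (t\<^sup>2 - a\<^sup>2))) \<partial>lborel) \<longlonglongrightarrow> w a"
    by (simp only: u_def)
qed

section \<open>Regularity of the profile of a Sobolev radial map\<close>

lemma test_function_partial_deriv:
  assumes "test_function U \<phi>"
  shows "test_function U (partial_deriv j \<phi>)"
proof -
  define S where "S = closure {x. \<phi> x \<noteq> 0}"
  note S = test_function_facts[OF assms S_def]
  have "C_k (Suc k) \<phi>" for k using assms by (simp only: test_function_def)
  then have "C_k k (partial_deriv j \<phi>)" for k by simp
  then show ?thesis by (rule test_functionI[OF _ S(1,2,4)])
qed

lemma locally_integrable_on_vec_nth:
  fixes h :: "real ^ 'n::finite \<Rightarrow> real ^ 'm::finite"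
  assumes "locally_integrable_on U h"
  shows "locally_integrable_on U (\<lambda>x. h x $ i)"
  unfolding locally_integrable_on_def set_integrable_def
proof (intro allI impI)
  fix K assume "compact K \<and> K \<subseteq> U"
  then have "integrable lebesgue (\<lambda>x. indicator K x *\<^sub>R h x)"
    using assms by (simp add: locally_integrable_on_def set_integrable_def)
  then have "integrable lebesgue (\<lambda>x. (indicator K x *\<^sub>R h x) $ i)"
    by (intro integrable_bounded_linear[OF bounded_linear_vec_nth])
  then show "integrable lebesgue (\<lambda>x. indicator K x *\<^sub>R h x $ i)" by simp
qed

text \<open>The step is taken in the squared norm, which is a polynomial in the coordinates.\<close>

lemma smooth_step_norm:
  fixes c d :: real
  assumes "smooth_step S s"
  shows "C_k k (\<lambda>x::real^'n::finite. S (d * ((norm x)\<^sup>2 - c)))"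
    and "partial_deriv j (\<lambda>x::real^'n. S (d * ((norm x)\<^sup>2 - c))) x = s (d * ((norm x)\<^sup>2 - c)) * (d * (2 * x $ j))"
proof -
  note S = smooth_stepD[OF assms]
  have "C_k k (\<lambda>x::real^'n. d * (x \<bullet> x + (- c)))" for k
    by (intro C_k_mult C_k_const C_k_add C_k_inner)
  then have "C_k k (\<lambda>x::real^'n. S (d * (x \<bullet> x + (- c))))" by (intro C_k_compose[OF S(1)])
  then show "C_k k (\<lambda>x::real^'n. S (d * ((norm x)\<^sup>2 - c)))" by (simp add: power2_norm_eq_inner)
  have D: "((\<lambda>x::real^'n. d * (x \<bullet> x - c)) has_derivative (\<lambda>h. d * (2 * (x \<bullet> h)))) (at x)"
    by (auto intro!: derivative_eq_intros simp: inner_commute)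
  have "partial_deriv j (\<lambda>x. S (d * (x \<bullet> x - c))) x = s (d * (x \<bullet> x - c)) * partial_deriv j (\<lambda>x. d * (x \<bullet> x - c)) x"
    by (rule partial_deriv_compose(2)[OF S(6)]) (use D in \<open>auto simp: differentiable_def\<close>)
  also have "partial_deriv j (\<lambda>x. d * (x \<bullet> x - c)) x = d * (2 * x $ j)"
    by (simp add: partial_deriv_eq[OF D] inner_axis)
  finally show "partial_deriv j (\<lambda>x::real^'n. S (d * ((norm x)\<^sup>2 - c))) x = s (d * ((norm x)\<^sup>2 - c)) * (d * (2 * x $ j))"
    by (simp add: power2_norm_eq_inner)
qed

lemma shell_test_function:
  fixes a b R :: real and d :: real
  assumes S: "smooth_step S s" and ab: "1 < a" "a < b" and d: "0 < d" "b\<^sup>2 + 1 / d < R\<^sup>2" and R: "0 < R"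
  shows "test_function (annulus R) (\<lambda>x::real^'n::finite. S (d * ((norm x)\<^sup>2 - a\<^sup>2)) - S (d * ((norm x)\<^sup>2 - b\<^sup>2)))"
proof -
  define c where "c = sqrt (b\<^sup>2 + 1 / d)"
  have c2: "c\<^sup>2 = b\<^sup>2 + 1 / d" using d(1) by (simp add: c_def)
  have c0: "0 \<le> c" using d(1) by (simp add: c_def)
  have cR: "c < R" using d(2) R c0 by (intro power2_less_imp_less[of c R]) (auto simp: c2)
  show ?thesis
  proof (rule test_functionI[of _ "cball 0 c - ball 0 a"])
    show "C_k k (\<lambda>x::real^'n. S (d * ((norm x)\<^sup>2 - a\<^sup>2)) - S (d * ((norm x)\<^sup>2 - b\<^sup>2)))" for k
    proof -
      have "C_k k (\<lambda>x::real^'n. S (d * ((norm x)\<^sup>2 - a\<^sup>2)) + (- 1) * S (d * ((norm x)\<^sup>2 - b\<^sup>2)))"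
        by (intro C_k_add C_k_mult C_k_const smooth_step_norm(1)[OF S])
      then show ?thesis by simp
    qed
    show "compact (cball 0 c - ball (0::real^'n) a)" by (intro compact_diff compact_cball open_ball)
    show "cball 0 c - ball (0::real^'n) a \<subseteq> annulus R" using ab cR by (auto simp: annulus_def)
    show "S (d * ((norm x)\<^sup>2 - a\<^sup>2)) - S (d * ((norm x)\<^sup>2 - b\<^sup>2)) = 0" if x: "x \<notin> cball 0 c - ball 0 a" for x :: "real^'n"
    proof (cases "norm x < a")
      case True
      have "(norm x)\<^sup>2 \<le> a\<^sup>2" "a\<^sup>2 \<le> b\<^sup>2" using True ab by (auto intro!: power_mono)
      then have "d * ((norm x)\<^sup>2 - a\<^sup>2) \<le> 0" "d * ((norm x)\<^sup>2 - b\<^sup>2) \<le> 0"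
        using d(1) by (auto intro!: mult_nonneg_nonpos)
      then show ?thesis using smooth_stepD(2)[OF S] by simp
    next
      case False
      then have "c < norm x" using x by auto
      then have "c\<^sup>2 \<le> (norm x)\<^sup>2" using c0 by (intro power_mono) auto
      then have *: "1 / d \<le> (norm x)\<^sup>2 - b\<^sup>2" by (simp add: c2)
      have "b\<^sup>2 \<ge> a\<^sup>2" using ab by (auto intro!: power_mono)
      then have "1 / d \<le> (norm x)\<^sup>2 - a\<^sup>2" using * by linarith
      then have "1 \<le> d * ((norm x)\<^sup>2 - a\<^sup>2)" "1 \<le> d * ((norm x)\<^sup>2 - b\<^sup>2)"
        using * d(1) by (simp_all add: pos_divide_le_eq mult.commute)
      then show ?thesis using smooth_stepD(3)[OF S] by simp
    qed
  qed
qed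

text \<open>The Gauss theorem for the shell \<open>a < |x| \<le> b\<close>. In the weak derivative identity for component \<open>i\<close> and
direction \<open>i\<close>, insert a smooth approximation of the indicator of the shell and sum over \<open>i\<close>. The trace
appears on one side; on the other the gradient of the test function is radial and concentrates on the
two boundary spheres.\<close>

lemma radial_weak_divergence:
  fixes G :: "real ^ 'n::finite \<Rightarrow> real ^ 'n ^ 'n"
  assumes R: "1 < R" and K: "continuous_on UNIV K" "mono K" "\<And>t. 0 \<le> K t"
    and G: "has_weak_derivative_on (radial_map K) G (annulus R)"
    and \<tau>: "integrable lebesgue (\<lambda>x. indicator (annulus R) x * (\<Sum>i\<in>UNIV. G x $ i $ i))"
    and ab: "1 < a" "a < b" "b < R"
  shows "sphere_area CARD('n) b * K b - sphere_area CARD('n) a * K a =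
    (\<integral>x. indicator {a<..b} (norm x) * (indicator (annulus R) x * (\<Sum>i\<in>UNIV. G x $ i $ i)) \<partial>lebesgue)"
proof -
  obtain S s where S: "smooth_step S s" using smooth_step_exists by blast
  note SD = smooth_stepD[OF S]
  define \<tau> where "\<tau> x = indicator (annulus R) x * (\<Sum>i\<in>UNIV. G x $ i $ i)" for x
  note \<tau>i = \<tau>[folded \<tau>_def]
  define w where "w t = sphere_area CARD('n) t * K t" for t
  have wc: "continuous_on {0..} w" "\<And>x y. 0 \<le> x \<Longrightarrow> x \<le> y \<Longrightarrow> w x \<le> w y" "\<And>x. x < 0 \<Longrightarrow> w x = 0"
  proof -
    have "continuous_on {0..} (\<lambda>t. (real CARD('n) * unit_ball_vol (real CARD('n)) * t ^ (CARD('n) - 1)) * K t)"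
      by (intro continuous_intros continuous_on_subset[OF K(1)]) auto
    then show "continuous_on {0..} w"
      by (rule continuous_on_cong[THEN iffD1, rotated -1]) (auto simp: w_def sphere_area_def)
    show "w x \<le> w y" if "0 \<le> x" "x \<le> y" for x y
      unfolding w_def using K(2,3) that sphere_area_mono[of "CARD('n)" x y]
      by (intro mult_mono) (auto simp: sphere_area_nonneg mono_def)
    show "w x = 0" if "x < 0" for x using that by (simp add: w_def sphere_area_def)
  qed
  have b2: "b\<^sup>2 < R\<^sup>2" using ab by (intro power_strict_mono) auto
  \<comment> \<open>from \<open>m0\<close> on, the outer transition layer of the step stays inside the annulus\<close>
  obtain m0 :: nat where m0: "1 / (R\<^sup>2 - b\<^sup>2) < real m0" using reals_Archimedean2 by blast
  define d where "d m = real (Suc (m + m0))" for m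
  have d0: "0 < d m" for m by (simp add: d_def)
  have dR: "b\<^sup>2 + 1 / d m < R\<^sup>2" for m
  proof -
    have "1 / (R\<^sup>2 - b\<^sup>2) < d m" using m0 by (simp add: d_def)
    then have "1 < d m * (R\<^sup>2 - b\<^sup>2)" using b2 by (simp add: field_simps)
    then have "1 / d m < R\<^sup>2 - b\<^sup>2" using d0[of m] by (simp add: pos_divide_less_eq mult.commute)
    then show ?thesis by simp
  qed
  define \<phi> where "\<phi> m x = S (d m * ((norm x)\<^sup>2 - a\<^sup>2)) - S (d m * ((norm x)\<^sup>2 - b\<^sup>2))" for m and x :: "real ^ 'n"
  have test: "test_function (annulus R) (\<phi> m)" for m
    unfolding \<phi>_def using R by (intro shell_test_function[OF S ab(1,2) d0 dR]) auto
  define u where "u c m t = 2 * d m * t * s (d m * (t\<^sup>2 - c\<^sup>2))" for c m t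
  have pd: "partial_deriv i (\<phi> m) x = (s (d m * ((norm x)\<^sup>2 - a\<^sup>2)) - s (d m * ((norm x)\<^sup>2 - b\<^sup>2))) * (d m * (2 * x $ i))" for i m x
  proof -
    have diff: "(\<lambda>x::real^'n. S (d m * ((norm x)\<^sup>2 - c))) differentiable at x" for c
      using smooth_step_norm(1)[OF S, of "Suc 0" "d m" c] by auto
    have "partial_deriv i (\<phi> m) x = partial_deriv i (\<lambda>x. S (d m * ((norm x)\<^sup>2 - a\<^sup>2))) x - partial_deriv i (\<lambda>x. S (d m * ((norm x)\<^sup>2 - b\<^sup>2))) x"
    proof -
      have "((\<lambda>x. S (d m * ((norm x)\<^sup>2 - c))) has_derivative frechet_derivative (\<lambda>x. S (d m * ((norm x)\<^sup>2 - c))) (at x)) (at x)" for c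
        using diff[of c] by (simp add: frechet_derivative_works)
      from partial_deriv_eq[OF has_derivative_diff[OF this[of "a\<^sup>2"] this[of "b\<^sup>2"]]]
      show ?thesis unfolding \<phi>_def[abs_def] by (simp add: partial_deriv_def)
    qed
    then show ?thesis by (simp add: smooth_step_norm(2)[OF S] left_diff_distrib)
  qed
  have ident: "(\<integral>t. w t * (u a m t) \<partial>lborel) - (\<integral>t. w t * (u b m t) \<partial>lborel) = - (\<integral>x. \<tau> x * \<phi> m x \<partial>lebesgue)" for m
  proof -
    have li: "locally_integrable_on (annulus R) (\<lambda>x. radial_map K x $ i)" "locally_integrable_on (annulus R) (\<lambda>x. G x $ i $ i)"
      for i :: 'n
      using G by (auto simp: has_weak_derivative_on_def intro: locally_integrable_on_vec_nth locally_integrable_on_component)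
    note i1 = locally_integrable_times_test_function[OF li(1) test_function_partial_deriv[OF test]]
    note i2 = locally_integrable_times_test_function[OF li(2) test]
    have "(\<Sum>i\<in>UNIV. LINT x:annulus R|lebesgue. radial_map K x $ i * partial_deriv i (\<phi> m) x) =
        (\<Sum>i\<in>UNIV. - (LINT x:annulus R|lebesgue. G x $ i $ i * \<phi> m x))"
      using G test by (intro sum.cong refl) (simp add: has_weak_derivative_on_def)
    also have "\<dots> = - (\<Sum>i\<in>UNIV. LINT x:annulus R|lebesgue. G x $ i $ i * \<phi> m x)"
      by (simp add: sum_negf)
    also have "(\<Sum>i\<in>UNIV. LINT x:annulus R|lebesgue. G x $ i $ i * \<phi> m x) = (\<integral>x. \<tau> x * \<phi> m x \<partial>lebesgue)"
      unfolding set_lebesgue_integral_def using i2 unfolding set_integrable_def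
      by (subst Bochner_Integration.integral_sum[symmetric])
        (auto intro!: Bochner_Integration.integral_cong simp: \<tau>_def sum_distrib_left sum_distrib_right)
    also have "(\<Sum>i\<in>UNIV. LINT x:annulus R|lebesgue. radial_map K x $ i * partial_deriv i (\<phi> m) x) =
        (\<integral>x. (\<Sum>i\<in>UNIV. indicator (annulus R) x *\<^sub>R (radial_map K x $ i * partial_deriv i (\<phi> m) x)) \<partial>lebesgue)"
      unfolding set_lebesgue_integral_def using i1 unfolding set_integrable_def
      by (subst Bochner_Integration.integral_sum[symmetric]) auto
    also have "(\<lambda>x::real^'n. \<Sum>i\<in>UNIV. indicator (annulus R) x *\<^sub>R (radial_map K x $ i * partial_deriv i (\<phi> m) x)) =
        (\<lambda>x. K (norm x) * u a m (norm x) - K (norm x) * u b m (norm x))"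
    proof
      fix x :: "real ^ 'n"
      define t where "t = norm x"
      define q where "q = s (d m * (t\<^sup>2 - a\<^sup>2)) - s (d m * (t\<^sup>2 - b\<^sup>2))"
      have "radial_map K x $ i * partial_deriv i (\<phi> m) x = K t / t * q * 2 * d m * (x $ i * x $ i)" for i
        unfolding radial_map_nth pd q_def t_def by simp
      then have "(\<Sum>i\<in>UNIV. radial_map K x $ i * partial_deriv i (\<phi> m) x) = K t / t * q * 2 * d m * (x \<bullet> x)"
        by (simp only: sum_distrib_left[symmetric] inner_vec_def inner_real_def)
      also have "x \<bullet> x = t * t" by (simp add: t_def power2_norm_eq_inner[symmetric] power2_eq_square)
      also have "K t / t * q * 2 * d m * (t * t) = K t * u a m t - K t * u b m t"
        by (simp add: u_def q_def algebra_simps)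
      finally have *: "(\<Sum>i\<in>UNIV. radial_map K x $ i * partial_deriv i (\<phi> m) x) = K t * u a m t - K t * u b m t" .
      show "(\<Sum>i\<in>UNIV. indicator (annulus R) x *\<^sub>R (radial_map K x $ i * partial_deriv i (\<phi> m) x)) =
          K (norm x) * u a m (norm x) - K (norm x) * u b m (norm x)"
      proof (cases "x \<in> annulus R")
        case True
        then show ?thesis using * by (simp add: t_def)
      next
        case False
        have "partial_deriv i (\<phi> m) x = 0" for i
          using test_function_facts(4)[OF test refl, of x] test_function_facts(2)[OF test refl] False by blast
        then have "(\<Sum>i\<in>UNIV. radial_map K x $ i * partial_deriv i (\<phi> m) x) = 0" by simp
        then show ?thesis using * False by (simp add: t_def)
      qed
    qed
    also have "(\<integral>x. K (norm x) * u a m (norm x) - K (norm x) * u b m (norm x) \<partial>(lebesgue :: (real^'n) measure)) =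
        (\<integral>t. sphere_area CARD('n) t * (K t * u a m t - K t * u b m t) \<partial>lborel)"
    proof -
      have "(\<lambda>t. K t * u a m t - K t * u b m t) \<in> borel_measurable borel"
        unfolding u_def
        by (intro borel_measurable_continuous_onI continuous_intros continuous_on_compose2[OF SD(7)] K(1)) auto
      from integral_norm[OF this, where 'a = "real^'n"] show ?thesis by simp
    qed
    also have "\<dots> = (\<integral>t. w t * u a m t - w t * u b m t \<partial>lborel)"
      by (rule Bochner_Integration.integral_cong) (auto simp: w_def algebra_simps)
    also have "\<dots> = (\<integral>t. w t * u a m t \<partial>lborel) - (\<integral>t. w t * u b m t \<partial>lborel)"
    proof (rule Bochner_Integration.integral_diff)
      show "integrable lborel (\<lambda>t. w t * u a m t)" "integrable lborel (\<lambda>t. w t * u b m t)"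
        unfolding u_def d_def using ab by (intro smooth_step_kernel(1)[OF S _ wc]; auto)+
    qed
    finally show ?thesis .
  qed
  have L: "(\<lambda>m. \<integral>t. w t * u c m t \<partial>lborel) \<longlonglongrightarrow> w c" if "0 < c" for c
    unfolding u_def d_def
    using LIMSEQ_ignore_initial_segment[OF smooth_step_kernel(2)[OF S that wc], of m0] by (simp add: ac_simps)
  have \<phi>lim: "(\<lambda>m. \<phi> m x) \<longlonglongrightarrow> indicator {a<..b} (norm x)" for x
  proof -
    have "(\<lambda>m. S (d m * v)) \<longlonglongrightarrow> (if 0 < v then 1 else 0)" for v
      unfolding d_def using LIMSEQ_ignore_initial_segment[OF smooth_step_limit[OF S, of v], of "Suc m0"] by (simp add: ac_simps)
    from tendsto_diff[OF this[of "(norm x)\<^sup>2 - a\<^sup>2"] this[of "(norm x)\<^sup>2 - b\<^sup>2"]]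
    have "(\<lambda>m. \<phi> m x) \<longlonglongrightarrow> (if 0 < (norm x)\<^sup>2 - a\<^sup>2 then 1 else 0) - (if 0 < (norm x)\<^sup>2 - b\<^sup>2 then 1 else 0)"
      unfolding \<phi>_def .
    moreover have "0 < (norm x)\<^sup>2 - c\<^sup>2 \<longleftrightarrow> c < norm x" if "0 < c" for c
      using that abs_le_square_iff[of "norm x" c] by (auto simp: not_le[symmetric])
    ultimately show ?thesis using ab by (auto simp: indicator_def split: if_splits)
  qed
  have "(\<lambda>m. \<integral>x. \<tau> x * \<phi> m x \<partial>lebesgue) \<longlonglongrightarrow> (\<integral>x. \<tau> x * indicator {a<..b} (norm x) \<partial>lebesgue)"
  proof (rule integral_dominated_convergence)
    show "integrable lebesgue (\<lambda>x. \<bar>\<tau> x\<bar>)" using \<tau>i by (rule integrable_abs)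
    show "AE x in lebesgue. norm (\<tau> x * \<phi> m x) \<le> \<bar>\<tau> x\<bar>" for m
    proof (rule AE_I2)
      fix x :: "real ^ 'n"
      have "\<bar>\<phi> m x\<bar> \<le> 1"
        using SD(4,5)[of "d m * ((norm x)\<^sup>2 - a\<^sup>2)"] SD(4,5)[of "d m * ((norm x)\<^sup>2 - b\<^sup>2)"]
        unfolding \<phi>_def by linarith
      from mult_left_mono[OF this, of "\<bar>\<tau> x\<bar>"] show "norm (\<tau> x * \<phi> m x) \<le> \<bar>\<tau> x\<bar>" by (simp add: abs_mult)
    qed
    show "AE x in lebesgue. (\<lambda>m. \<tau> x * \<phi> m x) \<longlonglongrightarrow> \<tau> x * indicator {a<..b} (norm x)"
      by (intro AE_I2 tendsto_intros \<phi>lim)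
    show "(\<lambda>x. \<tau> x * \<phi> m x) \<in> borel_measurable lebesgue" for m
    proof (rule borel_measurable_times[OF borel_measurable_integrable[OF \<tau>i]])
      show "\<phi> m \<in> borel_measurable lebesgue"
        using test_function_facts(6)[OF test refl] by (intro measurable_lebesgueI borel_measurable_continuous_onI)
    qed
    show "(\<lambda>x. \<tau> x * indicator {a<..b} (norm x)) \<in> borel_measurable lebesgue"
    proof (rule borel_measurable_times[OF borel_measurable_integrable[OF \<tau>i]])
      show "(\<lambda>x::real^'n. indicator {a<..b} (norm x) :: real) \<in> borel_measurable lebesgue"
        by (rule measurable_lebesgueI) measurable
    qed
  qed
  then have "(\<lambda>m. - (\<integral>x. \<tau> x * \<phi> m x \<partial>lebesgue)) \<longlonglongrightarrow> - (\<integral>x. \<tau> x * indicator {a<..b} (norm x) \<partial>lebesgue)"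
    by (rule tendsto_minus)
  moreover have "(\<lambda>m. - (\<integral>x. \<tau> x * \<phi> m x \<partial>lebesgue)) \<longlonglongrightarrow> w a - w b"
    unfolding ident[symmetric] using ab by (intro tendsto_diff L) auto
  ultimately have "w a - w b = - (\<integral>x. \<tau> x * indicator {a<..b} (norm x) \<partial>lebesgue)"
    by (rule LIMSEQ_unique[rotated])
  then show ?thesis by (simp add: w_def \<tau>_def mult.commute)
qed

text \<open>Exhaustion of the annulus by compact shells.\<close>

lemma locally_integrable_on_annulus_measurable:
  fixes f :: "real ^ 'n::finite \<Rightarrow> real"
  assumes f: "locally_integrable_on (annulus R) f"
  shows "(\<lambda>x. indicator (annulus R) x * f x) \<in> borel_measurable lebesgue"
proof (rule borel_measurable_LIMSEQ_real)
  define S where "S m = cball 0 (R - inverse (real (Suc m))) - ball (0 :: real ^ 'n) (1 + inverse (real (Suc m)))" for m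
  have S: "compact (S m)" "S m \<subseteq> annulus R" for m
  proof -
    show "compact (S m)" unfolding S_def by (intro compact_diff compact_cball open_ball)
    have pos: "0 < inverse (real (Suc m))" by simp
    show "S m \<subseteq> annulus R"
    proof
      fix x assume "x \<in> S m"
      then have "norm x \<le> R - inverse (real (Suc m))" "1 + inverse (real (Suc m)) \<le> norm x"
        unfolding S_def by (simp_all add: not_less)
      with pos have "1 < norm x" "norm x < R" by linarith+
      then show "x \<in> annulus R" by (simp add: annulus_def)
    qed
  qed
  show "(\<lambda>x. indicator (S m) x * f x) \<in> borel_measurable lebesgue" for m
  proof -
    have "integrable lebesgue (\<lambda>x. indicator (S m) x *\<^sub>R f x)"
      using f S[of m] by (simp add: locally_integrable_on_def set_integrable_def)
    then show ?thesis by (auto dest: borel_measurable_integrable)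
  qed
  show "(\<lambda>m. indicator (S m) x * f x) \<longlonglongrightarrow> indicator (annulus R) x * f x" for x
  proof (cases "x \<in> annulus R")
    case True
    then have "0 < min (R - norm x) (norm x - 1)" by (simp add: annulus_def)
    then obtain m0 where m0: "inverse (real (Suc m0)) < min (R - norm x) (norm x - 1)"
      using reals_Archimedean by blast
    have "x \<in> S m" if "m \<ge> m0" for m
    proof -
      have "inverse (real (Suc m)) \<le> inverse (real (Suc m0))"
        using that by (intro le_imp_inverse_le) auto
      moreover have "inverse (real (Suc m0)) < R - norm x" "inverse (real (Suc m0)) < norm x - 1"
        using m0 by (simp_all only: min_less_iff_conj)
      ultimately have "norm x \<le> R - inverse (real (Suc m))" "1 + inverse (real (Suc m)) \<le> norm x"
        by linarith+
      then show ?thesis unfolding S_def by (simp only: Diff_iff mem_cball_0 mem_ball_0 not_less simp_thms)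
    qed
    then have "\<forall>\<^sub>F m in sequentially. indicator (S m) x * f x = f x"
      by (auto simp: eventually_sequentially intro!: exI[of _ m0])
    then show ?thesis using True by (simp add: tendsto_eventually)
  next
    case False
    then have "x \<notin> S m" for m using S(2)[of m] by blast
    then show ?thesis using False by simp
  qed
qed

text \<open>On a set of finite measure an \<open>n\<close>-th power integrable function is integrable.\<close>

lemma trace_integrable:
  fixes G :: "real ^ 'n::finite \<Rightarrow> real ^ 'n ^ 'n"
  assumes G: "locally_integrable_on (annulus R) G"
    and Gp: "set_integrable lebesgue (annulus R) (\<lambda>x. norm (G x) ^ CARD('n))"
  shows "integrable lebesgue (\<lambda>x. indicator (annulus R) x * (\<Sum>i\<in>UNIV. G x $ i $ i))"
proof -
  let ?A = "annulus R :: (real ^ 'n) set" and ?n = "CARD('n)"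
  have "(\<lambda>x. \<Sum>i\<in>UNIV. indicator ?A x * G x $ i $ i) \<in> borel_measurable lebesgue"
    by (intro borel_measurable_sum locally_integrable_on_annulus_measurable locally_integrable_on_component G)
  then have m: "(\<lambda>x. indicator ?A x * (\<Sum>i\<in>UNIV. G x $ i $ i)) \<in> borel_measurable lebesgue"
    by (simp add: sum_distrib_left)
  have "integrable lebesgue (indicat_real ?A)"
  proof (rule integrable_real_indicator)
    have "bounded ?A" by (rule bounded_subset[of "cball 0 R"]) (auto simp: annulus_def)
    then show "emeasure lebesgue ?A < \<infinity>"
      using emeasure_bounded_finite[of ?A] open_annulus[of R, where 'n='n] by (simp add: emeasure_completion borel_open)
  qed (simp add: open_annulus lebesgue_openin borel_open)
  then have b: "integrable lebesgue (\<lambda>x. real ?n * (indicat_real ?A x + indicator ?A x *\<^sub>R norm (G x) ^ ?n))"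
    using Gp by (intro integrable_mult_right Bochner_Integration.integrable_add) (auto simp: set_integrable_def)
  show ?thesis
  proof (rule Bochner_Integration.integrable_bound[OF b m], rule AE_I2)
    fix x
    have "norm (G x) \<le> 1 + norm (G x) ^ ?n"
    proof (cases "norm (G x) \<le> 1")
      case False
      then have "norm (G x) ^ 1 \<le> norm (G x) ^ ?n" by (intro power_increasing) (auto simp: Suc_leI)
      then show ?thesis by simp
    qed (simp add: add_increasing2)
    moreover have "\<bar>\<Sum>i\<in>UNIV. G x $ i $ i\<bar> \<le> real ?n * norm (G x)"
    proof -
      have "\<bar>G x $ i $ i\<bar> \<le> norm (G x)" for i
        using component_le_norm_cart[of "G x $ i" i] Finite_Cartesian_Product.norm_nth_le[of "G x" i] by linarith
      then have "(\<Sum>i\<in>UNIV. \<bar>G x $ i $ i\<bar>) \<le> (\<Sum>i\<in>(UNIV :: 'n set). norm (G x))" by (intro sum_mono)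
      then have "(\<Sum>i\<in>UNIV. \<bar>G x $ i $ i\<bar>) \<le> real ?n * norm (G x)" by simp
      with sum_abs show ?thesis by (rule order_trans)
    qed
    ultimately have "\<bar>\<Sum>i\<in>UNIV. G x $ i $ i\<bar> \<le> real ?n * (1 + norm (G x) ^ ?n)"
      using mult_left_mono[of "norm (G x)" "1 + norm (G x) ^ ?n" "real ?n"] by linarith
    then have *: "\<bar>indicator ?A x * (\<Sum>i\<in>UNIV. G x $ i $ i)\<bar> \<le> real ?n * (indicat_real ?A x + indicator ?A x *\<^sub>R norm (G x) ^ ?n)"
      by (auto simp: indicator_def)
    then show "norm (indicator ?A x * (\<Sum>i\<in>UNIV. G x $ i $ i)) \<le> norm (real ?n * (indicat_real ?A x + indicator ?A x *\<^sub>R norm (G x) ^ ?n))"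
    proof -
      have "0 \<le> real ?n * (indicat_real ?A x + indicator ?A x *\<^sub>R norm (G x) ^ ?n)"
        by (intro mult_nonneg_nonneg add_nonneg_nonneg) auto
      with * show ?thesis by (simp only: real_norm_def abs_of_nonneg)
    qed
  qed
qed

text \<open>Let \<open>N\<close> be the distribution of \<open>|x|\<close> under the density given by the absolute value of the divergence,
divided by the area of the unit sphere; it is absolutely continuous because null sets of radii are null
sets of points. The Gauss theorem bounds the increments of \<open>t^(n-1) K\<close> by \<open>N\<close>, and for \<open>t \<ge> 1\<close> they
dominate the increments of the increasing function \<open>K\<close>. Hence the Stieltjes measure of \<open>K\<close> is absolutely
continuous, and its density is the derivative of \<open>K\<close>.\<close>

lemma weakly_differentiable_radial_profile:
  fixes G :: "real ^ 'n::finite \<Rightarrow> real ^ 'n ^ 'n"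
  assumes R: "1 < R" and K: "continuous_on UNIV K" "mono K" "\<And>t. 0 \<le> K t"
    and const: "\<And>t. t \<le> 1 \<Longrightarrow> K t = K 1" "\<And>t. R \<le> t \<Longrightarrow> K t = K R"
    and G: "has_weak_derivative_on (radial_map K) G (annulus R)"
    and Gp: "set_integrable lebesgue (annulus R) (\<lambda>x. norm (G x) ^ CARD('n))"
  obtains k where "k \<in> borel_measurable borel" "\<And>t. 0 \<le> k t" "\<And>a b. a \<le> b \<Longrightarrow> is_primitive a b K k"
proof -
  define \<tau> where "\<tau> x = indicator (annulus R) x * (\<Sum>i\<in>UNIV. G x $ i $ i)" for x
  have \<tau>i: "integrable lebesgue \<tau>"
    unfolding \<tau>_def[abs_def] using G Gp by (intro trace_integrable) (auto simp: has_weak_derivative_on_def)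
  have \<tau>m [measurable]: "\<tau> \<in> borel_measurable lebesgue" using \<tau>i by simp
  define c where "c = sphere_area CARD('n) 1"
  have c: "0 < c" unfolding c_def by (rule sphere_area_pos) auto
  define M where "M = density lebesgue (\<lambda>x. ennreal (\<bar>\<tau> x\<bar> / c))"
  have nM: "norm \<in> M \<rightarrow>\<^sub>M (borel :: real measure)"
    unfolding M_def using measurable_norm_lebesgue[where 'a = "real^'n"] by simp
  define N where "N = distr M borel norm"
  have N: "emeasure N B = ennreal (\<integral>x. indicator B (norm x) * (\<bar>\<tau> x\<bar> / c) \<partial>lebesgue)"
    if [measurable]: "B \<in> sets borel" for B
  proof -
    have [measurable]: "norm -` B \<in> sets (lebesgue :: (real^'n) measure)"
      using measurable_sets[OF measurable_norm_lebesgue[where 'a = "real^'n"] that] by simp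
    have "emeasure N B = emeasure M (norm -` B)"
      unfolding N_def using nM by (subst emeasure_distr) (auto simp: M_def)
    also have "\<dots> = (\<integral>\<^sup>+x. ennreal (indicator B (norm x) * (\<bar>\<tau> x\<bar> / c)) \<partial>lebesgue)"
      unfolding M_def by (subst emeasure_density) (auto intro!: nn_integral_cong simp: indicator_def)
    also have "\<dots> = ennreal (\<integral>x. indicator B (norm x) * (\<bar>\<tau> x\<bar> / c) \<partial>lebesgue)"
    proof (rule nn_integral_eq_integral)
      have "integrable lebesgue (\<lambda>x. indicator (norm -` B) x *\<^sub>R (\<bar>\<tau> x\<bar> / c))"
        using \<tau>i by (intro integrable_mult_indicator) auto
      then show "integrable lebesgue (\<lambda>x. indicator B (norm x) * (\<bar>\<tau> x\<bar> / c))"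
        by (simp add: indicator_def)
    qed (use c in auto)
    finally show ?thesis .
  qed
  have fin: "finite_borel_measure N"
  proof -
    have "space N = UNIV" "sets N = sets borel" by (auto simp: N_def)
    moreover have "emeasure N UNIV \<noteq> \<infinity>" by (simp add: N)
    ultimately show ?thesis by (auto simp: finite_borel_measure_def finite_borel_measure_axioms_def intro!: finite_measureI)
  qed
  interpret N: finite_borel_measure N by (rule fin)
  have Nm: "measure N B = (\<integral>x. indicator B (norm x) * (\<bar>\<tau> x\<bar> / c) \<partial>lebesgue)" if "B \<in> sets borel" for B
    using N[OF that] c by (simp add: measure_def integral_nonneg_AE)
  have inner: "K b - K a \<le> measure N {a<..b}" if ab: "1 < a" "a < b" "b < R" for a b
  proof -
    have iB: "integrable lebesgue (\<lambda>x. indicator {a<..b} (norm x) * v x)" if "integrable lebesgue v" for v :: "real ^ 'n \<Rightarrow> real"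
    proof -
      have "norm -` {a<..b} \<in> sets (lebesgue :: (real^'n) measure)"
        using measurable_sets[OF measurable_norm_lebesgue[where 'a = "real^'n"], of "{a<..b}"] by simp
      from integrable_mult_indicator[OF this that] show ?thesis by (simp add: indicator_def)
    qed
    have "sphere_area CARD('n) t = c * t ^ (CARD('n) - 1)" if "0 \<le> t" for t
      using that by (simp add: sphere_area_def c_def)
    then have "c * (b ^ (CARD('n) - 1) * K b - a ^ (CARD('n) - 1) * K a) =
        sphere_area CARD('n) b * K b - sphere_area CARD('n) a * K a"
      using ab by (simp add: algebra_simps)
    also have "\<dots> = (\<integral>x. indicator {a<..b} (norm x) * \<tau> x \<partial>lebesgue)"
      unfolding \<tau>_def using \<tau>i[unfolded \<tau>_def[abs_def]] by (intro radial_weak_divergence[OF R K G _ ab])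
    also have "\<dots> \<le> (\<integral>x. indicator {a<..b} (norm x) * \<bar>\<tau> x\<bar> \<partial>lebesgue)"
      by (rule integral_mono[OF iB[OF \<tau>i] iB[OF integrable_abs[OF \<tau>i]]]) (auto simp: indicator_def)
    also have "\<dots> = c * measure N {a<..b}"
      using c by (simp add: Nm)
    finally have "b ^ (CARD('n) - 1) * K b - a ^ (CARD('n) - 1) * K a \<le> measure N {a<..b}"
      using c by simp
    moreover have "K b - K a \<le> b ^ (CARD('n) - 1) * K b - a ^ (CARD('n) - 1) * K a"
    proof -
      have "a ^ (CARD('n) - 1) \<le> b ^ (CARD('n) - 1)" using ab by (intro power_mono) auto
      then have "a ^ (CARD('n) - 1) * K b \<le> b ^ (CARD('n) - 1) * K b" using K(3) by (rule mult_right_mono)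
      moreover have "1 * (K b - K a) \<le> a ^ (CARD('n) - 1) * (K b - K a)"
        using ab K(2) by (intro mult_right_mono one_le_power) (auto simp: mono_def)
      ultimately show ?thesis by (simp add: algebra_simps)
    qed
    ultimately show ?thesis by linarith
  qed
  \<comment> \<open>the bound is known strictly inside \<open>(1, R)\<close>; as \<open>K\<close> is constant outside and continuous, it extends to
    all intervals\<close>
  have outer: "K b - K a \<le> measure N {a<..b}" if "a < b" for a b
  proof (cases "max a 1 < min b R")
    case True
    define a' b' where "a' = max a 1" and "b' = min b R"
    have ab': "a' < b'" "1 \<le> a'" "b' \<le> R" using True by (auto simp: a'_def b'_def)
    have Kab: "K b = K b'" "K a = K a'"
      using const(1)[of a] const(2)[of b] by (auto simp: a'_def b'_def max_def min_def)
    define q where "q m = (b' - a') * inverse (real (Suc m)) / 3" for m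
    have q0: "q \<longlonglongrightarrow> 0"
    proof -
      have "q \<longlonglongrightarrow> (b' - a') * 0 / 3" unfolding q_def by (intro tendsto_intros LIMSEQ_inverse_real_of_nat) simp
      then show ?thesis by simp
    qed
    have q: "0 < q m" "q m \<le> (b' - a') / 3" for m
    proof -
      show "0 < q m" using ab' by (simp add: q_def)
      have "(b' - a') * inverse (real (Suc m)) \<le> (b' - a') * 1"
        using ab' by (intro mult_left_mono) (auto simp: inverse_le_1_iff)
      then show "q m \<le> (b' - a') / 3" by (simp add: q_def)
    qed
    have "K (b' - q m) - K (a' + q m) \<le> measure N {a<..b}" for m
    proof -
      have "K (b' - q m) - K (a' + q m) \<le> measure N {a' + q m<..b' - q m}"
        using q[of m] ab' by (intro inner) auto
      also have "\<dots> \<le> measure N {a<..b}"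
        using q[of m] by (intro N.finite_measure_mono) (auto simp: a'_def b'_def N.M_is_borel)
      finally show ?thesis .
    qed
    moreover have "(\<lambda>m. K (b' - q m) - K (a' + q m)) \<longlonglongrightarrow> K (b' - 0) - K (a' + 0)"
      by (intro tendsto_intros continuous_on_tendsto_compose[OF K(1)] q0) auto
    ultimately have "K b' - K a' \<le> measure N {a<..b}"
      by (intro LIMSEQ_le_const2[of _ "K b' - K a'"]) auto
    then show ?thesis by (simp add: Kab)
  next
    case False
    then have "K b = K a" using that R const(1)[of a] const(1)[of b] const(2)[of a] const(2)[of b]
      by (auto simp: max_def min_def not_less split: if_splits)
    then show ?thesis by simp
  qed
  \<comment> \<open>a distribution function has to vanish at minus infinity\<close>
  define K0 where "K0 t = K t - K 1" for t
  have K0: "mono K0" "continuous_on UNIV K0" "(K0 \<longlongrightarrow> 0) at_bot"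
  proof -
    show "mono K0" using K(2) by (auto simp: mono_def K0_def)
    show "continuous_on UNIV K0" unfolding K0_def by (intro continuous_intros K(1))
    show "(K0 \<longlongrightarrow> 0) at_bot"
    proof (rule tendsto_eventually)
      have "K0 t = 0" if "t \<le> 1" for t unfolding K0_def const(1)[OF that] by simp
      then show "\<forall>\<^sub>F t in at_bot. K0 t = 0" unfolding eventually_at_bot_linorder by blast
    qed
  qed
  have K0R: "K0 t = K0 R" if "R \<le> t" for t unfolding K0_def const(2)[OF that] ..
  have K0c: "continuous (at_right a) K0" for a
    using K0(2) by (auto simp: continuous_on_eq_continuous_at intro: continuous_at_imp_continuous_within)
  define \<nu> where "\<nu> = interval_measure K0"
  have \<nu>: "emeasure \<nu> {a<..b} = ennreal (K b - K a)" if "a \<le> b" for a b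
    unfolding \<nu>_def using K0(1) K0c that
    by (subst emeasure_interval_measure_Ioc) (auto simp: mono_def K0_def)
  have \<nu>fin: "finite_borel_measure \<nu>"
    unfolding \<nu>_def
  proof (rule finite_borel_measure_interval_measure[OF _ K0c K0(3)])
    show "K0 x \<le> K0 y" if "x \<le> y" for x y using K0(1) that by (auto simp: mono_def)
    show "(K0 \<longlongrightarrow> K0 R) at_top"
    proof (rule tendsto_eventually)
      show "\<forall>\<^sub>F t in at_top. K0 t = K0 R" unfolding eventually_at_top_linorder using K0R by blast
    qed
    show "0 \<le> K0 R" using K(2) R by (auto simp: K0_def mono_def)
  qed
  interpret \<nu>: finite_borel_measure \<nu> by (rule \<nu>fin)
  have ac: "absolutely_continuous lborel \<nu>"
    unfolding absolutely_continuous_def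
  proof
    fix B :: "real set" assume B: "B \<in> null_sets lborel"
    then have Bb: "B \<in> sets borel" by auto
    have "AE x::real^'n in lebesgue. norm x \<notin> B" using AE_norm[OF AE_not_in[OF B]] .
    then have "AE x in lebesgue. indicator B (norm x) * (\<bar>\<tau> x\<bar> / c) = 0" by eventually_elim simp
    then have "measure N B = 0" unfolding Nm[OF Bb] by (rule integral_eq_zero_AE)
    have "measure \<nu> B = 0"
      unfolding \<nu>_def
    proof (rule finite_borel_measure_null_if_Ioc_le[OF fin K0 _ refl _ Bb \<open>measure N B = 0\<close>])
      show "K0 b - K0 a \<le> measure N {a<..b}" if "a < b" for a b using outer[OF that] by (simp add: K0_def)
      show "K0 t = K0 R" if "R \<le> t" for t by (rule K0R[OF that])
    qed
    then show "B \<in> null_sets \<nu>" using Bb by (auto simp: \<nu>.emeasure_eq_measure \<nu>.M_is_borel)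
  qed
  obtain f where f: "f \<in> borel_measurable lborel" "density lborel f = \<nu>"
    using sigma_finite_measure.Radon_Nikodym[OF sigma_finite_lborel ac] \<nu>.M_is_borel by auto
  have [measurable]: "f \<in> borel_measurable borel" using f(1) by simp
  have intf: "(\<integral>\<^sup>+x. f x * indicator B x \<partial>lborel) = emeasure \<nu> B" if "B \<in> sets borel" for B
    using that by (simp add: f(2)[symmetric] emeasure_density)
  have "(\<integral>\<^sup>+x. f x \<partial>lborel) = emeasure \<nu> UNIV" using intf[of UNIV] by simp
  then have f_fin: "AE x in lborel. f x \<noteq> \<infinity>"
    using \<nu>.emeasure_finite[of UNIV] by (intro nn_integral_PInf_AE) auto
  define k where "k t = enn2real (f t)" for t
  have km [measurable]: "k \<in> borel_measurable borel" unfolding k_def by measurable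
  have kf: "AE x in lborel. ennreal (k x) = f x"
    using f_fin by eventually_elim (simp add: k_def less_top)
  have int: "integrable lborel (\<lambda>x. indicator {a..b} x * k x)" "(\<integral>x. indicator {a..b} x * k x \<partial>lborel) = K b - K a"
    if "a \<le> b" for a b
  proof -
    have "(\<integral>\<^sup>+x. ennreal (indicator {a..b} x * k x) \<partial>lborel) = (\<integral>\<^sup>+x. f x * indicator {a<..b} x \<partial>lborel)"
    proof (rule nn_integral_cong_AE)
      show "AE x in lborel. ennreal (indicator {a..b} x * k x) = f x * indicator {a<..b} x"
        using kf AE_lborel_singleton[of a] by eventually_elim (auto simp: indicator_def)
    qed
    also have "\<dots> = ennreal (K b - K a)" using \<nu>[OF that] by (simp add: intf)
    finally have *: "(\<integral>\<^sup>+x. ennreal (indicator {a..b} x * k x) \<partial>lborel) = ennreal (K b - K a)" .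
    have "K a \<le> K b" using K(2) that by (auto simp: mono_def)
    then have "has_bochner_integral lborel (\<lambda>x. indicator {a..b} x * k x) (K b - K a)"
      using * by (intro has_bochner_integral_nn_integral) (auto simp: k_def)
    then show "integrable lborel (\<lambda>x. indicator {a..b} x * k x)" "(\<integral>x. indicator {a..b} x * k x \<partial>lborel) = K b - K a"
      by (auto simp: has_bochner_integral_iff)
  qed
  show thesis
  proof (rule that[of k])
    show "is_primitive a b K k" if "a \<le> b" for a b
      unfolding is_primitive_def
      using int continuous_on_subset[OF K(1)] that by (auto simp: set_integrable_def set_lebesgue_integral_def)
  qed (auto simp: k_def[abs_def])
qed

section \<open>Degrees of sphere maps\<close>

text \<open>The segment between \<open>f x\<close> and \<open>g x\<close> avoids the origin, so the linear homotopy can be normalised.\<close>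

lemma homotopic_never_antipodal:
  fixes f g :: "'a::topological_space \<Rightarrow> 'b::euclidean_space"
  assumes f: "continuous_on S f" "f \<in> S \<rightarrow> sphere 0 1" and g: "continuous_on S g" "g \<in> S \<rightarrow> sphere 0 1"
    and ne: "\<And>x. x \<in> S \<Longrightarrow> f x \<noteq> - g x"
  shows "homotopic_with_canon (\<lambda>_. True) S (sphere 0 1) f g"
proof -
  have "homotopic_with_canon (\<lambda>_. True) S (- {0}) f g"
  proof (rule homotopic_with_linear[OF f(1) g(1)])
    fix x assume x: "x \<in> S"
    have n: "norm (f x) = 1" "norm (g x) = 1" using f(2) g(2) x by auto
    have "0 \<notin> closed_segment (f x) (g x)"
    proof
      assume "0 \<in> closed_segment (f x) (g x)"
      then obtain u where u: "0 \<le> u" "u \<le> 1" "(1 - u) *\<^sub>R f x + u *\<^sub>R g x = 0"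
        by (auto simp: closed_segment_def)
      then have e: "(1 - u) *\<^sub>R f x = - (u *\<^sub>R g x)" by (simp add: eq_neg_iff_add_eq_0)
      then have "norm ((1 - u) *\<^sub>R f x) = norm (u *\<^sub>R g x)" by (simp only: norm_minus_cancel)
      then have u2: "u = 1 / 2" using u n by simp
      have "(1 / 2 :: real) *\<^sub>R f x = (1 / 2) *\<^sub>R (- g x)" using e unfolding u2 by simp
      then have "f x = - g x" by (simp only: scaleR_cancel_left) simp
      then show False using ne[OF x] by blast
    qed
    then show "closed_segment (f x) (g x) \<subseteq> - {0}" by blast
  qed
  then have "homotopic_with_canon (\<lambda>_. True) S (sphere 0 1) (sgn \<circ> f) (sgn \<circ> g)"
    by (rule homotopic_with_compose_continuous_left) (auto simp: norm_sgn intro!: continuous_on_sgn continuous_intros)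
  then show ?thesis
    by (rule homotopic_with_eq) (use f(2) g(2) in \<open>auto simp: sgn_div_norm Pi_iff\<close>)
qed

lemma continuous_map_nsphere_permute:
  assumes "\<tau> permutes {..p}"
  shows "continuous_map (nsphere p) (nsphere p) (\<lambda>x i. x (\<tau> i))"
proof -
  have "(\<Sum>i\<le>p. (x (\<tau> i))\<^sup>2) = (\<Sum>i\<le>p. (x i)\<^sup>2)" for x :: "nat \<Rightarrow> real"
    using sum.permute[OF assms, of "\<lambda>i. (x i)\<^sup>2"] by (simp add: o_def)
  moreover have "\<tau> i = i" if "i > p" for i using permutes_not_in[OF assms, of i] that by simp
  moreover have "continuous_map (nsphere p) euclideanreal (\<lambda>x. x k)" for k
    by (rule continuous_map_nsphere_projection)
  ultimately show ?thesis
    unfolding nsphere[of p]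
    by (auto simp: continuous_map_in_subtopology continuous_map_componentwise_UNIV)
qed

text \<open>All coordinate reflections are conjugate to the one in coordinate \<open>0\<close> by a transposition.\<close>

lemma Brouwer_degree2_reflection_at:
  assumes "k \<le> p"
  shows "Brouwer_degree2 p (\<lambda>x i. if i = k then - x i else x i) = - 1"
proof -
  define \<tau> where "\<tau> = Transposition.transpose 0 k"
  have \<tau>: "\<tau> permutes {..p}" unfolding \<tau>_def using assms by (intro permutes_swap_id) auto
  define s :: "(nat \<Rightarrow> real) \<Rightarrow> nat \<Rightarrow> real" where "s x i = x (\<tau> i)" for x i
  define r :: "(nat \<Rightarrow> real) \<Rightarrow> nat \<Rightarrow> real" where "r x i = (if i = 0 then - x i else x i)" for x i
  have s: "continuous_map (nsphere p) (nsphere p) s"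
    using continuous_map_nsphere_permute[OF \<tau>] by (simp add: s_def[abs_def])
  have r: "continuous_map (nsphere p) (nsphere p) r"
    unfolding r_def[abs_def] by (rule continuous_map_nsphere_reflection)
  have "s \<circ> s = id" by (auto simp: s_def \<tau>_def fun_eq_iff)
  then have ss: "Brouwer_degree2 p s * Brouwer_degree2 p s = 1"
    using Brouwer_degree2_compose[OF s s] Brouwer_degree2_id[of p] by simp
  have eq: "(\<lambda>x i. if i = k then - x i else x i) = s \<circ> (r \<circ> s)"
    by (auto simp: s_def r_def \<tau>_def fun_eq_iff Transposition.transpose_def)
  have "Brouwer_degree2 p (s \<circ> (r \<circ> s)) = Brouwer_degree2 p s * (Brouwer_degree2 p r * Brouwer_degree2 p s)"
    using Brouwer_degree2_compose[OF continuous_map_compose[OF s r] s] Brouwer_degree2_compose[OF s r] by simp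
  also have "\<dots> = - 1"
    using ss Brouwer_degree2_reflection[of p] by (simp add: r_def[abs_def])
  finally show ?thesis by (simp only: eq)
qed

text \<open>Reflections are composed one coordinate at a time; for \<open>m = p + 1\<close> this is the antipode.\<close>

lemma Brouwer_degree2_negate_initial:
  assumes "m \<le> Suc p"
  shows "continuous_map (nsphere p) (nsphere p) (\<lambda>x i. if i < m then - x i else x i) \<and>
    Brouwer_degree2 p (\<lambda>x i. if i < m then - x i else x i) = (- 1) ^ m"
  using assms
proof (induction m)
  case 0
  have "(\<lambda>(x :: nat \<Rightarrow> real) i. if i < 0 then - x i else x i) = id" by (auto simp: fun_eq_iff)
  then show ?case by (simp add: id_def Brouwer_degree2_id[unfolded id_def])
next
  case (Suc m)
  have eq: "(\<lambda>(x :: nat \<Rightarrow> real) i. if i < Suc m then - x i else x i) =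
      (\<lambda>x i. if i = m then - x i else x i) \<circ> (\<lambda>x i. if i < m then - x i else x i)"
    by (auto simp: fun_eq_iff)
  have c: "continuous_map (nsphere p) (nsphere p) (\<lambda>x i. if i < m then - x i else x i)"
    and d: "Brouwer_degree2 p (\<lambda>x i. if i < m then - x i else x i) = (- 1) ^ m"
    using Suc by auto
  note r = continuous_map_nsphere_reflection[of p m]
  show ?case
    unfolding eq Brouwer_degree2_compose[OF c r] d Brouwer_degree2_reflection_at[of m p]
    using continuous_map_compose[OF c r] Suc.prems Brouwer_degree2_reflection_at[of m p] by simp
qed

lemma Brouwer_degree2_antipode:
  "continuous_map (nsphere p) (nsphere p) (\<lambda>x i. - x i)"
  "Brouwer_degree2 p (\<lambda>x i. - x i) = (- 1) ^ Suc p"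
proof -
  have eq: "(if i < Suc p then - x i else x i) = - x i" if "x \<in> topspace (nsphere p)" for x i
    using that by (auto simp: nsphere not_less Suc_le_eq)
  note n = Brouwer_degree2_negate_initial[of "Suc p" p]
  show "continuous_map (nsphere p) (nsphere p) (\<lambda>x i. - x i)"
    by (rule continuous_map_eq[OF conjunct1[OF n]]) (use eq in \<open>auto simp: fun_eq_iff\<close>)
  have "Brouwer_degree2 p (\<lambda>x i. - x i) = Brouwer_degree2 p (\<lambda>x i. if i < Suc p then - x i else x i)"
    by (rule Brouwer_degree2_eq) (use eq in \<open>auto simp: fun_eq_iff\<close>)
  then show "Brouwer_degree2 p (\<lambda>x i. - x i) = (- 1) ^ Suc p" using n by simp
qed

text \<open>The homeomorphism \<open>c\<close> is arbitrary and need not commute with the antipodes of the two spheres.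
Transporting the antipode of \<open>nsphere p\<close> through it gives a map \<open>a\<close> without fixed points, and such a map is
homotopic to the antipode.\<close>

lemma Brouwer_degree2_sphere_antipode:
  fixes c :: "(nat \<Rightarrow> real) \<Rightarrow> 'b::euclidean_space"
  assumes cc': "homeomorphic_maps (nsphere p) (top_of_set (sphere 0 1)) c c'"
  shows "Brouwer_degree2 p (c' \<circ> uminus \<circ> c) = (- 1) ^ Suc p"
proof -
  let ?S = "sphere (0::'b) 1"
  have c: "continuous_map (nsphere p) (top_of_set ?S) c" and c': "continuous_map (top_of_set ?S) (nsphere p) c'"
    and c'c: "\<And>x. x \<in> topspace (nsphere p) \<Longrightarrow> c' (c x) = x" and cc: "\<And>y. y \<in> ?S \<Longrightarrow> c (c' y) = y"
    using cc' by (auto simp: homeomorphic_maps_def)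
  define A :: "(nat \<Rightarrow> real) \<Rightarrow> nat \<Rightarrow> real" where "A = (\<lambda>x i. - x i)"
  have A: "continuous_map (nsphere p) (nsphere p) A" "Brouwer_degree2 p A = (- 1) ^ Suc p"
    unfolding A_def by (rule Brouwer_degree2_antipode)+
  \<comment> \<open>the antipode of \<open>nsphere p\<close> seen on the unit sphere\<close>
  define a where "a = c \<circ> A \<circ> c'"
  have a: "continuous_map (top_of_set ?S) (top_of_set ?S) a"
    unfolding a_def o_assoc[symmetric] by (rule continuous_map_compose[OF continuous_map_compose[OF c' A(1)] c])
  have c'S: "c' y \<in> topspace (nsphere p)" if "y \<in> ?S" for y
    using continuous_map_image_subset_topspace[OF c'] that by auto
  have a_ne: "a y \<noteq> y" if y: "y \<in> ?S" for y
  proof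
    assume "a y = y"
    have t: "A (c' y) \<in> topspace (nsphere p)"
      using continuous_map_image_subset_topspace[OF A(1)] c'S[OF y] by auto
    have "c' (a y) = A (c' y)" using c'c[OF t] by (simp add: a_def)
    then have "c' y = A (c' y)" using \<open>a y = y\<close> by simp
    then have "c' y i = 0" for i by (auto simp: A_def dest!: fun_cong[of _ _ i])
    then show False using c'S[OF y] by (auto simp: nsphere)
  qed
  have "homotopic_with_canon (\<lambda>_. True) ?S ?S a uminus"
    by (rule homotopic_never_antipodal)
      (use a a_ne in \<open>auto simp: continuous_map_subtopology_eu intro: continuous_intros\<close>)
  then have "homotopic_with (\<lambda>_. True) (top_of_set ?S) (nsphere p) (c' \<circ> a) (c' \<circ> uminus)"
    by (rule homotopic_with_compose_continuous_map_left[OF _ c']) simp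
  then have "homotopic_with (\<lambda>_. True) (nsphere p) (nsphere p) (c' \<circ> a \<circ> c) (c' \<circ> uminus \<circ> c)"
    by (rule homotopic_with_compose_continuous_map_right[OF _ c]) simp
  then have "Brouwer_degree2 p (c' \<circ> uminus \<circ> c) = Brouwer_degree2 p (c' \<circ> a \<circ> c)"
    using Brouwer_degree2_homotopic by metis
  also have "\<dots> = Brouwer_degree2 p A"
  proof (rule Brouwer_degree2_eq)
    fix x assume x: "x \<in> topspace (nsphere p)"
    then have "A x \<in> topspace (nsphere p)"
      using continuous_map_image_subset_topspace[OF A(1)] by auto
    then show "(c' \<circ> a \<circ> c) x = A x" using x by (simp add: a_def c'c)
  qed
  finally show ?thesis using A(2) by simp
qed

lemma Brouwer_degree2_sphere_id:
  fixes c :: "(nat \<Rightarrow> real) \<Rightarrow> 'b::euclidean_space"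
  assumes "homeomorphic_maps (nsphere p) (top_of_set (sphere 0 1)) c c'"
  shows "Brouwer_degree2 p (c' \<circ> (\<lambda>x. x) \<circ> c) = 1"
proof -
  have "Brouwer_degree2 p (c' \<circ> (\<lambda>x. x) \<circ> c) = Brouwer_degree2 p id"
    by (rule Brouwer_degree2_eq) (use assms in \<open>auto simp: homeomorphic_maps_def\<close>)
  then show ?thesis by simp
qed

lemma Brouwer_degree2_sphere_homotopic:
  fixes c :: "(nat \<Rightarrow> real) \<Rightarrow> 'b::euclidean_space"
  assumes cc': "homeomorphic_maps (nsphere p) (top_of_set (sphere 0 1)) c c'"
    and h: "homotopic_with_canon (\<lambda>_. True) (sphere 0 1) (sphere 0 1) f g"
  shows "Brouwer_degree2 p (c' \<circ> f \<circ> c) = Brouwer_degree2 p (c' \<circ> g \<circ> c)"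
proof -
  have c: "continuous_map (nsphere p) (top_of_set (sphere 0 1)) c" and c': "continuous_map (top_of_set (sphere 0 1)) (nsphere p) c'"
    using cc' by (auto simp: homeomorphic_maps_def)
  have "homotopic_with (\<lambda>_. True) (top_of_set (sphere 0 1)) (nsphere p) (c' \<circ> f) (c' \<circ> g)"
    by (rule homotopic_with_compose_continuous_map_left[OF h c']) simp
  then have "homotopic_with (\<lambda>_. True) (nsphere p) (nsphere p) (c' \<circ> f \<circ> c) (c' \<circ> g \<circ> c)"
    by (rule homotopic_with_compose_continuous_map_right[OF _ c]) simp
  then show ?thesis by (rule Brouwer_degree2_homotopic)
qed

text \<open>Monotonicity prevents the map \<open>u \<mapsto> (h (x + r u) - h x) / |h (x + r u) - h x|\<close> from being antipodal to
\<open>\<sigma> u\<close>, so it is homotopic to the identity or to the antipode, according to the sign.\<close>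

lemma local_sphere_map_degree:
  fixes h :: "real ^ 'n::finite \<Rightarrow> real ^ 'n"
  assumes h: "continuous_on U h" and r: "0 < r" "cball x r \<subseteq> U"
    and \<sigma>: "\<sigma> = 1 \<or> \<sigma> = - 1"
    and mono: "\<And>u. norm u = 1 \<Longrightarrow> 0 < \<sigma> * ((h (x + r *\<^sub>R u) - h x) \<bullet> u)"
    and cc': "homeomorphic_maps (nsphere (CARD('n) - 1)) (top_of_set (sphere (0 :: real ^ 'n) 1)) c c'"
  shows "Brouwer_degree2 (CARD('n) - 1) (c' \<circ> local_sphere_map h x r \<circ> c) = (if \<sigma> = 1 then 1 else (- 1) ^ CARD('n))"
proof -
  let ?S = "sphere (0 :: real ^ 'n) 1" and ?f = "local_sphere_map h x r"
  have in_U: "x + r *\<^sub>R u \<in> U" if "u \<in> ?S" for u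
    using r that by (auto simp: subset_iff dist_norm)
  have ne: "h (x + r *\<^sub>R u) - h x \<noteq> 0" if "u \<in> ?S" for u
  proof
    assume "h (x + r *\<^sub>R u) - h x = 0"
    then show False using mono[of u] that by simp
  qed
  have fc: "continuous_on ?S ?f"
    unfolding local_sphere_map_def
    by (intro continuous_intros continuous_on_sgn continuous_on_compose2[OF h]) (use in_U ne in auto)
  have fS: "?f \<in> ?S \<rightarrow> ?S"
    using ne by (auto simp: local_sphere_map_def norm_sgn)
  have hom: "homotopic_with_canon (\<lambda>_. True) ?S ?S ?f (\<lambda>u. \<sigma> *\<^sub>R u)"
  proof (rule homotopic_never_antipodal[OF fc fS])
    show "continuous_on ?S (\<lambda>u. \<sigma> *\<^sub>R u)" by (intro continuous_intros)
    show "(\<lambda>u. \<sigma> *\<^sub>R u) \<in> ?S \<rightarrow> ?S" using \<sigma> by auto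
    fix u assume u: "u \<in> ?S"
    show "?f u \<noteq> - (\<sigma> *\<^sub>R u)"
    proof
      assume e: "?f u = - (\<sigma> *\<^sub>R u)"
      have "0 < \<sigma> * ((h (x + r *\<^sub>R u) - h x) \<bullet> u)" using mono u by simp
      also have "h (x + r *\<^sub>R u) - h x = norm (h (x + r *\<^sub>R u) - h x) *\<^sub>R ?f u"
        using ne[OF u] by (simp add: local_sphere_map_def sgn_div_norm)
      finally have "0 < - (norm (h (x + r *\<^sub>R u) - h x) * (\<sigma> * \<sigma>))"
        using u unfolding e by (simp add: norm_eq_1 mult_ac)
      moreover have "0 \<le> norm (h (x + r *\<^sub>R u) - h x) * (\<sigma> * \<sigma>)" by simp
      ultimately show False by linarith
    qed
  qed
  have card: "Suc (CARD('n) - 1) = CARD('n)" using zero_less_card_finite[where 'a='n] by simp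
  from \<sigma> show ?thesis
  proof
    assume "\<sigma> = 1"
    then show ?thesis
      using Brouwer_degree2_sphere_homotopic[OF cc' hom] Brouwer_degree2_sphere_id[OF cc'] by simp
  next
    assume s: "\<sigma> = - 1"
    then have "(\<lambda>u. \<sigma> *\<^sub>R u) = (uminus :: real ^ 'n \<Rightarrow> _)" by (simp add: fun_eq_iff)
    then show ?thesis
      using Brouwer_degree2_sphere_homotopic[OF cc' hom] Brouwer_degree2_sphere_antipode[OF cc'] s card by simp
  qed
qed

text \<open>With \<open>a = |x|\<close> and \<open>b = |y|\<close> the Cauchy--Schwarz inequality gives the lower bound \<open>(K b - K a) (b - a)\<close>.
If \<open>a = b\<close>, the inequality of Cauchy and Schwarz is strict instead.\<close>

lemma radial_map_monotone:
  fixes x y :: "real ^ 'n::finite"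
  assumes x: "x \<noteq> 0" and y: "y \<noteq> 0" and ne: "x \<noteq> y"
    and pos: "0 < K (norm x)" "0 < K (norm y)"
    and mono: "norm x < norm y \<Longrightarrow> K (norm x) < K (norm y)" "norm y < norm x \<Longrightarrow> K (norm y) < K (norm x)"
  shows "0 < (radial_map K y - radial_map K x) \<bullet> (y - x)"
proof -
  define a b where "a = norm x" and "b = norm y"
  have ab: "0 < a" "0 < b" using x y by (auto simp: a_def b_def)
  have xx: "x \<bullet> x = a * a" "y \<bullet> y = b * b"
    by (auto simp: a_def b_def power2_norm_eq_inner[symmetric] power2_eq_square)
  have "(radial_map K y - radial_map K x) \<bullet> (y - x) =
      K b / b * (y \<bullet> y) + K a / a * (x \<bullet> x) - (K b / b + K a / a) * (x \<bullet> y)"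
    by (simp add: radial_map_def a_def b_def inner_diff inner_commute[of y x] divide_inverse algebra_simps)
  also have "\<dots> = K b * b + K a * a - (K b / b + K a / a) * (x \<bullet> y)"
    using ab by (simp add: xx)
  finally have eq: "(radial_map K y - radial_map K x) \<bullet> (y - x) = K b * b + K a * a - (K b / b + K a / a) * (x \<bullet> y)" .
  have kp: "0 < K b / b + K a / a" using pos ab by (auto simp: a_def b_def intro!: add_pos_pos)
  have cs: "x \<bullet> y \<le> a * b" using norm_cauchy_schwarz[of x y] by (simp add: a_def b_def)
  have ex: "(K b / b + K a / a) * (a * b) = K b * a + K a * b" using ab by (simp add: field_simps)
  show ?thesis
  proof (cases "a = b")
    case True
    have "x \<bullet> y < a * b"
    proof (rule ccontr)
      assume "\<not> x \<bullet> y < a * b"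
      then have "x \<bullet> y = norm x * norm y" using cs by (simp add: a_def b_def)
      then have "norm x *\<^sub>R y = norm y *\<^sub>R x" using norm_cauchy_schwarz_eq[of x y] by simp
      then show False using True ne ab by (simp add: a_def b_def)
    qed
    then have "(K b / b + K a / a) * (x \<bullet> y) < (K b / b + K a / a) * (a * b)"
      using kp by simp
    then show ?thesis unfolding eq ex using True by simp
  next
    case False
    have "(K b / b + K a / a) * (x \<bullet> y) \<le> (K b / b + K a / a) * (a * b)"
      using kp cs by simp
    moreover have "0 < (K b - K a) * (b - a)"
      using False mono by (cases "a < b") (auto simp: a_def b_def zero_less_mult_iff)
    ultimately show ?thesis unfolding eq ex by (simp add: algebra_simps)
  qed
qed

section \<open>The class of radial homeomorphisms\<close>

lemma has_weak_derivative_on_cong: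
  assumes "\<And>x. x \<in> U \<Longrightarrow> h x = h' x" "has_weak_derivative_on h G U"
  shows "has_weak_derivative_on h' G U"
proof -
  have "locally_integrable_on U h'"
    unfolding locally_integrable_on_def set_integrable_def
  proof (intro allI impI)
    fix S assume S: "compact S \<and> S \<subseteq> U"
    then have "(\<lambda>x. indicator S x *\<^sub>R h' x) = (\<lambda>x. indicator S x *\<^sub>R h x)"
      using assms(1) by (auto simp: fun_eq_iff indicator_def)
    moreover have "integrable lebesgue (\<lambda>x. indicator S x *\<^sub>R h x)"
      using assms(2) S by (simp add: has_weak_derivative_on_def locally_integrable_on_def set_integrable_def)
    ultimately show "integrable lebesgue (\<lambda>x. indicator S x *\<^sub>R h' x)" by (simp only:)
  qed
  moreover have "(LINT x:U|lebesgue. h' x $ i * f x) = (LINT x:U|lebesgue. h x $ i * f x)" for i f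
    unfolding set_lebesgue_integral_def
    by (rule Bochner_Integration.integral_cong) (use assms(1) in \<open>auto simp: indicator_def\<close>)
  ultimately show ?thesis using assms(2) by (simp add: has_weak_derivative_on_def)
qed

lemma has_weak_derivative_on_scaleR:
  assumes "has_weak_derivative_on h G U"
  shows "has_weak_derivative_on (\<lambda>x. c *\<^sub>R h x) (\<lambda>x. c *\<^sub>R G x) U"
proof -
  have "locally_integrable_on U (\<lambda>x. c *\<^sub>R h x)" "locally_integrable_on U (\<lambda>x. c *\<^sub>R G x)"
    using assms by (auto simp: has_weak_derivative_on_def locally_integrable_on_def)
  then show ?thesis
    using assms by (simp add: has_weak_derivative_on_def set_lebesgue_integral_def mult.assoc mult.left_commute[of _ c])
qed

lemma radial_gradient_scale: "radial_gradient (\<lambda>t. c * K t) (\<lambda>t. c * k t) x = c *\<^sub>R radial_gradient K k x"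
  by (simp add: radial_gradient_def vec_eq_iff algebra_simps)

lemma radial_map_inj_on:
  assumes mono: "\<And>s t. 1 < s \<Longrightarrow> s < t \<Longrightarrow> t < R \<Longrightarrow> K s < K t" and pos: "\<And>t. 1 < t \<Longrightarrow> t < R \<Longrightarrow> 0 < K t"
  shows "inj_on (radial_map K) (annulus R :: (real ^ 'n::finite) set)"
proof
  fix x y :: "real ^ 'n"
  assume xy: "x \<in> annulus R" "y \<in> annulus R" "radial_map K x = radial_map K y"
  then have n: "1 < norm x" "norm x < R" "1 < norm y" "norm y < R" by (auto simp: annulus_def)
  show "x = y"
  proof (rule ccontr)
    assume "x \<noteq> y"
    then have "0 < (radial_map K y - radial_map K x) \<bullet> (y - x)"
      using n mono[of "norm x" "norm y"] mono[of "norm y" "norm x"] pos[of "norm x"] pos[of "norm y"]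
      by (intro radial_map_monotone) auto
    then show False using xy(3) by simp
  qed
qed

lemma radial_map_continuous_on:
  assumes "continuous_on {1<..<R} K"
  shows "continuous_on (annulus R :: (real ^ 'n::finite) set) (radial_map K)"
  unfolding radial_map_def[abs_def]
  by (intro continuous_intros continuous_on_compose2[OF assms]) (auto simp: annulus_def)

lemma radial_map_degree:
  fixes x :: "real ^ 'n::finite"
  assumes cont: "continuous_on {1<..<R} K"
    and mono: "\<And>s t. 1 < s \<Longrightarrow> s < t \<Longrightarrow> t < R \<Longrightarrow> K s < K t" and pos: "\<And>t. 1 < t \<Longrightarrow> t < R \<Longrightarrow> 0 < K t"
    and h: "\<And>x. x \<in> annulus R \<Longrightarrow> h x = \<sigma> *\<^sub>R radial_map K x" and \<sigma>: "\<sigma> = 1 \<or> \<sigma> = - 1"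
    and r: "0 < r" "cball x r \<subseteq> annulus R"
    and cc': "homeomorphic_maps (nsphere (CARD('n) - 1)) (top_of_set (sphere (0 :: real ^ 'n) 1)) c c'"
  shows "Brouwer_degree2 (CARD('n) - 1) (c' \<circ> local_sphere_map h x r \<circ> c) = (if \<sigma> = 1 then 1 else (- 1) ^ CARD('n))"
proof (rule local_sphere_map_degree[OF _ r \<sigma> _ cc'])
  have "continuous_on (annulus R) (\<lambda>x :: real ^ 'n. \<sigma> *\<^sub>R radial_map K x)"
    by (intro continuous_intros radial_map_continuous_on cont)
  then show "continuous_on (annulus R) h"
    by (rule continuous_on_cong[THEN iffD1, rotated -1]) (auto simp: h)
  fix u :: "real ^ 'n" assume u: "norm u = 1"
  define y where "y = x + r *\<^sub>R u"
  have A: "x \<in> annulus R" "y \<in> annulus R"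
    using r u by (auto simp: y_def subset_iff dist_norm)
  then have n: "1 < norm x" "norm x < R" "1 < norm y" "norm y < R" by (auto simp: annulus_def)
  have "x \<noteq> y" using r(1) u by (auto simp: y_def)
  then have "0 < (radial_map K y - radial_map K x) \<bullet> (y - x)"
    using n mono[of "norm x" "norm y"] mono[of "norm y" "norm x"] pos[of "norm x"] pos[of "norm y"]
    by (intro radial_map_monotone) auto
  then have "0 < (radial_map K y - radial_map K x) \<bullet> u" using r(1) by (simp add: y_def zero_less_mult_iff)
  moreover have "\<sigma> * ((h y - h x) \<bullet> u) = (radial_map K y - radial_map K x) \<bullet> u"
    using \<sigma> by (auto simp: h A inner_diff_left)
  ultimately show "0 < \<sigma> * ((h (x + r *\<^sub>R u) - h x) \<bullet> u)" by (simp add: y_def)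
qed

text \<open>Along a ray the map is \<open>K0 t\<close> times the direction. As \<open>|K0| > 1\<close>, the continuous function \<open>K0\<close> has constant
sign \<open>\<sigma>\<close>; \<open>K1 = |K0|\<close> is injective, hence strictly monotone, and increasing because it tends to \<open>1\<close> at
the inner radius. It is continued by its boundary values to the continuous function \<open>K\<close> on the line. The
local degree at any point of the annulus forces \<open>\<sigma> ^ n = 1\<close>.\<close>

lemma radial_class_profile:
  fixes h :: "real ^ 'n::finite \<Rightarrow> real ^ 'n"
  assumes h: "h \<in> radial_class R Rs" and R: "1 < R"
  obtains \<sigma> K where "\<sigma> = 1 \<or> \<sigma> = - 1" "\<sigma> ^ CARD('n) = 1" "continuous_on UNIV K" "mono K"
    "\<And>t. t \<le> 1 \<Longrightarrow> K t = 1" "\<And>t. R \<le> t \<Longrightarrow> K t = Rs" "\<And>t. 1 \<le> K t"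
    "\<And>x. x \<in> annulus R \<Longrightarrow> h x = \<sigma> *\<^sub>R radial_map K x"
proof -
  obtain K0 g where K0: "\<And>x. x \<in> annulus R \<Longrightarrow> h x = radial_map K0 x"
    and g: "homeomorphism (annulus R) (annulus Rs) h g"
    and ori: "orientation_preserving_on (annulus R) h"
    and lim1: "((\<lambda>x. norm (h x)) \<longlongrightarrow> 1) (filtercomap norm (at_right 1))"
    and limR: "((\<lambda>x. norm (h x)) \<longlongrightarrow> Rs) (filtercomap norm (at_left R))"
    using h by (auto simp: radial_class_def)
  fix i0 :: 'n
  define e :: "real ^ 'n" where "e = axis i0 1"
  have e: "norm e = 1" by (simp add: e_def)
  have te: "t *\<^sub>R e \<in> annulus R" if "1 < t" "t < R" for t using that e by (simp add: annulus_def)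
  have hte: "h (t *\<^sub>R e) = K0 t *\<^sub>R e" if "1 < t" "t < R" for t
    using K0[OF te[OF that]] that e by (simp add: radial_map_def)
  have in_Rs: "h x \<in> annulus Rs" if "x \<in> annulus R" for x
    using g that by (auto simp: homeomorphism_def)
  have absK: "1 < \<bar>K0 t\<bar>" "\<bar>K0 t\<bar> < Rs" if "1 < t" "t < R" for t
    using in_Rs[OF te[OF that]] e by (auto simp: hte[OF that] annulus_def)
  have K0c: "continuous_on {1<..<R} K0"
  proof -
    have "continuous_on {1<..<R} (\<lambda>t. t *\<^sub>R e)" by (intro continuous_intros)
    then have "continuous_on {1<..<R} (\<lambda>t. h (t *\<^sub>R e))"
      by (rule continuous_on_compose2[OF homeomorphism_cont1[OF g]]) (use te in auto)
    then have "continuous_on {1<..<R} (\<lambda>t. h (t *\<^sub>R e) \<bullet> e)"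
      by (rule continuous_on_inner) (rule continuous_on_const)
    then show ?thesis
      by (rule continuous_on_cong[THEN iffD1, rotated -1]) (use e in \<open>auto simp: hte norm_eq_1\<close>)
  qed
  have inj: "s = t" if "K0 s = K0 t" "1 < s" "s < R" "1 < t" "t < R" for s t
  proof -
    have "h (s *\<^sub>R e) = h (t *\<^sub>R e)" using that by (simp add: hte)
    then have "g (h (s *\<^sub>R e)) = g (h (t *\<^sub>R e))" by (rule arg_cong)
    then have "s *\<^sub>R e = t *\<^sub>R e"
      by (simp only: homeomorphism_apply1[OF g te[OF that(2,3)]] homeomorphism_apply1[OF g te[OF that(4,5)]])
    then show ?thesis using e by auto
  qed
  define m where "m = (1 + R) / 2"
  have m: "1 < m" "m < R" using R by (auto simp: m_def)
  \<comment> \<open>the sign at an arbitrary radius; \<open>K0\<close> has no zero\<close>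
  define \<sigma> :: real where "\<sigma> = (if 0 < K0 m then 1 else - 1)"
  have \<sigma>: "\<sigma> = 1 \<or> \<sigma> = - 1" by (simp add: \<sigma>_def)
  define K1 where "K1 t = \<sigma> * K0 t" for t
  have K1c: "continuous_on {1<..<R} K1" unfolding K1_def by (intro continuous_intros K0c)
  have K1pos: "0 < K1 t" if t: "1 < t" "t < R" for t
  proof (rule ccontr)
    assume "\<not> 0 < K1 t"
    then have neg: "K1 t < 0" using absK[OF t] \<sigma> by (auto simp: K1_def)
    have mp: "0 < K1 m" using absK[OF m] by (auto simp: K1_def \<sigma>_def)
    have "connected (K1 ` {1<..<R})" using K1c by (intro connected_continuous_image) auto
    then have "is_interval (K1 ` {1<..<R})" by (simp add: is_interval_connected_1)
    then have "0 \<in> K1 ` {1<..<R}"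
      using neg mp t m mem_is_interval_1_I[of "K1 ` {1<..<R}" "K1 t" "K1 m" 0] by auto
    then obtain s where "1 < s" "s < R" "K1 s = 0" by auto
    then show False using absK[of s] \<sigma> by (auto simp: K1_def)
  qed
  have K1abs: "K1 t = norm (h (t *\<^sub>R e))" if "1 < t" "t < R" for t
    using K1pos[OF that] \<sigma> e by (auto simp: hte[OF that] K1_def)
  have K1b: "1 < K1 t" "K1 t < Rs" if "1 < t" "t < R" for t
    using absK[OF that] K1abs[OF that] e by (auto simp: hte[OF that])
  have l1: "(K1 \<longlongrightarrow> 1) (at_right 1)"
  proof -
    have "filterlim (\<lambda>t. t *\<^sub>R e) (filtercomap norm (at_right 1)) (at_right 1)"
      unfolding filterlim_filtercomap_iff
    proof (rule filterlim_mono_eventually[OF filterlim_ident order_refl order_refl])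
      show "\<forall>\<^sub>F t in at_right 1. t = (norm \<circ> (\<lambda>t. t *\<^sub>R e)) t"
        using e by (auto simp: eventually_at_right_field intro!: exI[of _ 2])
    qed
    from filterlim_compose[OF lim1 this] have "((\<lambda>t. norm (h (t *\<^sub>R e))) \<longlongrightarrow> 1) (at_right 1)" .
    then show ?thesis
      by (rule Lim_transform_eventually) (use R K1abs in \<open>auto simp: eventually_at_right_field intro!: exI[of _ R]\<close>)
  qed
  have lR: "(K1 \<longlongrightarrow> Rs) (at_left R)"
  proof -
    have "filterlim (\<lambda>t. t *\<^sub>R e) (filtercomap norm (at_left R)) (at_left R)"
      unfolding filterlim_filtercomap_iff
    proof (rule filterlim_mono_eventually[OF filterlim_ident order_refl order_refl])
      show "\<forall>\<^sub>F t in at_left R. t = (norm \<circ> (\<lambda>t. t *\<^sub>R e)) t"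
        using e R by (auto simp: eventually_at_left_field intro!: exI[of _ 1])
    qed
    from filterlim_compose[OF limR this] have "((\<lambda>t. norm (h (t *\<^sub>R e))) \<longlongrightarrow> Rs) (at_left R)" .
    then show ?thesis
      by (rule Lim_transform_eventually) (use R K1abs in \<open>auto simp: eventually_at_left_field intro!: exI[of _ 1]\<close>)
  qed
  have K1mono: "K1 s < K1 t" if "1 < s" "s < t" "t < R" for s t
  proof -
    have "inj_on K1 {1<..<R}" using inj \<sigma> by (auto simp: inj_on_def K1_def)
    then have "strict_mono_on {1<..<R} K1 \<or> strict_antimono_on {1<..<R} K1"
      using injective_eq_monotone_map[of "{1<..<R}" K1] K1c by (auto simp: is_interval_1)
    then show ?thesis
    proof
      assume "strict_antimono_on {1<..<R} K1"
      then have anti: "K1 b < K1 a" if "1 < a" "a < b" "b < R" for a b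
        using that unfolding monotone_on_def by auto
      have "K1 m \<le> 1"
      proof (rule tendsto_lowerbound[OF l1])
        show "\<forall>\<^sub>F a in at_right 1. K1 m \<le> K1 a"
          using m anti by (auto simp: eventually_at_right_field intro!: exI[of _ m] less_imp_le)
      qed simp
      then show ?thesis using K1b[OF m] by simp
    qed (use that in \<open>auto simp: monotone_on_def\<close>)
  qed
  define K where "K t = (if t \<le> 1 then 1 else if R \<le> t then Rs else K1 t)" for t
  have "1 < Rs" using K1b[OF m] by simp
  have KK1: "K t = K1 t" if "1 < t" "t < R" for t using that by (simp add: K_def)
  have K1': "K t = 1" if "t \<le> 1" for t using that by (simp add: K_def)
  have KR: "K t = Rs" if "R \<le> t" for t using that R by (simp add: K_def)
  have Kc: "isCont K t" for t
  proof -
    consider "t < 1" | "t = 1" | "1 < t" "t < R" | "t = R" | "R < t" using R by linarith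
    then show ?thesis
    proof cases
      case 1
      then have "\<forall>\<^sub>F s in nhds t. K s = 1" using eventually_nhds_in_open[of "{..<1}" t] by (auto simp: K_def elim!: eventually_mono)
      then show ?thesis by (subst isCont_cong[of _ "\<lambda>_. 1"]) auto
    next
      case 5
      then have "\<forall>\<^sub>F s in nhds t. K s = Rs" using eventually_nhds_in_open[of "{R<..}" t] R by (auto simp: K_def elim!: eventually_mono)
      then show ?thesis by (subst isCont_cong[of _ "\<lambda>_. Rs"]) auto
    next
      case 3
      then have "\<forall>\<^sub>F s in nhds t. K s = K1 s" using eventually_nhds_in_open[of "{1<..<R}" t] by (auto simp: K_def elim!: eventually_mono)
      moreover have "isCont K1 t" using K1c 3 by (simp add: continuous_on_eq_continuous_at)
      ultimately show ?thesis by (subst isCont_cong[of _ K1]) auto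
    next
      case 2
      have "(K \<longlongrightarrow> 1) (at_left 1)"
        by (rule tendsto_eventually) (auto simp: K_def eventually_at_left_field intro!: exI[of _ 0])
      moreover have "(K \<longlongrightarrow> 1) (at_right 1)"
        by (rule Lim_transform_eventually[OF l1]) (use R in \<open>auto simp: KK1 eventually_at_right_field intro!: exI[of _ R]\<close>)
      ultimately show ?thesis using 2 by (simp add: isCont_def filterlim_split_at K1')
    next
      case 4
      have "(K \<longlongrightarrow> Rs) (at_right R)"
        by (rule tendsto_eventually) (use R in \<open>auto simp: K_def eventually_at_right_field intro!: exI[of _ "R + 1"]\<close>)
      moreover have "(K \<longlongrightarrow> Rs) (at_left R)"
        by (rule Lim_transform_eventually[OF lR]) (use R in \<open>auto simp: KK1 eventually_at_left_field intro!: exI[of _ 1]\<close>)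
      ultimately show ?thesis using 4 by (simp add: isCont_def filterlim_split_at KR)
    qed
  qed
  have Kmono: "K s \<le> K t" if "s \<le> t" for s t
    using that K1mono[of s t] K1b[of s] K1b[of t] \<open>1 < Rs\<close> by (cases "s = t") (auto simp: K_def)
  have K1le: "1 \<le> K t" for t using K1b[of t] \<open>1 < Rs\<close> by (auto simp: K_def)
  have hK: "h x = \<sigma> *\<^sub>R radial_map K x" if x: "x \<in> annulus R" for x
  proof -
    have n: "1 < norm x" "norm x < R" using x by (auto simp: annulus_def)
    have "K0 (norm x) = \<sigma> * K (norm x)" using \<sigma> by (auto simp: KK1[OF n] K1_def)
    then show ?thesis using K0[OF x] by (simp add: radial_map_def)
  qed
  have "\<sigma> ^ CARD('n) = 1"
  proof -
    define x :: "real ^ 'n" where "x = m *\<^sub>R e"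
    have "x \<in> annulus R" unfolding x_def by (rule te[OF m])
    then obtain r where r: "0 < r" "cball x r \<subseteq> annulus R"
      using open_annulus[of R, where 'n='n] by (auto simp: open_contains_cball)
    obtain c c' where cc': "homeomorphic_maps (nsphere (CARD('n) - 1)) (top_of_set (sphere (0 :: real ^ 'n) 1)) c c'"
      using sphere_homeomorphic_nsphere[where 'n='n] by (auto simp: homeomorphic_space_def)
    have "Brouwer_degree2 (CARD('n) - 1) (c' \<circ> local_sphere_map h x r \<circ> c) = 1"
      using ori r cc' by (auto simp: orientation_preserving_on_def)
    moreover have "Brouwer_degree2 (CARD('n) - 1) (c' \<circ> local_sphere_map h x r \<circ> c) = (if \<sigma> = 1 then 1 else (- 1) ^ CARD('n))"
    proof (rule radial_map_degree[OF _ _ _ hK \<sigma> r cc'])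
      show "continuous_on {1<..<R} K" using Kc by (simp add: continuous_at_imp_continuous_on)
      show "K s < K t" if "1 < s" "s < t" "t < R" for s t using K1mono[OF that] that by (simp add: KK1)
      show "0 < K t" for t using K1le[of t] by simp
    qed
    ultimately show ?thesis using \<sigma>
      by (cases "even (CARD('n))") (auto split: if_splits)
  qed
  moreover have "continuous_on UNIV K" using Kc by (simp add: continuous_at_imp_continuous_on)
  moreover have "mono K" using Kmono by (rule monoI)
  ultimately show thesis
    using \<sigma> K1' KR K1le hK by (intro that[of \<sigma> K])
qed

text \<open>Surjectivity onto the target annulus is the intermediate value theorem for \<open>K\<close>; continuity of the
inverse comes from invariance of domain.\<close>

lemma radial_map_in_radial_class:
  fixes K k :: "real \<Rightarrow> real"
  assumes R: "1 < R" and K: "continuous_on {1..R} K" "K 1 = 1" "K R = Rs"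
    and mono: "\<And>s t. 1 \<le> s \<Longrightarrow> s < t \<Longrightarrow> t \<le> R \<Longrightarrow> K s < K t"
    and W: "(radial_map K :: real ^ 'n::finite \<Rightarrow> _) \<in> sobolev_W1 CARD('n) (annulus R)"
  shows "(radial_map K :: real ^ 'n \<Rightarrow> _) \<in> radial_class R Rs"
proof -
  let ?h = "radial_map K :: real ^ 'n \<Rightarrow> _"
  have b: "1 < K t" "K t < Rs" if "1 < t" "t < R" for t using mono[of 1 t] mono[of t R] that K by auto
  have Kc: "continuous_on {1<..<R} K" by (rule continuous_on_subset[OF K(1)]) auto
  have m': "\<And>s t. 1 < s \<Longrightarrow> s < t \<Longrightarrow> t < R \<Longrightarrow> K s < K t" using mono by auto
  have p': "\<And>t. 1 < t \<Longrightarrow> t < R \<Longrightarrow> 0 < K t" using b(1) by fastforce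
  have nh: "norm (?h x) = K (norm x)" if "x \<in> annulus R" for x
    using that norm_radial_map[of x K] p'[of "norm x"] by (cases "x = 0") (auto simp: annulus_def)
  have img: "?h ` annulus R = annulus Rs"
  proof
    show "?h ` annulus R \<subseteq> annulus Rs"
    proof
      fix y assume "y \<in> ?h ` annulus R"
      then obtain x where "x \<in> annulus R" "y = ?h x" by auto
      then show "y \<in> annulus Rs" using nh[of x] b[of "norm x"] by (simp add: annulus_def)
    qed
    show "annulus Rs \<subseteq> ?h ` annulus R"
    proof
      fix y :: "real ^ 'n" assume "y \<in> annulus Rs"
      then have y: "1 < norm y" "norm y < Rs" by (auto simp: annulus_def)
      obtain t where t: "1 \<le> t" "t \<le> R" "K t = norm y"
        using IVT'[of K 1 "norm y" R] K R y by auto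
      then have "t \<noteq> 1" "t \<noteq> R" using K y by auto
      then have t': "1 < t" "t < R" using t by auto
      have y0: "y \<noteq> 0" using y by auto
      define x where "x = (t / norm y) *\<^sub>R y"
      have nx: "norm x = t" using t' y0 by (simp add: x_def)
      have "?h x = y" unfolding radial_map_def nx t(3) using y0 t' by (simp add: x_def)
      moreover have "x \<in> annulus R" using nx t' by (simp add: annulus_def)
      ultimately show "y \<in> ?h ` annulus R" by auto
    qed
  qed
  obtain g where "homeomorphism (annulus R) (?h ` annulus R) ?h g"
    using invariance_of_domain_homeomorphism[OF open_annulus radial_map_continuous_on[OF Kc] _ radial_map_inj_on[OF m' p']]
    by auto
  then have hom: "\<exists>g. homeomorphism (annulus R) (annulus Rs) ?h g" unfolding img by blast
  have ori: "orientation_preserving_on (annulus R) ?h"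
    unfolding orientation_preserving_on_def
    using radial_map_degree[OF Kc m' p', of ?h 1] by auto
  have "(K \<longlongrightarrow> K 1) (at 1 within {1..R})" using K(1) R by (auto simp: continuous_on_def)
  then have l1: "(K \<longlongrightarrow> 1) (at_right 1)" using at_within_Icc_at_right[OF R] K(2) by simp
  have "(K \<longlongrightarrow> K R) (at R within {1..R})" using K(1) R by (auto simp: continuous_on_def)
  then have lR: "(K \<longlongrightarrow> Rs) (at_left R)" using at_within_Icc_at_left[OF R] K(3) by simp
  have "((\<lambda>x. norm (?h x)) \<longlongrightarrow> 1) (filtercomap norm (at_right 1))"
  proof (rule Lim_transform_eventually)
    show "((\<lambda>x::real^'n. K (norm x)) \<longlongrightarrow> 1) (filtercomap norm (at_right 1))"
      by (rule filterlim_compose[OF l1 filterlim_filtercomap])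
    have "\<forall>\<^sub>F t in at_right 1. 1 < t \<and> t < R" using R by (auto simp: eventually_at_right_field intro!: exI[of _ R])
    then have "\<forall>\<^sub>F x::real^'n in filtercomap norm (at_right 1). 1 < norm x \<and> norm x < R" by (rule eventually_filtercomapI)
    then show "\<forall>\<^sub>F x in filtercomap norm (at_right 1). K (norm x) = norm (?h x)"
      by eventually_elim (simp add: nh annulus_def)
  qed
  moreover have "((\<lambda>x. norm (?h x)) \<longlongrightarrow> Rs) (filtercomap norm (at_left R))"
  proof (rule Lim_transform_eventually)
    show "((\<lambda>x::real^'n. K (norm x)) \<longlongrightarrow> Rs) (filtercomap norm (at_left R))"
      by (rule filterlim_compose[OF lR filterlim_filtercomap])
    have "\<forall>\<^sub>F t in at_left R. 1 < t \<and> t < R" using R by (auto simp: eventually_at_left_field intro!: exI[of _ 1])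
    then have "\<forall>\<^sub>F x::real^'n in filtercomap norm (at_left R). 1 < norm x \<and> norm x < R" by (rule eventually_filtercomapI)
    then show "\<forall>\<^sub>F x in filtercomap norm (at_left R). K (norm x) = norm (?h x)"
      by eventually_elim (simp add: nh annulus_def)
  qed
  ultimately show ?thesis
    unfolding radial_class_def using hom ori W by (intro CollectI conjI exI[of _ K]) auto
qed

section \<open>The differential equation as an Euler--Lagrange equation\<close>

text \<open>The graph of the convex function \<open>z \<mapsto> (c + z^2)^(n/2)\<close> lies above its tangent at \<open>y\<close>: the inequality
of Cauchy and Schwarz gives this for the square root, Bernoulli's inequality for the \<open>n\<close>-th power.\<close>

lemma norm_power_tangent:
  fixes c y z :: real
  assumes c: "0 < c" and n: "2 \<le> n"
  shows "sqrt (c + z\<^sup>2) ^ n \<ge> sqrt (c + y\<^sup>2) ^ n + real n * sqrt (c + y\<^sup>2) ^ (n - 2) * y * (z - y)"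
proof -
  define q where "q y = sqrt (c + y\<^sup>2)" for y
  have qp: "0 < q y" for y using c by (auto simp: q_def intro: add_pos_nonneg)
  have q2: "(q y)\<^sup>2 = c + y\<^sup>2" for y using c by (simp add: q_def)
  have cs: "c + y * z \<le> q y * q z"
  proof (rule power2_le_imp_le)
    have "0 \<le> c * (y - z)\<^sup>2" using c by simp
    then show "(c + y * z)\<^sup>2 \<le> (q y * q z)\<^sup>2"
      unfolding power_mult_distrib q2 by (simp add: power2_eq_square algebra_simps)
    show "0 \<le> q y * q z" using qp[of y] qp[of z] by simp
  qed
  \<comment> \<open>Bernoulli's inequality for the ratio \<open>q z / q y = 1 + d\<close>\<close>
  have b: "q z ^ n \<ge> q y ^ n + real n * q y ^ (n - 1) * (q z - q y)"
  proof -
    define d where "d = q z / q y - 1"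
    have "- 1 \<le> d" using qp[of y] qp[of z] by (simp add: d_def)
    then have "1 + real n * d \<le> (1 + d) ^ n" by (rule Bernoulli_inequality)
    then have "q y ^ n * (1 + real n * d) \<le> q y ^ n * (1 + d) ^ n" using qp[of y] by (intro mult_left_mono) auto
    also have "q y ^ n * (1 + d) ^ n = q z ^ n"
      using qp[of y] by (simp add: d_def power_mult_distrib[symmetric])
    also have "q y ^ n * (1 + real n * d) = q y ^ n + real n * q y ^ (n - 1) * (q z - q y)"
    proof -
      have "q y ^ n = q y * q y ^ (n - 1)" using n by (simp add: power_eq_if)
      moreover have "q y * d = q z - q y" using qp[of y] by (simp add: d_def field_simps)
      ultimately show ?thesis by (simp add: distrib_left)
    qed
    finally show ?thesis .
  qed
  have "q y * (q z - q y) \<ge> y * (z - y)"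
    using cs q2[of y] by (simp add: power2_eq_square algebra_simps)
  then have "real n * q y ^ (n - 2) * (y * (z - y)) \<le> real n * q y ^ (n - 2) * (q y * (q z - q y))"
    using qp[of y] by (intro mult_left_mono) auto
  also have "\<dots> = real n * q y ^ (n - 1) * (q z - q y)"
  proof -
    have "q y ^ (n - 1) = q y ^ (n - 2) * q y"
      using n by (metis Suc_1 Suc_diff_Suc Suc_le_lessD mult.commute power_Suc One_nat_def numeral_2_eq_2)
    then show ?thesis by simp
  qed
  finally show ?thesis using b by (simp add: q_def[symmetric] mult.assoc)
qed

text \<open>The identity behind the Euler--Lagrange equation, with \<open>m\<close> for \<open>t^2\<close> times the coefficient \<open>M\<close> of the
differential equation, \<open>F\<close> for the second derivative of \<open>\<Phi>\<close>, and \<open>P = q^(n-2)\<close>, \<open>T = t^n\<close>, \<open>U = H^n\<close>.\<close>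

lemma Euler_Lagrange_algebra:
  fixes n y q P T U F m :: real
  assumes q: "q\<^sup>2 = n - 1 + y\<^sup>2"
    and m: "m * ((n - 1) * n * P * T * (1 + y\<^sup>2) + U * q\<^sup>2 * F) = (n - 1) * (n * P * T * (q\<^sup>2 + (n - 2) * y) + U * y * q\<^sup>2 * F)"
    and pos: "n \<noteq> 0" "T \<noteq> 0" "q \<noteq> 0"
  shows "(y + m) * (P * (n - 1) * (1 + y\<^sup>2) / q\<^sup>2) + F * (U / T) * (m - (n - 1) * y) / n = (n - 1) * P * (1 + y)"
proof -
  have "(y + m) * P * (n * T) * (n - 1) * (1 + y\<^sup>2) + F * U * q\<^sup>2 * (m - (n - 1) * y) = (n - 1) * P * (1 + y) * (n * T * q\<^sup>2)"
  proof -
    have "(y + m) * P * (n * T) * (n - 1) * (1 + y\<^sup>2) + F * U * q\<^sup>2 * (m - (n - 1) * y) =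
        m * ((n - 1) * n * P * T * (1 + y\<^sup>2) + U * q\<^sup>2 * F) + y * ((n - 1) * n * P * T * (1 + y\<^sup>2)) - (n - 1) * y * (U * q\<^sup>2 * F)"
      by (simp add: algebra_simps)
    also have "\<dots> = (n - 1) * n * P * T * (q\<^sup>2 + y * (n - 1 + y\<^sup>2))"
      unfolding m by (simp add: algebra_simps)
    also have "\<dots> = (n - 1) * P * (1 + y) * (n * T * q\<^sup>2)"
      unfolding q[symmetric] by (simp add: algebra_simps)
    finally show ?thesis .
  qed
  moreover have "(y + m) * (P * (n - 1) * (1 + y\<^sup>2) / q\<^sup>2) + F * (U / T) * (m - (n - 1) * y) / n =
      ((y + m) * P * (n * T) * (n - 1) * (1 + y\<^sup>2) + F * U * q\<^sup>2 * (m - (n - 1) * y)) / (n * T * q\<^sup>2)"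
    using pos by (simp add: divide_simps)
  ultimately show ?thesis using pos by simp
qed

text \<open>In terms of the scale invariant quantity \<open>y = t k / h\<close> all summands in the numerator and in the
denominator of the coefficient share the factor \<open>s\<close>.\<close>

lemma M_coeff_reduced:
  fixes t h k :: real
  assumes n: "2 \<le> n" and t: "0 < t" and h: "0 < h" and k: "0 < k"
    and J: "J = t powi (1 - int n) * h ^ (n - 1) * k" and F: "0 < (deriv ^^ 2) \<Phi> J"
    and y: "y = t * k / h" and q: "q = sqrt (real n - 1 + y\<^sup>2)"
  shows "(t\<^sup>2 * M_coeff n \<Phi> t h k) * ((real n - 1) * real n * q ^ (n - 2) * t ^ n * (1 + y\<^sup>2) + h ^ n * q\<^sup>2 * (deriv ^^ 2) \<Phi> J) =
    (real n - 1) * (real n * q ^ (n - 2) * t ^ n * (q\<^sup>2 + (real n - 2) * y) + h ^ n * y * q\<^sup>2 * (deriv ^^ 2) \<Phi> J)"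
proof -
  define F where "F = (deriv ^^ 2) \<Phi> J"
  define N where "N = real n"
  define P where "P = q ^ (n - 2)"
  have N: "2 \<le> N" using n by (simp add: N_def)
  have y0: "0 < y" using y t h k by simp
  have q2: "q\<^sup>2 = N - 1 + y\<^sup>2" using q N by (simp add: N_def)
  have q0: "0 < q" using q N y0 by (simp add: N_def add_pos_pos)
  have ky: "k = y * h / t" using y t h by simp
  have w: "((real n - 1) * h\<^sup>2 / t\<^sup>2 + k\<^sup>2) powr (real n / 2) = P * q\<^sup>2 * (h ^ n / t ^ n)"
  proof -
    have "(real n - 1) * h\<^sup>2 / t\<^sup>2 + k\<^sup>2 = (q * h / t)\<^sup>2"
      using t by (simp add: ky power_mult_distrib power_divide q2 N_def algebra_simps add_divide_distrib diff_divide_distrib)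
    also have "\<dots> powr (real n / 2) = (q * h / t) powr (real n)"
    proof -
      have "0 < q * h / t" using q0 h t by simp
      then have "(q * h / t)\<^sup>2 = (q * h / t) powr 2" by (simp add: powr_numeral)
      then show ?thesis by (simp add: powr_powr)
    qed
    also have "\<dots> = (q * h / t) ^ n" using q0 h t by (simp add: powr_realpow)
    also have "\<dots> = q ^ n * (h ^ n / t ^ n)" by (simp add: power_mult_distrib power_divide)
    also have "q ^ n = P * q\<^sup>2" 
    proof -
      have "n - 2 + 2 = n" using n by simp
      with power_add[of q "n - 2" 2] show ?thesis by (simp only: P_def)
    qed
    finally show ?thesis .
  qed
  have Qeq: "(real n - 1) * h\<^sup>2 + t\<^sup>2 * k\<^sup>2 = h\<^sup>2 * q\<^sup>2"
    using t by (simp add: ky power_mult_distrib power_divide q2 N_def algebra_simps)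
  define B where "B = real n * t ^ (2 * n) * h ^ 3 * (P * q\<^sup>2 * (h ^ n / t ^ n)) * (h\<^sup>2 * q\<^sup>2 + (real n - 2) * t * h * k)"
  define C0 where "C0 = t * h ^ (2 * n) * k * (h\<^sup>2 * q\<^sup>2)\<^sup>2"
  define D where "D = (real n - 1) * real n * t ^ (2 * n) * h\<^sup>2 * (P * q\<^sup>2 * (h ^ n / t ^ n)) * (h\<^sup>2 + t\<^sup>2 * k\<^sup>2)"
  define E0 where "E0 = h ^ (2 * n) * (h\<^sup>2 * q\<^sup>2)\<^sup>2"
  have M: "M_coeff n \<Phi> t h k = (real n - 1) / (t\<^sup>2 * h) * ((B + C0 * F) / (D + E0 * F))"
  proof -
    have c: "(real n - 1) * h\<^sup>2 + (real n - 2) * t * h * k + t\<^sup>2 * k\<^sup>2 = h\<^sup>2 * q\<^sup>2 + (real n - 2) * t * h * k"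
      using Qeq by simp
    show ?thesis
      unfolding M_coeff_def Let_def w Qeq c F_def J B_def C0_def D_def E0_def using k by simp
  qed
  \<comment> \<open>the common factor of all four summands\<close>
  define s where "s = h ^ n * q\<^sup>2 * h ^ 4"
  have s0: "s \<noteq> 0" using h q0 by (simp add: s_def)
  have tt: "t ^ (2 * n) * (h ^ n / t ^ n) = t ^ n * h ^ n"
  proof -
    have "t ^ (2 * n) = t ^ n * t ^ n" unfolding mult_2 power_add ..
    then show ?thesis using t by simp
  qed
  have hh: "h ^ (2 * n) = h ^ n * h ^ n" unfolding mult_2 power_add ..
  have tk: "t * k = y * h" using t by (simp add: ky)
  have Bs: "B = s * (h * (N * P * t ^ n * (q\<^sup>2 + (N - 2) * y)))"
  proof -
    have "B = N * (t ^ (2 * n) * (h ^ n / t ^ n)) * h ^ 3 * P * q\<^sup>2 * (h\<^sup>2 * q\<^sup>2 + (N - 2) * h * (t * k))"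
      by (simp add: B_def N_def mult_ac)
    then show ?thesis unfolding tt tk s_def by (simp add: power2_eq_square power3_eq_cube power4_eq_xxxx algebra_simps)
  qed
  have Cs: "C0 = s * (h * (h ^ n * y * q\<^sup>2))"
  proof -
    have "C0 = (t * k) * h ^ (2 * n) * (h\<^sup>2 * q\<^sup>2)\<^sup>2" by (simp add: C0_def mult_ac)
    then show ?thesis unfolding tk hh s_def by (simp add: power2_eq_square power4_eq_xxxx algebra_simps)
  qed
  have Ds: "D = s * ((N - 1) * N * P * t ^ n * (1 + y\<^sup>2))"
  proof -
    have "t\<^sup>2 * k\<^sup>2 = (y * h)\<^sup>2" unfolding tk[symmetric] by (simp add: power_mult_distrib)
    then have "D = (N - 1) * N * (t ^ (2 * n) * (h ^ n / t ^ n)) * h\<^sup>2 * P * q\<^sup>2 * (h\<^sup>2 + (y * h)\<^sup>2)"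
      by (simp add: D_def N_def mult_ac)
    then show ?thesis unfolding tt s_def by (simp add: power2_eq_square power4_eq_xxxx algebra_simps)
  qed
  have Es: "E0 = s * (h ^ n * q\<^sup>2)"
    unfolding E0_def hh s_def by (simp add: power2_eq_square power4_eq_xxxx algebra_simps)
  have Fp: "0 < F" using F by (simp add: F_def)
  define D' where "D' = (N - 1) * N * P * t ^ n * (1 + y\<^sup>2) + h ^ n * q\<^sup>2 * F"
  define B' where "B' = N * P * t ^ n * (q\<^sup>2 + (N - 2) * y) + h ^ n * y * q\<^sup>2 * F"
  have D': "0 < D'"
    unfolding D'_def using N t h q0 Fp
    by (intro add_nonneg_pos mult_nonneg_nonneg mult_pos_pos) (auto simp: P_def)
  have "B + C0 * F = s * (h * B')" "D + E0 * F = s * D'"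
    unfolding Bs Cs Ds Es B'_def D'_def by (simp_all add: algebra_simps)
  then have "M_coeff n \<Phi> t h k = (N - 1) / (t\<^sup>2 * h) * (h * B' / D')"
    unfolding M N_def using s0 by simp
  then have "t\<^sup>2 * M_coeff n \<Phi> t h k = (N - 1) * B' / D'"
    using t h by simp
  then have "t\<^sup>2 * M_coeff n \<Phi> t h k * D' = (N - 1) * B'" using D' by simp
  then show ?thesis unfolding D'_def B'_def F_def N_def P_def .
qed

text \<open>The common factor \<open>1 - y\<close> in the derivatives of \<open>y\<close> and of the Jacobian comes from
\<open>H - t H' = H (1 - y)\<close>; the remaining factors are combined by \<open>Euler_Lagrange_algebra\<close>. The right-hand side is
the partial derivative in \<open>v = H^n\<close> of the energy density.\<close>

lemma Euler_Lagrange_equation: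
  fixes H dH :: "real \<Rightarrow> real"
  assumes n: "2 \<le> n" and t: "0 < t" and h: "0 < H t" and k: "0 < dH t"
    and H: "(H has_real_derivative dH t) (at t)"
    and dH: "(dH has_real_derivative (H t - t * dH t) * M_coeff n \<Phi> t (H t) (dH t)) (at t)"
    and F: "(deriv \<Phi> has_real_derivative (deriv ^^ 2) \<Phi> J) (at J)" "0 < (deriv ^^ 2) \<Phi> J"
    and J: "J = dH t * (H t / t) ^ (n - 1)"
    and y: "\<And>t. y t = t * dH t / H t" and q: "\<And>t. q t = sqrt (real n - 1 + (y t)\<^sup>2)"
  shows "((\<lambda>t. y t * q t ^ (n - 2) + deriv \<Phi> (dH t * (H t / t) ^ (n - 1)) / real n) has_real_derivative
    (real n - 1) / t * q t ^ (n - 2) * (1 - (y t)\<^sup>2)) (at t)"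
proof -
  define M where "M = M_coeff n \<Phi> t (H t) (dH t)"
  define m where "m = t\<^sup>2 * M"
  define N where "N = real n"
  define Y Q P where "Y = y t" and "Q = q t" and "P = q t ^ (n - 2)"
  define D2 where "D2 = (deriv ^^ 2) \<Phi> J"
  define T U where "T = t ^ n" and "U = H t ^ n"
  have N: "2 \<le> N" using n by (simp add: N_def)
  have Y0: "0 < Y" using y t h k by (simp add: Y_def)
  have Q2: "Q\<^sup>2 = N - 1 + Y\<^sup>2" using q[of t] N by (simp add: N_def Q_def Y_def)
  have Q0: "0 < Q" using q[of t] N Y0 by (simp add: N_def Q_def Y_def add_pos_nonneg)
  have kY: "dH t = Y * H t / t" using y[of t] t h by (simp add: Y_def)
  have Jeq: "J = t powi (1 - int n) * H t ^ (n - 1) * dH t"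
  proof -
    have "t powi (1 - int n) = inverse (t ^ (n - 1))"
      using n t by (simp add: power_int_def nat_diff_distrib' of_nat_diff power_inverse)
    then show ?thesis by (simp add: J power_divide divide_inverse mult_ac power_mult_distrib power_inverse)
  qed
  have red: "m * ((N - 1) * N * P * T * (1 + Y\<^sup>2) + U * Q\<^sup>2 * D2) = (N - 1) * (N * P * T * (Q\<^sup>2 + (N - 2) * Y) + U * Y * Q\<^sup>2 * D2)"
    using M_coeff_reduced[OF n t h k Jeq F(2) y[of t] q[of t]]
    by (simp only: m_def M_def N_def P_def T_def U_def Y_def Q_def D2_def)
  have key: "(Y + m) * (P * (N - 1) * (1 + Y\<^sup>2) / Q\<^sup>2) + D2 * (U / T) * (m - (N - 1) * Y) / N = (N - 1) * P * (1 + Y)"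
    by (rule Euler_Lagrange_algebra[OF Q2 red]) (use N t Q0 in \<open>auto simp: T_def\<close>)
  have dHt: "(H t - t * dH t) * M = H t * (1 - Y) * m / t\<^sup>2"
  proof -
    have "H t - t * dH t = H t * (1 - Y)" "m / t\<^sup>2 = M" using t by (simp_all add: kY m_def algebra_simps)
    then show ?thesis by (simp flip: times_divide_eq_right)
  qed
  define Y' where "Y' = (1 - Y) * (Y + m) / t"
  have "(y has_real_derivative ((dH t + t * ((H t - t * dH t) * M)) * H t - t * dH t * dH t) / (H t * H t)) (at t)"
  proof -
    have "((\<lambda>t. t * dH t / H t) has_real_derivative ((dH t + t * ((H t - t * dH t) * M)) * H t - t * dH t * dH t) / (H t * H t)) (at t)"
      using h unfolding M_def by (auto intro!: derivative_eq_intros H dH)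
    then show ?thesis by (simp add: y[abs_def, symmetric] y)
  qed
  moreover have "((dH t + t * ((H t - t * dH t) * M)) * H t - t * dH t * dH t) / (H t * H t) = Y'"
    unfolding dHt unfolding kY Y'_def using t h by (simp add: field_simps power2_eq_square)
  ultimately have y': "(y has_real_derivative Y') (at t)" by simp
  have q': "(q has_real_derivative Y * Y' / Q) (at t)"
  proof -
    have "0 < real n - 1 + (y t)\<^sup>2" using N by (simp add: N_def add_pos_nonneg)
    then have "((\<lambda>t. sqrt (real n - 1 + (y t)\<^sup>2)) has_real_derivative Y * Y' / Q) (at t)"
      by (auto intro!: derivative_eq_intros y' simp: Y_def Q_def q field_simps)
    moreover have "q = (\<lambda>t. sqrt (real n - 1 + (y t)\<^sup>2))" using q by auto
    ultimately show ?thesis by simp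
  qed
  have P': "((\<lambda>t. q t ^ (n - 2)) has_real_derivative (N - 2) * P * Y * Y' / Q\<^sup>2) (at t)"
  proof -
    have "((\<lambda>t. q t ^ (n - 2)) has_real_derivative real (n - 2) * q t ^ (n - 2 - Suc 0) * (Y * Y' / Q)) (at t)"
      using DERIV_power[OF q', of "n - 2"] by (simp add: mult_ac)
    moreover have "real (n - 2) * q t ^ (n - 2 - Suc 0) * (Y * Y' / Q) = (N - 2) * P * Y * Y' / Q\<^sup>2"
    proof (cases "n = 2")
      case False
      then have "n - 2 = Suc (n - 2 - Suc 0)" using n by simp
      then have "P = Q ^ Suc (n - 2 - Suc 0)" unfolding P_def Q_def by (rule arg_cong)
      then show ?thesis using Q0 n by (simp add: N_def Q_def of_nat_diff power2_eq_square)
    qed (simp add: N_def)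
    ultimately show ?thesis by simp
  qed
  define J' where "J' = (U / T) * (1 - Y) * (m - (N - 1) * Y) / t"
  have J': "((\<lambda>t. dH t * (H t / t) ^ (n - 1)) has_real_derivative J') (at t)"
  proof -
    define V where "V = (H t / t) ^ (n - 1)"
    have ht: "((\<lambda>t. H t / t) has_real_derivative (dH t * t - H t) / (t * t)) (at t)"
      using t by (auto intro!: derivative_eq_intros H)
    have hp: "((\<lambda>t. (H t / t) ^ (n - 1)) has_real_derivative real (n - 1) * (H t / t) ^ (n - 1 - Suc 0) * ((dH t * t - H t) / (t * t))) (at t)"
      using DERIV_power[OF ht, of "n - 1"] by (simp add: mult_ac)
    have d: "((\<lambda>t. dH t * (H t / t) ^ (n - 1)) has_real_derivative
        (H t - t * dH t) * M * V + real (n - 1) * (H t / t) ^ (n - 1 - Suc 0) * ((dH t * t - H t) / (t * t)) * dH t) (at t)"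
      using DERIV_mult[OF dH hp] by (simp add: M_def V_def)
    have V: "V = (H t / t) * (H t / t) ^ (n - 1 - Suc 0)"
    proof -
      have "n - 1 = Suc (n - 1 - Suc 0)" using n by simp
      then show ?thesis unfolding V_def by (metis power_Suc)
    qed
    have V2: "(H t / t) * V = U / T"
    proof -
      have "n = Suc (n - 1)" using n by simp
      then have "(H t / t) ^ n = (H t / t) * V" unfolding V_def by (metis power_Suc)
      then show ?thesis by (simp add: U_def T_def power_divide)
    qed
    have a1: "real (n - 1) * (H t / t) ^ (n - 1 - Suc 0) * ((dH t * t - H t) / (t * t)) * dH t = - (N - 1) * (U / T) * (1 - Y) * Y / t"
      unfolding V2[symmetric] V kY using t n by (simp add: N_def of_nat_diff field_simps)
    have a2: "(H t - t * dH t) * M * V = (U / T) * (1 - Y) * m / t"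
      unfolding dHt V2[symmetric] using t by (simp add: power2_eq_square)
    have "(H t - t * dH t) * M * V + real (n - 1) * (H t / t) ^ (n - 1 - Suc 0) * ((dH t * t - H t) / (t * t)) * dH t = J'"
    proof -
      define W where "W = U / T"
      show ?thesis unfolding a1 a2 J'_def W_def[symmetric]
        by (simp add: algebra_simps diff_divide_distrib add_divide_distrib)
    qed
    with d show ?thesis by simp
  qed
  have D: "((\<lambda>t. deriv \<Phi> (dH t * (H t / t) ^ (n - 1))) has_real_derivative D2 * J') (at t)"
    using DERIV_chain2[OF F(1)[unfolded J] J'] by (simp add: D2_def J)
  have A: "((\<lambda>t. y t * q t ^ (n - 2) + deriv \<Phi> (dH t * (H t / t) ^ (n - 1)) / real n) has_real_derivative
      (Y' * P + (N - 2) * P * Y * Y' / Q\<^sup>2 * Y) + D2 * J' / N) (at t)"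
    using DERIV_add[OF DERIV_mult[OF y' P'] DERIV_cdivide[OF D, of "real n"]] by (simp add: P_def Y_def N_def)
  have B: "(Y' * P + (N - 2) * P * Y * Y' / Q\<^sup>2 * Y) + D2 * J' / N =
      (1 - Y) / t * ((Y + m) * (P * (N - 1) * (1 + Y\<^sup>2) / Q\<^sup>2) + D2 * (U / T) * (m - (N - 1) * Y) / N)"
  proof -
    have "Y' * P + (N - 2) * P * Y * Y' / Q\<^sup>2 * Y = Y' * P * (Q\<^sup>2 + (N - 2) * Y\<^sup>2) / Q\<^sup>2"
      using Q0 by (simp add: field_simps power2_eq_square)
    also have "Q\<^sup>2 + (N - 2) * Y\<^sup>2 = (N - 1) * (1 + Y\<^sup>2)" unfolding Q2 by (simp add: algebra_simps)
    finally have e1: "Y' * P + (N - 2) * P * Y * Y' / Q\<^sup>2 * Y = Y' * P * ((N - 1) * (1 + Y\<^sup>2)) / Q\<^sup>2" .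
    have e2: "Y' * P * ((N - 1) * (1 + Y\<^sup>2)) / Q\<^sup>2 = (1 - Y) / t * ((Y + m) * (P * (N - 1) * (1 + Y\<^sup>2) / Q\<^sup>2))"
      by (simp add: Y'_def mult_ac)
    have e3: "D2 * J' / N = (1 - Y) / t * (D2 * (U / T) * (m - (N - 1) * Y) / N)"
      by (simp add: J'_def mult_ac)
    show ?thesis unfolding e1 e2 e3 by (simp only: distrib_left)
  qed
  have C: "(1 - Y) / t * ((N - 1) * P * (1 + Y)) = (N - 1) / t * P * (1 - Y\<^sup>2)"
    by (simp add: power2_eq_square algebra_simps add_divide_distrib diff_divide_distrib)
  from A show ?thesis unfolding B key C by (simp only: N_def P_def Y_def)
qed

section \<open>Calibration of the energy density\<close>

lemma convex_on_le_max:
  fixes \<Phi> :: "real \<Rightarrow> real"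
  assumes conv: "convex_on {0<..} \<Phi>" and xyz: "0 < x" "x \<le> y" "y \<le> z"
  shows "\<Phi> y \<le> max (\<Phi> x) (\<Phi> z)"
proof (cases "x = z")
  case False
  define u where "u = (y - x) / (z - x)"
  have d: "0 < z - x" using False xyz by simp
  have u: "0 \<le> u" "u \<le> 1" using d xyz by (auto simp: u_def)
  have "u * (z - x) = y - x" using d by (simp add: u_def)
  then have y: "y = (1 - u) *\<^sub>R x + u *\<^sub>R z" by (simp add: algebra_simps)
  have "\<Phi> y \<le> (1 - u) * \<Phi> x + u * \<Phi> z"
    unfolding y using convex_onD[OF conv u] xyz by simp
  also have "\<dots> \<le> (1 - u) * max (\<Phi> x) (\<Phi> z) + u * max (\<Phi> x) (\<Phi> z)"
    using u by (intro add_mono mult_left_mono) auto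
  finally show ?thesis by (simp add: algebra_simps)
qed (use xyz in auto)

text \<open>Near \<open>0\<close> a convex function is monotone: decreasing if it decreases anywhere, and increasing otherwise. The
limit may be infinite in the first case.\<close>

lemma convex_limit_at_zero:
  fixes \<Phi> :: "real \<Rightarrow> real"
  assumes conv: "convex_on {0<..} \<Phi>"
  shows "\<exists>L. ((\<lambda>s. ennreal (\<Phi> s)) \<longlongrightarrow> L) (at_right 0)"
proof (cases "\<exists>u v. 0 < u \<and> u < v \<and> \<Phi> v < \<Phi> u")
  case True
  then obtain u v where uv: "0 < u" "u < v" "\<Phi> v < \<Phi> u" by auto
  have anti: "\<Phi> y \<le> \<Phi> x" if "0 < x" "x \<le> y" "y \<le> u" for x y
  proof -
    have "\<Phi> u \<le> max (\<Phi> y) (\<Phi> v)" using convex_on_le_max[OF conv, of y u v] that uv by auto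
    then have "\<Phi> v < \<Phi> y" using uv by auto
    moreover have "\<Phi> y \<le> max (\<Phi> x) (\<Phi> v)" using convex_on_le_max[OF conv, of x y v] that uv by auto
    ultimately show ?thesis by auto
  qed
  define L where "L = (SUP s\<in>{0<..u}. ennreal (\<Phi> s))"
  have "((\<lambda>s. ennreal (\<Phi> s)) \<longlongrightarrow> L) (at_right 0)"
  proof (rule order_tendstoI)
    fix a assume "a < L"
    then obtain s where s: "0 < s" "s \<le> u" "a < ennreal (\<Phi> s)" unfolding L_def less_SUP_iff by auto
    have "a < ennreal (\<Phi> r)" if "0 < r" "r < s" for r
      using s(3) ennreal_leI[OF anti[of r s]] that s by (auto intro: less_le_trans)
    then show "\<forall>\<^sub>F r in at_right 0. a < ennreal (\<Phi> r)"
      unfolding eventually_at_right_field using s(1) by blast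
  next
    fix a assume "L < a"
    have "ennreal (\<Phi> r) < a" if "0 < r" "r < u" for r
      using \<open>L < a\<close> SUP_upper[of r "{0<..u}" "\<lambda>s. ennreal (\<Phi> s)"] that unfolding L_def by (auto intro: le_less_trans)
    then show "\<forall>\<^sub>F r in at_right 0. ennreal (\<Phi> r) < a"
      unfolding eventually_at_right_field using uv(1) by blast
  qed
  then show ?thesis by blast
next
  case False
  then have mono: "\<Phi> x \<le> \<Phi> y" if "0 < x" "x \<le> y" for x y
  proof (cases "x = y")
    case False
    then have "x < y" using that by simp
    with \<open>\<not> (\<exists>u v. 0 < u \<and> u < v \<and> \<Phi> v < \<Phi> u)\<close> that(1) have "\<not> \<Phi> y < \<Phi> x" by blast
    then show ?thesis by simp
  qed simp
  define L where "L = (INF s\<in>{0<..}. ennreal (\<Phi> s))"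
  have "((\<lambda>s. ennreal (\<Phi> s)) \<longlongrightarrow> L) (at_right 0)"
  proof (rule order_tendstoI)
    fix a assume "L < a"
    then obtain s where s: "0 < s" "ennreal (\<Phi> s) < a" unfolding L_def INF_less_iff by auto
    have "ennreal (\<Phi> r) < a" if "0 < r" "r < s" for r
      using s(2) ennreal_leI[OF mono[of r s]] that s by (auto intro: le_less_trans)
    then show "\<forall>\<^sub>F r in at_right 0. ennreal (\<Phi> r) < a"
      unfolding eventually_at_right_field using s(1) by blast
  next
    fix a assume "a < L"
    have "a < ennreal (\<Phi> r)" if "0 < r" for r
      using \<open>a < L\<close> INF_lower[of r "{0<..}" "\<lambda>s. ennreal (\<Phi> s)"] that unfolding L_def by (auto intro: less_le_trans)
    then show "\<forall>\<^sub>F r in at_right 0. a < ennreal (\<Phi> r)"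
      unfolding eventually_at_right_field by (intro exI[of _ 1]) auto
  qed
  then show ?thesis by blast
qed

text \<open>For \<open>s = 0\<close> the tangent inequality at positive arguments passes to the limit.\<close>

lemma extend_zero_above_tangent:
  assumes conv: "convex_on {0<..} \<Phi>" and d: "(\<Phi> has_real_derivative d) (at s0)" and s0: "0 < s0" and s: "0 \<le> s"
  shows "ennreal (\<Phi> s0 + d * (s - s0)) \<le> extend_zero \<Phi> s"
proof -
  have tan: "\<Phi> s0 + d * (r - s0) \<le> \<Phi> r" if "0 < r" for r
    using convex_on_imp_above_tangent[OF conv _ _ _ has_field_derivative_at_within[OF d], of r] s0 that
    by (simp add: interior_open)
  show ?thesis
  proof (cases "0 < s")
    case True
    then show ?thesis using tan[OF True] by (simp add: extend_zero_def ennreal_leI)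
  next
    case False
    then have s: "s = 0" using s by simp
    obtain L where L: "((\<lambda>s. ennreal (\<Phi> s)) \<longlongrightarrow> L) (at_right 0)" using convex_limit_at_zero[OF conv] by blast
    have "((\<lambda>r. ennreal (\<Phi> s0 + d * (r - s0))) \<longlongrightarrow> ennreal (\<Phi> s0 + d * (0 - s0))) (at_right 0)"
      by (intro tendsto_intros)
    moreover have "\<forall>\<^sub>F r in at_right 0. ennreal (\<Phi> s0 + d * (r - s0)) \<le> ennreal (\<Phi> r)"
      unfolding eventually_at_right_field by (intro exI[of _ 1]) (use tan in \<open>auto intro!: ennreal_leI\<close>)
    ultimately have "ennreal (\<Phi> s0 + d * (0 - s0)) \<le> L"
      using L by (intro tendsto_le[OF _ L]) auto
    moreover have "extend_zero \<Phi> 0 = L"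
      unfolding extend_zero_def using tendsto_Lim[OF _ L] by simp
    ultimately show ?thesis using s by simp
  qed
qed

lemma ennreal_add_le: "ennreal (a + b) \<le> ennreal a + ennreal b"
proof -
  have "ennreal (a + b) \<le> ennreal (max 0 a + max 0 b)" by (intro ennreal_leI) auto
  also have "\<dots> = ennreal (max 0 a) + ennreal (max 0 b)" by (rule ennreal_plus) auto
  also have "\<dots> = ennreal a + ennreal b" by (simp add: max_def ennreal_neg)
  finally show ?thesis .
qed

text \<open>The first part of the energy density is \<open>v g(y) / t\<close> with \<open>v = K^n\<close> and \<open>g(y) = (n - 1 + y^2)^(n/2)\<close>, and
the bound is the tangent inequality for \<open>g\<close> multiplied by \<open>v / t\<close>. Its right-hand side is linear in
\<open>v\<close> and \<open>v' = n K^(n-1) k\<close>, with equality for the pair \<open>(h, d)\<close>.\<close>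

lemma norm_power_calibration:
  fixes t h d K k :: real
  assumes n: "2 \<le> n" and t: "0 < t" and h: "0 < h" and K: "0 < K"
    and y: "y = t * d / h" and q: "q = sqrt (real n - 1 + y\<^sup>2)"
  shows "sqrt (d\<^sup>2 + (real n - 1) * (h / t)\<^sup>2) ^ n +
      ((real n - 1) / t * q ^ (n - 2) * (1 - y\<^sup>2) * (K ^ n - h ^ n) +
       y * q ^ (n - 2) * (real n * K ^ (n - 1) * k - real n * h ^ (n - 1) * d)) / t ^ (n - 1)
    \<le> sqrt (k\<^sup>2 + (real n - 1) * (K / t)\<^sup>2) ^ n"
proof -
  define N where "N = real n"
  define P where "P = q ^ (n - 2)"
  have N: "2 \<le> N" using n by (simp add: N_def)
  have c: "0 < N - 1" using N by simp
  have nn: "n = Suc (n - 1)" using n by simp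
  have q2: "q\<^sup>2 = N - 1 + y\<^sup>2" using q c by (simp add: N_def)
  have qn: "q ^ n = P * q\<^sup>2"
  proof -
    have "n - 2 + 2 = n" using n by simp
    with power_add[of q "n - 2" 2] show ?thesis by (simp only: P_def)
  qed
  have scale: "sqrt (l\<^sup>2 + (N - 1) * (v / t)\<^sup>2) ^ n = (v / t) ^ n * sqrt (N - 1 + (t * l / v)\<^sup>2) ^ n" if v: "0 < v" for l v
  proof -
    have "l\<^sup>2 + (N - 1) * (v / t)\<^sup>2 = (v / t)\<^sup>2 * (N - 1 + (t * l / v)\<^sup>2)"
      using t v by (simp add: field_simps power_mult_distrib power_divide)
    then have "sqrt (l\<^sup>2 + (N - 1) * (v / t)\<^sup>2) = v / t * sqrt (N - 1 + (t * l / v)\<^sup>2)"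
      using t v by (simp add: real_sqrt_mult)
    then show ?thesis by (simp only: power_mult_distrib)
  qed
  define A where "A v l = (v / t) ^ n * (P * ((N - 1) * (1 - y\<^sup>2))) + N * P * y * ((v / t) ^ (n - 1) * l)" for v l
  have A_alt: "(v / t) ^ n * (q ^ n + N * P * y * (t * l / v - y)) = A v l" if v: "0 < v" for v l
  proof -
    have vt: "(v / t) ^ n * (t * l / v) = (v / t) ^ (n - 1) * l"
    proof -
      have "(v / t) ^ n = (v / t) * (v / t) ^ (n - 1)" by (subst nn) simp
      then show ?thesis using v t by simp
    qed
    have "(v / t) ^ n * (q ^ n + N * P * y * (t * l / v - y)) =
        (v / t) ^ n * (q ^ n - N * P * y\<^sup>2) + N * P * y * ((v / t) ^ n * (t * l / v))"
      by (simp add: algebra_simps power2_eq_square)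
    also have "q ^ n - N * P * y\<^sup>2 = P * ((N - 1) * (1 - y\<^sup>2))"
      unfolding qn q2 by (simp add: algebra_simps)
    finally show ?thesis unfolding vt A_def .
  qed
  have low: "A K k \<le> sqrt (k\<^sup>2 + (N - 1) * (K / t)\<^sup>2) ^ n"
  proof -
    have "q ^ n + N * P * y * (t * k / K - y) \<le> sqrt (N - 1 + (t * k / K)\<^sup>2) ^ n"
      using norm_power_tangent[OF c n, of y "t * k / K"] by (simp add: N_def P_def q)
    then have "(K / t) ^ n * (q ^ n + N * P * y * (t * k / K - y)) \<le> (K / t) ^ n * sqrt (N - 1 + (t * k / K)\<^sup>2) ^ n"
      using K t by (intro mult_left_mono) auto
    then show ?thesis unfolding A_alt[OF K] scale[OF K] .
  qed
  have eq: "sqrt (d\<^sup>2 + (N - 1) * (h / t)\<^sup>2) ^ n = A h d"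
  proof -
    have "A h d = (h / t) ^ n * q ^ n" unfolding A_alt[OF h, symmetric] y[symmetric] by simp
    then show ?thesis unfolding scale[OF h] y[symmetric] by (simp add: q N_def)
  qed
  have Aform: "A v l = ((N - 1) / t * P * (1 - y\<^sup>2) * v ^ n + y * P * (N * v ^ (n - 1) * l)) / t ^ (n - 1)" for v l
  proof -
    have tn: "t ^ n = t * t ^ (n - 1)" by (subst nn) simp
    show ?thesis unfolding A_def power_divide tn using t by (simp add: add_divide_distrib mult_ac)
  qed
  have "sqrt (d\<^sup>2 + (N - 1) * (h / t)\<^sup>2) ^ n + ((N - 1) / t * P * (1 - y\<^sup>2) * (K ^ n - h ^ n) +
       y * P * (N * K ^ (n - 1) * k - N * h ^ (n - 1) * d)) / t ^ (n - 1) = A h d + (A K k - A h d)"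
  proof -
    have "(c1 * (X - Z) + w * (u - v)) / T = (c1 * X + w * u) / T - (c1 * Z + w * v) / T" for c1 X Z w u v T :: real
      by (simp add: right_diff_distrib diff_divide_distrib add_divide_distrib)
    then show ?thesis by (simp only: eq Aform)
  qed
  then show ?thesis using low unfolding N_def P_def by simp
qed

text \<open>The extra term on the left, multiplied by \<open>t^(n-1)\<close>, is \<open>p' (K^n - h^n) + p (K^n - h^n)'\<close> for the
stationary profile \<open>h\<close>, hence a derivative.\<close>

lemma energy_density_calibration:
  fixes t h d K k :: real
  assumes n: "2 \<le> n" and t: "0 < t" and h: "0 < h" and d: "0 < d" and K: "0 < K" and k: "0 \<le> k"
    and conv: "convex_on {0<..} \<Phi>"
    and y: "y = t * d / h" and q: "q = sqrt (real n - 1 + y\<^sup>2)" and J: "J = d * (h / t) ^ (n - 1)"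
    and D: "(\<Phi> has_real_derivative D) (at J)"
  shows "ennreal (sqrt (d\<^sup>2 + (real n - 1) * (h / t)\<^sup>2) ^ n + \<Phi> J +
      ((real n - 1) / t * q ^ (n - 2) * (1 - y\<^sup>2) * (K ^ n - h ^ n) +
       (y * q ^ (n - 2) + D / real n) * (real n * K ^ (n - 1) * k - real n * h ^ (n - 1) * d)) / t ^ (n - 1))
    \<le> ennreal (sqrt (k\<^sup>2 + (real n - 1) * (K / t)\<^sup>2) ^ n) + extend_zero \<Phi> (k * (K / t) ^ (n - 1))"
proof -
  define A where "A = sqrt (d\<^sup>2 + (real n - 1) * (h / t)\<^sup>2) ^ n +
      ((real n - 1) / t * q ^ (n - 2) * (1 - y\<^sup>2) * (K ^ n - h ^ n) +
       y * q ^ (n - 2) * (real n * K ^ (n - 1) * k - real n * h ^ (n - 1) * d)) / t ^ (n - 1)"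
  define s where "s = k * (K / t) ^ (n - 1)"
  have J0: "0 < J" unfolding J using d h t by simp
  have s0: "0 \<le> s" unfolding s_def using k K t by simp
  have B: "D * (s - J) = D / real n * (real n * K ^ (n - 1) * k - real n * h ^ (n - 1) * d) / t ^ (n - 1)"
    using n unfolding s_def J power_divide by (simp add: right_diff_distrib diff_divide_distrib mult_ac)
  have "sqrt (d\<^sup>2 + (real n - 1) * (h / t)\<^sup>2) ^ n + \<Phi> J +
      ((real n - 1) / t * q ^ (n - 2) * (1 - y\<^sup>2) * (K ^ n - h ^ n) +
       (y * q ^ (n - 2) + D / real n) * (real n * K ^ (n - 1) * k - real n * h ^ (n - 1) * d)) / t ^ (n - 1) =
      A + (\<Phi> J + D * (s - J))"
    unfolding A_def B by (simp add: distrib_right add_divide_distrib)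
  then have "ennreal (sqrt (d\<^sup>2 + (real n - 1) * (h / t)\<^sup>2) ^ n + \<Phi> J +
      ((real n - 1) / t * q ^ (n - 2) * (1 - y\<^sup>2) * (K ^ n - h ^ n) +
       (y * q ^ (n - 2) + D / real n) * (real n * K ^ (n - 1) * k - real n * h ^ (n - 1) * d)) / t ^ (n - 1)) \<le>
     ennreal A + ennreal (\<Phi> J + D * (s - J))"
    by (simp only: ennreal_add_le)
  also have "\<dots> \<le> ennreal (sqrt (k\<^sup>2 + (real n - 1) * (K / t)\<^sup>2) ^ n) + extend_zero \<Phi> s"
    unfolding A_def
    by (intro add_mono ennreal_leI norm_power_calibration[OF n t h K y q] extend_zero_above_tangent[OF conv D J0 s0])
  finally show ?thesis by (simp only: s_def)
qed

text \<open>The form in which the boundary terms \<open>\<delta> m\<close> are discarded; neither energy has to be finite.\<close>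

lemma le_of_approximate_le:
  fixes e e' :: ennreal
  assumes le: "\<And>m. ennreal (r m + \<delta> m) \<le> e'" and r: "\<And>m. 0 \<le> r m" "(\<lambda>m. ennreal (r m)) \<longlonglongrightarrow> e"
    and \<delta>: "\<delta> \<longlonglongrightarrow> 0"
  shows "e \<le> e'"
proof (cases e')
  case (real E)
  have b: "r m \<le> E - \<delta> m" for m
    using le[of m] real by (auto simp: ennreal_le_iff)
  have "(\<lambda>m. ennreal (E - \<delta> m)) \<longlonglongrightarrow> ennreal (E - 0)" by (intro tendsto_intros tendsto_ennrealI \<delta>)
  then have "e \<le> ennreal (E - 0)"
    by (rule LIMSEQ_le[OF r(2)]) (auto intro!: ennreal_leI b)
  then show ?thesis using real by simp
qed simp

lemma integral_le_nn_integral: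
  assumes "integrable M f"
  shows "ennreal (\<integral>x. f x \<partial>M) \<le> (\<integral>\<^sup>+x. ennreal (f x) \<partial>M)"
proof -
  have i: "integrable M (\<lambda>x. max 0 (f x))" using assms by simp
  have "(\<integral>\<^sup>+x. ennreal (f x) \<partial>M) = (\<integral>\<^sup>+x. ennreal (max 0 (f x)) \<partial>M)"
    by (intro nn_integral_cong) (auto simp: max_def ennreal_neg)
  also have "\<dots> = ennreal (\<integral>x. max 0 (f x) \<partial>M)" using i by (intro nn_integral_eq_integral) auto
  finally show ?thesis using assms i by (auto intro!: ennreal_leI integral_mono)
qed

section \<open>Minimality\<close>

lemma weak_derivative_on_eq:
  assumes "open U" "has_weak_derivative_on h G U"
  shows "AE x in lebesgue. x \<in> U \<longrightarrow> weak_derivative_on U h x = G x"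
proof -
  have "has_weak_derivative_on h (weak_derivative_on U h) U"
    unfolding weak_derivative_on_def by (rule someI[of "\<lambda>G. has_weak_derivative_on h G U"]) (rule assms(2))
  then show ?thesis using weak_derivative_unique[OF assms(1) _ assms(2)] by blast
qed

text \<open>The energy refers to an arbitrarily chosen weak derivative, which agrees with the radial one almost
everywhere. The sign \<open>\<sigma>\<close> affects neither the norm nor, as \<open>\<sigma> ^ n = 1\<close>, the determinant.\<close>

lemma energy_radial:
  fixes h :: "real ^ 'n::finite \<Rightarrow> real ^ 'n"
  assumes G: "has_weak_derivative_on h (\<lambda>x. \<sigma> *\<^sub>R radial_gradient K k x) (annulus R)"
    and \<sigma>: "\<sigma> = 1 \<or> \<sigma> = - 1" "\<sigma> ^ CARD('n) = 1"
  shows "energy \<Phi> R h = (\<integral>\<^sup>+x\<in>annulus R.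
     (ennreal (sqrt ((k (norm x))\<^sup>2 + (real CARD('n) - 1) * (K (norm x) / norm x)\<^sup>2) ^ CARD('n))
       + extend_zero \<Phi> (k (norm x) * (K (norm x) / norm x) ^ (CARD('n) - 1))) \<partial>(lebesgue :: (real ^ 'n) measure))"
  unfolding energy_def
proof (rule nn_integral_cong_AE)
  have eq: "norm (\<sigma> *\<^sub>R radial_gradient K k x) = sqrt ((k (norm x))\<^sup>2 + (real CARD('n) - 1) * (K (norm x) / norm x)\<^sup>2)"
    "det (\<sigma> *\<^sub>R radial_gradient K k x) = k (norm x) * (K (norm x) / norm x) ^ (CARD('n) - 1)"
    if "x \<in> annulus R" for x :: "real ^ 'n"
  proof -
    have x: "x \<noteq> 0" using that by (auto simp: annulus_def)
    show "norm (\<sigma> *\<^sub>R radial_gradient K k x) = sqrt ((k (norm x))\<^sup>2 + (real CARD('n) - 1) * (K (norm x) / norm x)\<^sup>2)"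
      using \<sigma>(1) norm_radial_gradient[OF x, of K k] by auto
    have "det (\<sigma> *\<^sub>R radial_gradient K k x) = \<sigma> * k (norm x) * (\<sigma> * K (norm x) / norm x) ^ (CARD('n) - 1)"
      unfolding radial_gradient_scale[symmetric] by (rule det_radial_gradient[OF x])
    also have "\<dots> = \<sigma> ^ (CARD('n) - 1) * \<sigma> * (k (norm x) * (K (norm x) / norm x) ^ (CARD('n) - 1))"
      by (simp add: power_mult_distrib power_divide)
    also have "\<sigma> ^ (CARD('n) - 1) * \<sigma> = \<sigma> ^ CARD('n)" by (rule power_minus_mult) simp
    finally show "det (\<sigma> *\<^sub>R radial_gradient K k x) = k (norm x) * (K (norm x) / norm x) ^ (CARD('n) - 1)"
      by (simp only: \<sigma>(2) mult_1)
  qed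
  show "AE x in lebesgue. (ennreal (norm (weak_derivative_on (annulus R) h x) ^ CARD('n))
      + extend_zero \<Phi> (det (weak_derivative_on (annulus R) h x))) * indicator (annulus R) x =
     (ennreal (sqrt ((k (norm x))\<^sup>2 + (real CARD('n) - 1) * (K (norm x) / norm x)\<^sup>2) ^ CARD('n))
       + extend_zero \<Phi> (k (norm x) * (K (norm x) / norm x) ^ (CARD('n) - 1))) * indicator (annulus R) x"
    using weak_derivative_on_eq[OF open_annulus G]
  proof eventually_elim
    case (elim x)
    show ?case
    proof (cases "x \<in> annulus R")
      case True
      then have "weak_derivative_on (annulus R) h x = \<sigma> *\<^sub>R radial_gradient K k x" using elim by simp
      then show ?thesis by (simp only: eq[OF True])
    qed simp
  qed
qed

lemma radial_class_energy_profile: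
  fixes h :: "real ^ 'n::finite \<Rightarrow> real ^ 'n"
  assumes h: "h \<in> radial_class R Rs" and R: "1 < R"
  obtains K k where "continuous_on UNIV K" "k \<in> borel_measurable borel" "\<And>t. 0 \<le> k t"
    "\<And>a b. a \<le> b \<Longrightarrow> is_primitive a b K k" "\<And>t. 1 \<le> K t" "K 1 = 1" "K R = Rs"
    "\<And>\<Phi>. energy \<Phi> R h = (\<integral>\<^sup>+x\<in>annulus R.
     (ennreal (sqrt ((k (norm x))\<^sup>2 + (real CARD('n) - 1) * (K (norm x) / norm x)\<^sup>2) ^ CARD('n))
       + extend_zero \<Phi> (k (norm x) * (K (norm x) / norm x) ^ (CARD('n) - 1))) \<partial>(lebesgue :: (real ^ 'n) measure))"
proof -
  obtain \<sigma> K where \<sigma>: "\<sigma> = 1 \<or> \<sigma> = - 1" "\<sigma> ^ CARD('n) = 1" and K: "continuous_on UNIV K" "mono K"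
    and K1: "\<And>t. t \<le> 1 \<Longrightarrow> K t = 1" and KR: "\<And>t. R \<le> t \<Longrightarrow> K t = Rs" and Kge: "\<And>t. 1 \<le> K t"
    and hK: "\<And>x. x \<in> annulus R \<Longrightarrow> h x = \<sigma> *\<^sub>R radial_map K x"
    by (rule radial_class_profile[OF h R]) blast
  obtain G where G: "has_weak_derivative_on h G (annulus R)"
    and Gn: "set_integrable lebesgue (annulus R) (\<lambda>x. norm (G x) ^ CARD('n))"
    using h by (auto simp: radial_class_def sobolev_W1_def)
  have s2: "\<sigma> * \<sigma> = 1" using \<sigma>(1) by auto
  have "has_weak_derivative_on (\<lambda>x. \<sigma> *\<^sub>R h x) (\<lambda>x. \<sigma> *\<^sub>R G x) (annulus R)"
    by (rule has_weak_derivative_on_scaleR[OF G])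
  then have GK: "has_weak_derivative_on (radial_map K) (\<lambda>x. \<sigma> *\<^sub>R G x) (annulus R)"
    by (rule has_weak_derivative_on_cong[rotated]) (simp add: hK s2)
  have "norm (\<sigma> *\<^sub>R G x) = norm (G x)" for x using \<sigma>(1) by auto
  then have GKn: "set_integrable lebesgue (annulus R) (\<lambda>x. norm (\<sigma> *\<^sub>R G x) ^ CARD('n))" using Gn by (simp only:)
  have K0: "0 \<le> K t" for t using Kge[of t] by simp
  have c1: "K t = K 1" if "t \<le> 1" for t using K1[OF that] K1[of 1] by simp
  have cR: "K t = K R" if "R \<le> t" for t using KR[OF that] KR[of R] by simp
  obtain k where k: "k \<in> borel_measurable borel" "\<And>t. 0 \<le> k t" "\<And>a b. a \<le> b \<Longrightarrow> is_primitive a b K k"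
    using weakly_differentiable_radial_profile[OF R K K0 c1 cR GK GKn] by blast
  have "has_weak_derivative_on (radial_map K :: real ^ 'n \<Rightarrow> _) (radial_gradient K k) (annulus R)"
    by (rule radial_map_has_weak_derivative[OF R K(1) k(1)]) (rule k(3))
  then have "has_weak_derivative_on (\<lambda>x. \<sigma> *\<^sub>R radial_map K x :: real ^ 'n) (\<lambda>x. \<sigma> *\<^sub>R radial_gradient K k x) (annulus R)"
    by (rule has_weak_derivative_on_scaleR)
  then have "has_weak_derivative_on h (\<lambda>x. \<sigma> *\<^sub>R radial_gradient K k x) (annulus R)"
    by (rule has_weak_derivative_on_cong[rotated]) (simp add: hK)
  note E = energy_radial[OF this \<sigma>]
  show thesis
    by (rule that[OF K(1) k(1,2,3) Kge K1[OF order_refl] KR[OF order_refl] E])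
qed

text \<open>On a closed shell inside the annulus everything is integrable, and the calibration gives the comparison
up to boundary terms, whatever the energies are. The shells then exhaust the annulus.\<close>

lemma stationary_radial_map_minimizes:
  fixes \<Phi> H dH :: "real \<Rightarrow> real"
  assumes n: "2 \<le> CARD('n::finite)" and R: "1 < R"
    and conv: "convex_on {0<..} \<Phi>" and pos: "\<And>s. 0 < s \<Longrightarrow> 0 < \<Phi> s"
    and d\<Phi>: "\<And>s. 0 < s \<Longrightarrow> (\<Phi> has_real_derivative deriv \<Phi> s) (at s)"
    and H: "continuous_on UNIV H" "continuous_on UNIV dH" "\<And>t. 1 \<le> H t" "H 1 = 1" "H R = Rs"
    and dH: "\<And>t. 1 < t \<Longrightarrow> (H has_real_derivative dH t) (at t)" "\<And>t. 1 < t \<Longrightarrow> 0 < dH t"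
    and y: "\<And>t. y t = t * dH t / H t" and q: "\<And>t. q t = sqrt (real CARD('n) - 1 + (y t)\<^sup>2)"
    and J: "\<And>t. J t = dH t * (H t / t) ^ (CARD('n) - 1)"
    and EL: "\<And>t. 1 < t \<Longrightarrow> ((\<lambda>t. y t * q t ^ (CARD('n) - 2) + deriv \<Phi> (J t) / real CARD('n)) has_real_derivative
        (real CARD('n) - 1) / t * q t ^ (CARD('n) - 2) * (1 - (y t)\<^sup>2)) (at t)"
    and h: "h \<in> (radial_class R Rs :: (real ^ 'n \<Rightarrow> real ^ 'n) set)"
  shows "energy \<Phi> R (radial_map H :: real ^ 'n \<Rightarrow> real ^ 'n) \<le> energy \<Phi> R h"
proof -
  define n where "n = CARD('n)"
  note defn = n_def[symmetric]
  note n2 = n[unfolded defn] and q' = q[unfolded defn] and J' = J[unfolded defn] and EL' = EL[unfolded defn]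
  define p where "p t = y t * q t ^ (n - 2) + deriv \<Phi> (J t) / real n" for t
  define p' where "p' t = (real n - 1) / t * q t ^ (n - 2) * (1 - (y t)\<^sup>2)" for t
  have p: "(p has_real_derivative p' t) (at t)" if "1 < t" for t
    using EL'[OF that] unfolding p_def[abs_def] p'_def .
  have Hpos: "0 < H t" for t using H(3)[of t] by simp
  obtain K k where K: "continuous_on UNIV K" and k: "k \<in> borel_measurable borel" "\<And>t. 0 \<le> k t"
    and Kk: "\<And>a b. a \<le> b \<Longrightarrow> is_primitive a b K k" and Kge: "\<And>t. 1 \<le> K t" and Kb: "K 1 = 1" "K R = Rs"
    and eh: "energy \<Phi> R h = (\<integral>\<^sup>+x\<in>annulus R.
     (ennreal (sqrt ((k (norm x))\<^sup>2 + (real n - 1) * (K (norm x) / norm x)\<^sup>2) ^ n)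
       + extend_zero \<Phi> (k (norm x) * (K (norm x) / norm x) ^ (n - 1))) \<partial>(lebesgue :: (real ^ 'n) measure))"
    unfolding n_def by (rule radial_class_energy_profile[OF h R]) blast
  have Kpos: "0 < K t" for t using Kge[of t] by simp
  define L where "L t = sqrt ((dH t)\<^sup>2 + (real n - 1) * (H t / t)\<^sup>2) ^ n + \<Phi> (J t)" for t
  have Jpos: "0 < J t" if "1 < t" for t
    unfolding J' using dH(2)[OF that] Hpos[of t] that by simp
  have Hp: "is_primitive a b H dH" if "1 < a" for a b
    by (rule is_primitive_C1) (use that dH(1) H(2) in \<open>auto intro: has_field_derivative_at_within continuous_on_subset\<close>)
  have dHm: "dH \<in> borel_measurable borel" by (rule borel_measurable_continuous_onI[OF H(2)])
  have "has_weak_derivative_on (radial_map H :: real ^ 'n \<Rightarrow> _) (radial_gradient H dH) (annulus R)"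
    by (rule radial_map_has_weak_derivative[OF R H(1) dHm]) (rule Hp)
  then have "has_weak_derivative_on (radial_map H :: real ^ 'n \<Rightarrow> _) (\<lambda>x. 1 *\<^sub>R radial_gradient H dH x) (annulus R)" by simp
  note eH0 = energy_radial[OF this, of \<Phi>]
  have eH: "energy \<Phi> R (radial_map H :: real ^ 'n \<Rightarrow> _) = (\<integral>\<^sup>+x\<in>annulus R. ennreal (L (norm x)) \<partial>(lebesgue :: (real ^ 'n) measure))"
  proof -
    have "energy \<Phi> R (radial_map H :: real ^ 'n \<Rightarrow> _) = (\<integral>\<^sup>+x\<in>annulus R.
     (ennreal (sqrt ((dH (norm x))\<^sup>2 + (real n - 1) * (H (norm x) / norm x)\<^sup>2) ^ n)
       + extend_zero \<Phi> (dH (norm x) * (H (norm x) / norm x) ^ (n - 1))) \<partial>(lebesgue :: (real ^ 'n) measure))"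
      using eH0 unfolding n_def by simp
    also have "\<dots> = (\<integral>\<^sup>+x\<in>annulus R. ennreal (L (norm x)) \<partial>(lebesgue :: (real ^ 'n) measure))"
    proof (rule nn_integral_cong)
      fix x :: "real ^ 'n"
      show "(ennreal (sqrt ((dH (norm x))\<^sup>2 + (real n - 1) * (H (norm x) / norm x)\<^sup>2) ^ n)
       + extend_zero \<Phi> (dH (norm x) * (H (norm x) / norm x) ^ (n - 1))) * indicator (annulus R) x =
        ennreal (L (norm x)) * indicator (annulus R) x"
      proof (cases "x \<in> annulus R")
        case True
        then have t: "1 < norm x" by (simp add: annulus_def)
        have n1: "0 \<le> real n - 1" using n2 by simp
        have "0 < dH (norm x) * (H (norm x) / norm x) ^ (n - 1)" using Jpos[OF t] unfolding J' .
        moreover have "0 \<le> sqrt ((dH (norm x))\<^sup>2 + (real n - 1) * (H (norm x) / norm x)\<^sup>2) ^ n"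
        proof -
          have "0 \<le> (dH (norm x))\<^sup>2 + (real n - 1) * (H (norm x) / norm x)\<^sup>2" using n1 by simp
          then show ?thesis by (intro zero_le_power) (rule real_sqrt_ge_zero)
        qed
        ultimately show ?thesis
          unfolding L_def J' extend_zero_def using pos[of "dH (norm x) * (H (norm x) / norm x) ^ (n - 1)"]
          by (simp add: ennreal_plus less_imp_le)
      qed simp
    qed
    finally show ?thesis .
  qed
  have Lpos: "0 \<le> L t" if "1 < t" for t
  proof -
    have "0 \<le> (dH t)\<^sup>2 + (real n - 1) * (H t / t)\<^sup>2" using n2 by simp
    then have "0 \<le> sqrt ((dH t)\<^sup>2 + (real n - 1) * (H t / t)\<^sup>2) ^ n"
      by (intro zero_le_power) (rule real_sqrt_ge_zero)
    then show ?thesis unfolding L_def using pos[OF Jpos[OF that]] by linarith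
  qed
  have Jc: "continuous_on {1<..} J"
  proof -
    have "continuous_on {1<..} (\<lambda>t. dH t * (H t / t) ^ (n - 1))"
      by (intro continuous_intros continuous_on_subset[OF H(1)] continuous_on_subset[OF H(2)]) auto
    then show ?thesis by (simp add: J'[abs_def])
  qed
  have \<Phi>c: "continuous_on {0<..} \<Phi>"
  proof (rule DERIV_continuous_on)
    show "(\<Phi> has_field_derivative deriv \<Phi> s) (at s within {0<..})" if "s \<in> {0<..}" for s
      using d\<Phi>[of s] that by (simp add: has_field_derivative_at_within)
  qed
  have Lc: "continuous_on {1<..} L"
  proof -
    have "continuous_on {1<..} (\<lambda>t. \<Phi> (J t))"
      by (rule continuous_on_compose2[OF \<Phi>c Jc]) (use Jpos in auto)
    then have "continuous_on {1<..} (\<lambda>t. sqrt ((dH t)\<^sup>2 + (real n - 1) * (H t / t)\<^sup>2) ^ n + \<Phi> (J t))"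
      by (intro continuous_on_add) (intro continuous_intros continuous_on_subset[OF H(1)] continuous_on_subset[OF H(2)]; auto)
    then show ?thesis by (simp add: L_def[abs_def])
  qed
  have yc: "continuous_on {1..R} y"
  proof -
    have "continuous_on {1..R} (\<lambda>t. t * dH t / H t)"
      using Hpos by (intro continuous_intros continuous_on_subset[OF H(1)] continuous_on_subset[OF H(2)]) (auto simp: less_imp_neq[symmetric])
    then show ?thesis by (simp add: y[abs_def])
  qed
  have qc: "continuous_on {1..R} q"
  proof -
    have "continuous_on {1..R} (\<lambda>t. sqrt (real n - 1 + (y t)\<^sup>2))" by (intro continuous_intros yc)
    then show ?thesis by (simp add: q'[abs_def])
  qed
  have p'c: "continuous_on {1..R} p'"
    unfolding p'_def[abs_def] by (intro continuous_intros yc qc) auto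
  \<comment> \<open>\<open>p\<close> involves \<open>deriv \<Phi>\<close> near \<open>0\<close>, but \<open>p'\<close> is continuous up to the boundary\<close>
  obtain C where C: "\<And>t. 1 < t \<Longrightarrow> t < R \<Longrightarrow> \<bar>p t\<bar> \<le> C"
  proof -
    have "compact (p' ` {1..R})" by (intro compact_continuous_image p'c) auto
    then have "bounded (p' ` {1..R})" by (rule compact_imp_bounded)
    then obtain B where B: "\<forall>z\<in>p' ` {1..R}. norm z \<le> B" by (auto simp only: bounded_iff)
    then have B': "\<bar>p' t\<bar> \<le> B" if "1 \<le> t" "t \<le> R" for t using that by auto
    define m where "m = (1 + R) / 2"
    have m: "1 < m" "m < R" using R by (auto simp: m_def)
    have B0: "0 \<le> B" using B'[of m] m by auto
    have "\<bar>p t\<bar> \<le> \<bar>p m\<bar> + B * R" if t: "1 < t" "t < R" for t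
    proof -
      have "norm (p t - p m) \<le> B * norm (t - m)"
      proof (rule field_differentiable_bound[of "{1<..<R}" p p' B])
        show "(p has_field_derivative p' z) (at z within {1<..<R})" if "z \<in> {1<..<R}" for z
          using p[of z] that by (auto intro: has_field_derivative_at_within)
        show "norm (p' z) \<le> B" if "z \<in> {1<..<R}" for z using B'[of z] that by auto
      qed (use t m in auto)
      then have "\<bar>p t - p m\<bar> \<le> B * \<bar>t - m\<bar>" by simp
      also have "\<dots> \<le> B * R" using t m B0 by (intro mult_left_mono) auto
      finally show ?thesis by linarith
    qed
    then show thesis by (rule that)
  qed
  \<comment> \<open>the density of \<open>p (K^n - H^n)\<close>\<close>
  define D where "D t = p' t * (K t ^ n - H t ^ n) + p t * (real n * K t ^ (n - 1) * k t - real n * H t ^ (n - 1) * dH t)" for t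
  have Dp: "is_primitive a b (\<lambda>t. p t * (K t ^ n - H t ^ n)) D" if ab: "1 < a" "a \<le> b" "b < R" for a b
  proof -
    have "is_primitive a b p p'"
      by (rule is_primitive_C1)
        (use ab p in \<open>auto intro: has_field_derivative_at_within continuous_on_subset[OF p'c]\<close>)
    moreover have "is_primitive a b (\<lambda>t. K t ^ n - H t ^ n) (\<lambda>t. real n * K t ^ (n - 1) * k t - real n * H t ^ (n - 1) * dH t)"
      by (intro is_primitive_diff is_primitive_power Kk Hp ab)
    ultimately show ?thesis unfolding D_def[abs_def] by (rule is_primitive_mult)
  qed
  define c where "c = sphere_area n 1"
  have area: "sphere_area n t = c * t ^ (n - 1)" if "0 \<le> t" for t using that by (simp add: c_def sphere_area_def)
  define r where "r a b = (\<integral>t. sphere_area n t * (indicator {a..b} t * L t) \<partial>lborel)" for a b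
  define \<delta> where "\<delta> a b = c * (p b * (K b ^ n - H b ^ n) - p a * (K a ^ n - H a ^ n))" for a b
  have Lm: "(\<lambda>t. indicator {a..b} t * L t) \<in> borel_measurable borel" if "1 < a" for a b
  proof -
    have "continuous_on {a..b} L" by (rule continuous_on_subset[OF Lc]) (use that in auto)
    then show ?thesis using borel_measurable_continuous_on_indicator[of "{a..b}" L] by simp
  qed
  have Li: "integrable lborel (\<lambda>t. sphere_area n t * (indicator {a..b} t * L t))" if "1 < a" for a b
  proof -
    have "continuous_on {a..b} (\<lambda>t. c * t ^ (n - 1) * L t)"
      using that by (intro continuous_intros continuous_on_subset[OF Lc]) auto
    then have "integrable lborel (\<lambda>t. indicator {a..b} t *\<^sub>R (c * t ^ (n - 1) * L t))"
      by (rule borel_integrable_atLeastAtMost'[unfolded set_integrable_def])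
    moreover have "(\<lambda>t. indicator {a..b} t *\<^sub>R (c * t ^ (n - 1) * L t)) = (\<lambda>t. sphere_area n t * (indicator {a..b} t * L t))"
      using that area by (auto simp: fun_eq_iff indicator_def)
    ultimately show ?thesis by simp
  qed
  have r0: "0 \<le> r a b" if "1 < a" for a b
    unfolding r_def using that by (intro integral_nonneg_AE AE_I2) (auto simp: indicator_def sphere_area_nonneg Lpos)
  have shell: "(\<integral>\<^sup>+x. ennreal (indicator {a..b} (norm x) * L (norm x)) \<partial>(lebesgue :: (real ^ 'n) measure)) = ennreal (r a b)"
    if a: "1 < a" for a b
  proof -
    have "(\<integral>\<^sup>+x. ennreal (indicator {a..b} (norm x) * L (norm x)) \<partial>(lebesgue :: (real ^ 'n) measure)) =
        (\<integral>\<^sup>+t. ennreal (sphere_area n t) * ennreal (indicator {a..b} t * L t) \<partial>lborel)"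
      using nn_integral_norm[where 'a = "real ^ 'n", of "\<lambda>t. ennreal (indicator {a..b} t * L t)"] Lm[OF a, of b]
      by (simp add: n_def)
    also have "\<dots> = (\<integral>\<^sup>+t. ennreal (sphere_area n t * (indicator {a..b} t * L t)) \<partial>lborel)"
      using a Lpos by (intro nn_integral_cong) (auto simp: ennreal_mult sphere_area_nonneg indicator_def)
    also have "\<dots> = ennreal (r a b)"
      unfolding r_def using a Lpos
      by (intro nn_integral_eq_integral Li AE_I2) (auto simp: sphere_area_nonneg indicator_def)
    finally show ?thesis .
  qed
  have lower: "ennreal (r a b + \<delta> a b) \<le> energy \<Phi> R h" if ab: "1 < a" "a \<le> b" "b < R" for a b
  proof -
    define f where "f t = indicator {a..b} t * L t + indicator {a..b} t * (D t / t ^ (n - 1))" for t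
    have Di: "integrable lborel (\<lambda>t. indicator {a..b} t * D t)"
      using Dp[OF ab] by (simp add: is_primitive_def set_integrable_def)
    have fm: "f \<in> borel_measurable borel"
    proof -
      have "(\<lambda>t. (indicator {a..b} t * D t) / t ^ (n - 1)) \<in> borel_measurable borel"
        using borel_measurable_integrable[OF Di] by simp
      then show ?thesis unfolding f_def[abs_def] using Lm[OF ab(1), of b] by simp
    qed
    have feq: "sphere_area n t * f t = sphere_area n t * (indicator {a..b} t * L t) + c * (indicator {a..b} t * D t)" for t
      using ab area[of t] by (auto simp: f_def indicator_def algebra_simps)
    have fi: "integrable lborel (\<lambda>t. sphere_area n t * f t)"
      unfolding feq using Li[OF ab(1), of b] Di by simp
    have fval: "(\<integral>t. sphere_area n t * f t \<partial>lborel) = r a b + \<delta> a b"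
    proof -
      have "(\<integral>t. sphere_area n t * f t \<partial>lborel) = r a b + c * (\<integral>t. indicator {a..b} t * D t \<partial>lborel)"
        unfolding feq r_def using Li[OF ab(1), of b] Di by simp
      also have "(\<integral>t. indicator {a..b} t * D t \<partial>lborel) = p b * (K b ^ n - H b ^ n) - p a * (K a ^ n - H a ^ n)"
        using Dp[OF ab] ab(2) by (simp add: is_primitive_def set_lebesgue_integral_def)
      finally show ?thesis by (simp add: \<delta>_def)
    qed
    have fn: "integrable lebesgue (\<lambda>x :: real ^ 'n. f (norm x))"
      using fi integrable_norm_iff[OF fm, where 'a = "real ^ 'n"] by (simp add: n_def)
    have "r a b + \<delta> a b = (\<integral>x. f (norm x) \<partial>(lebesgue :: (real ^ 'n) measure))"
      using fval integral_norm[OF fm, where 'a = "real ^ 'n"] by (simp add: n_def)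
    then have "ennreal (r a b + \<delta> a b) \<le> (\<integral>\<^sup>+x. ennreal (f (norm x)) \<partial>(lebesgue :: (real ^ 'n) measure))"
      using integral_le_nn_integral[OF fn] by simp
    also have "\<dots> \<le> energy \<Phi> R h"
      unfolding eh
    proof (rule nn_integral_mono)
      fix x :: "real ^ 'n"
      define t where "t = norm x"
      show "ennreal (f (norm x)) \<le> (ennreal (sqrt ((k (norm x))\<^sup>2 + (real n - 1) * (K (norm x) / norm x)\<^sup>2) ^ n)
         + extend_zero \<Phi> (k (norm x) * (K (norm x) / norm x) ^ (n - 1))) * indicator (annulus R) x"
      proof (cases "a \<le> t \<and> t \<le> b")
        case True
        then have t: "1 < t" "t < R" "0 < t" using ab by auto
        have "f t = sqrt ((dH t)\<^sup>2 + (real n - 1) * (H t / t)\<^sup>2) ^ n + \<Phi> (J t) +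
          ((real n - 1) / t * q t ^ (n - 2) * (1 - (y t)\<^sup>2) * (K t ^ n - H t ^ n) +
           (y t * q t ^ (n - 2) + deriv \<Phi> (J t) / real n) * (real n * K t ^ (n - 1) * k t - real n * H t ^ (n - 1) * dH t)) / t ^ (n - 1)"
          using True by (simp add: f_def L_def D_def p_def p'_def)
        then have "ennreal (f t) \<le> ennreal (sqrt ((k t)\<^sup>2 + (real n - 1) * (K t / t)\<^sup>2) ^ n) + extend_zero \<Phi> (k t * (K t / t) ^ (n - 1))"
          using energy_density_calibration[OF n2 t(3) Hpos dH(2)[OF t(1)] Kpos k(2) conv y q' J' d\<Phi>[OF Jpos[OF t(1)]]]
          by (simp only:)
        then show ?thesis using t by (simp add: t_def annulus_def)
      next
        case False
        then have "f (norm x) = 0" by (auto simp: f_def t_def)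
        then show ?thesis by simp
      qed
    qed
    finally show ?thesis .
  qed
  \<comment> \<open>the shells \<open>1 + w m \<le> |x| \<le> R - w m\<close> increase to the annulus; the factor \<open>1/3\<close> keeps them nonempty\<close>
  define w where "w m = (R - 1) * inverse (real (Suc m)) / 3" for m
  have w0: "w \<longlonglongrightarrow> 0"
  proof -
    have "w \<longlonglongrightarrow> (R - 1) * 0 / 3" unfolding w_def by (intro tendsto_intros LIMSEQ_inverse_real_of_nat) simp
    then show ?thesis by simp
  qed
  have w: "0 < w m" "w m \<le> (R - 1) / 3" for m
  proof -
    show "0 < w m" using R by (simp add: w_def)
    have "(R - 1) * inverse (real (Suc m)) \<le> (R - 1) * 1"
      using R by (intro mult_left_mono) (auto simp: inverse_le_1_iff)
    then show "w m \<le> (R - 1) / 3" by (simp add: w_def)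
  qed
  have wdec: "w m \<le> w m'" if "m' \<le> m" for m m'
    unfolding w_def using R that by (intro divide_right_mono mult_left_mono le_imp_inverse_le) auto
  define a b where "a m = 1 + w m" and "b m = R - w m" for m
  have ab: "1 < a m" "a m \<le> b m" "b m < R" for m using w[of m] by (auto simp: a_def b_def)
  show ?thesis
  proof (rule le_of_approximate_le[of "\<lambda>m. r (a m) (b m)" "\<lambda>m. \<delta> (a m) (b m)"])
    show "ennreal (r (a m) (b m) + \<delta> (a m) (b m)) \<le> energy \<Phi> R h" for m by (rule lower[OF ab])
    show "0 \<le> r (a m) (b m)" for m by (rule r0[OF ab(1)])
    show "(\<lambda>m. ennreal (r (a m) (b m))) \<longlonglongrightarrow> energy \<Phi> R (radial_map H :: real ^ 'n \<Rightarrow> _)"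
      unfolding eH shell[OF ab(1), symmetric]
    proof (rule nn_integral_LIMSEQ)
      show "incseq (\<lambda>m (x :: real ^ 'n). ennreal (indicator {a m..b m} (norm x) * L (norm x)))"
      proof (rule incseq_SucI, rule le_funI)
        fix m and x :: "real ^ 'n"
        have "{a m..b m} \<subseteq> {a (Suc m)..b (Suc m)}" using wdec[of m "Suc m"] by (auto simp: a_def b_def)
        then show "ennreal (indicator {a m..b m} (norm x) * L (norm x)) \<le> ennreal (indicator {a (Suc m)..b (Suc m)} (norm x) * L (norm x))"
          using Lpos[of "norm x"] ab(1)[of "Suc m"] by (auto intro!: ennreal_leI simp: indicator_def)
      qed
      show "(\<lambda>x :: real ^ 'n. ennreal (indicator {a m..b m} (norm x) * L (norm x))) \<in> borel_measurable lebesgue" for m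
        by (rule measurable_compose[OF measurable_compose[OF measurable_norm_lebesgue Lm[OF ab(1)[of m], of "b m"]] measurable_ennreal])
      show "(\<lambda>m. ennreal (indicator {a m..b m} (norm x) * L (norm x))) \<longlonglongrightarrow> ennreal (L (norm x)) * indicator (annulus R) x"
        for x :: "real ^ 'n"
      proof (cases "x \<in> annulus R")
        case True
        then have "0 < min (norm x - 1) (R - norm x)" by (simp add: annulus_def)
        then have "\<forall>\<^sub>F m in sequentially. w m < min (norm x - 1) (R - norm x)"
          using w0 by (intro order_tendstoD(2)[of w 0]) auto
        then have "\<forall>\<^sub>F m in sequentially. ennreal (indicator {a m..b m} (norm x) * L (norm x)) = ennreal (L (norm x))"
          by eventually_elim (auto simp: a_def b_def indicator_def)
        then show ?thesis using True by (simp add: tendsto_eventually)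
      next
        case False
        then have "norm x \<notin> {a m..b m}" for m using ab[of m] by (auto simp: annulus_def)
        then show ?thesis using False by simp
      qed
    qed
    have van: "(\<lambda>m. p (g m) * (K (g m) ^ n - H (g m) ^ n)) \<longlonglongrightarrow> 0"
      if g: "g \<longlonglongrightarrow> e" "\<And>m. 1 < g m" "\<And>m. g m < R" and e: "K e = H e" for g e
    proof -
      have "(\<lambda>m. K (g m) ^ n - H (g m) ^ n) \<longlonglongrightarrow> K e ^ n - H e ^ n"
        by (intro tendsto_intros continuous_on_tendsto_compose[OF K g(1)] continuous_on_tendsto_compose[OF H(1) g(1)]) auto
      then have "(\<lambda>m. K (g m) ^ n - H (g m) ^ n) \<longlonglongrightarrow> 0" using e by simp
      moreover have "Bseq (\<lambda>m. p (g m))" using C g by (intro BseqI'[of _ C]) auto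
      ultimately have "(\<lambda>m. (K (g m) ^ n - H (g m) ^ n) * p (g m)) \<longlonglongrightarrow> 0"
        by (intro lim_null_mult_right_bounded[where B = C]) (use C g in \<open>auto intro: always_eventually\<close>)
      then show ?thesis by (simp add: mult.commute)
    qed
    have al: "a \<longlonglongrightarrow> 1 + 0" and bl: "b \<longlonglongrightarrow> R - 0"
      unfolding a_def b_def by (intro tendsto_intros w0)+
    have "(\<lambda>m. c * (p (b m) * (K (b m) ^ n - H (b m) ^ n) - p (a m) * (K (a m) ^ n - H (a m) ^ n))) \<longlonglongrightarrow> c * (0 - 0)"
    proof (intro tendsto_intros)
      show "(\<lambda>m. p (b m) * (K (b m) ^ n - H (b m) ^ n)) \<longlonglongrightarrow> 0"
        by (rule van[of _ R]) (use bl ab H(5) Kb in \<open>auto intro: less_le_trans\<close>)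
      show "(\<lambda>m. p (a m) * (K (a m) ^ n - H (a m) ^ n)) \<longlonglongrightarrow> 0"
        by (rule van[of _ 1]) (use al ab H(4) Kb in \<open>auto intro: le_less_trans\<close>)
    qed
    then show "(\<lambda>m. \<delta> (a m) (b m)) \<longlonglongrightarrow> 0" by (simp add: \<delta>_def)
  qed
qed

lemma set_integrable_annulus_bounded:
  fixes f :: "real ^ 'n::finite \<Rightarrow> real"
  assumes [measurable]: "f \<in> borel_measurable borel" and le: "\<And>x. x \<in> annulus R \<Longrightarrow> \<bar>f x\<bar> \<le> C"
  shows "set_integrable lebesgue (annulus R) f"
proof -
  let ?A = "annulus R :: (real ^ 'n) set"
  have A [measurable]: "?A \<in> sets borel" using open_annulus[of R, where 'n = 'n] by (rule borel_open)
  have "bounded ?A" by (rule bounded_subset[of "cball 0 R"]) (auto simp: annulus_def)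
  then have fin: "emeasure lborel ?A < \<infinity>" using emeasure_bounded_finite[of ?A] by simp
  have "integrable lborel (\<lambda>x. C * indicator ?A x :: real)"
    using fin A by (intro integrable_mult_right integrable_real_indicator) auto
  then have "integrable lborel (\<lambda>x. indicator ?A x *\<^sub>R f x)"
  proof (rule Bochner_Integration.integrable_bound)
    have "norm (indicator ?A x *\<^sub>R f x) \<le> norm (C * indicator ?A x :: real)" for x
      using le[of x] by (auto simp: indicator_def)
    then show "AE x in lborel. norm (indicator ?A x *\<^sub>R f x) \<le> norm (C * indicator ?A x :: real)" by simp
  qed measurable
  then show ?thesis unfolding set_integrable_def by (subst integrable_completion) auto
qed

lemma C1_radial_map_in_sobolev_W1:
  fixes H dH :: "real \<Rightarrow> real"
  assumes R: "1 < R" and H: "continuous_on UNIV H" "continuous_on UNIV dH"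
    and dH: "\<And>t. 1 < t \<Longrightarrow> (H has_real_derivative dH t) (at t)"
  shows "(radial_map H :: real ^ 'n::finite \<Rightarrow> _) \<in> sobolev_W1 CARD('n) (annulus R)"
proof -
  have Hm: "H \<in> borel_measurable borel" and dHm: "dH \<in> borel_measurable borel"
    by (rule borel_measurable_continuous_onI[OF H(1)] borel_measurable_continuous_onI[OF H(2)])+
  have Hp: "is_primitive a b H dH" if "1 < a" for a b
    by (rule is_primitive_C1) (use that dH H(2) in \<open>auto intro: has_field_derivative_at_within continuous_on_subset\<close>)
  have bd: "\<exists>C. \<forall>t\<in>{1..R}. \<bar>f t\<bar> \<le> C" if "continuous_on {1..R} f" for f :: "real \<Rightarrow> real"
  proof -
    have "bounded (f ` {1..R})" using that by (intro compact_imp_bounded compact_continuous_image) auto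
    then show ?thesis by (auto simp: bounded_iff)
  qed
  have G: "has_weak_derivative_on (radial_map H :: real ^ 'n \<Rightarrow> _) (radial_gradient H dH) (annulus R)"
    by (rule radial_map_has_weak_derivative[OF R H(1) dHm]) (rule Hp)
  have c1: "continuous_on {1..R} (\<lambda>t. \<bar>H t\<bar> ^ CARD('n))"
    by (intro continuous_intros continuous_on_subset[OF H(1)]) auto
  obtain C1 where C1: "\<forall>t\<in>{1..R}. \<bar>\<bar>H t\<bar> ^ CARD('n)\<bar> \<le> C1" using bd[OF c1] by blast
  have 1: "set_integrable lebesgue (annulus R) (\<lambda>x :: real ^ 'n. norm (radial_map H x) ^ CARD('n))"
  proof (rule set_integrable_annulus_bounded[where C = C1])
    show "(\<lambda>x :: real ^ 'n. norm (radial_map H x) ^ CARD('n)) \<in> borel_measurable borel"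
      using borel_measurable_radial_map[OF Hm] by measurable
    show "\<bar>norm (radial_map H x) ^ CARD('n)\<bar> \<le> C1" if "x \<in> annulus R" for x :: "real ^ 'n"
    proof -
      have x: "x \<noteq> 0" "norm x \<in> {1..R}" using that by (auto simp: annulus_def)
      then show ?thesis using C1 unfolding norm_radial_map[OF x(1)] by blast
    qed
  qed
  define g where "g t = sqrt ((dH t)\<^sup>2 + (real CARD('n) - 1) * (H t / t)\<^sup>2) ^ CARD('n)" for t
  have c2: "continuous_on {1..R} g"
    unfolding g_def by (intro continuous_intros continuous_on_subset[OF H(1)] continuous_on_subset[OF H(2)]) auto
  obtain C2 where C2: "\<forall>t\<in>{1..R}. \<bar>g t\<bar> \<le> C2" using bd[OF c2] by blast
  have 2: "set_integrable lebesgue (annulus R) (\<lambda>x :: real ^ 'n. norm (radial_gradient H dH x) ^ CARD('n))"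
  proof (rule set_integrable_annulus_bounded[where C = C2])
    show "(\<lambda>x :: real ^ 'n. norm (radial_gradient H dH x) ^ CARD('n)) \<in> borel_measurable borel"
      using borel_measurable_radial_gradient[OF Hm dHm] by measurable
    show "\<bar>norm (radial_gradient H dH x) ^ CARD('n)\<bar> \<le> C2" if "x \<in> annulus R" for x :: "real ^ 'n"
    proof -
      have x: "x \<noteq> 0" "norm x \<in> {1..R}" using that by (auto simp: annulus_def)
      then show ?thesis using C2 unfolding norm_radial_gradient[OF x(1)] g_def by blast
    qed
  qed
  show ?thesis unfolding sobolev_W1_def using G 1 2 by blast
qed

text \<open>The weak derivative that enters the energy is chosen by a predicate that only sees the map on the
annulus.\<close>

lemma energy_cong:
  fixes h h' :: "real ^ 'n::finite \<Rightarrow> real ^ 'n"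
  assumes "\<And>x. x \<in> annulus R \<Longrightarrow> h x = h' x"
  shows "energy \<Phi> R h = energy \<Phi> R h'"
proof -
  have "has_weak_derivative_on h G (annulus R) \<longleftrightarrow> has_weak_derivative_on h' G (annulus R)" for G
    using has_weak_derivative_on_cong[of "annulus R" h h'] has_weak_derivative_on_cong[of "annulus R" h' h] assms by auto
  then have "weak_derivative_on (annulus R) h = weak_derivative_on (annulus R) h'"
    by (simp add: weak_derivative_on_def)
  then show ?thesis by (simp add: energy_def)
qed

theorem theorem1p3:
  fixes \<Phi> H dH :: "real \<Rightarrow> real" and \<alpha> R Rs lam :: real
  assumes n: "CARD('n::finite) \<ge> 2"
    and Phi_C3: "\<And>k. k < 3 \<Longrightarrow> (deriv ^^ k) \<Phi> differentiable_on {0<..}"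
      "continuous_on {0<..} ((deriv ^^ 3) \<Phi>)"
    and Phi_pos: "\<And>s. s > 0 \<Longrightarrow> \<Phi> s > 0"
    and Phi_convex: "convex_on {0<..} \<Phi>"
    and Phi_dd_pos: "\<And>s. s > 0 \<Longrightarrow> (deriv ^^ 2) \<Phi> s > 0"
    and chi_lim: "((\<lambda>s. 1 / (deriv ^^ 2) \<Phi> s) \<longlongrightarrow> \<alpha>) (at_right 0)" "\<alpha> \<ge> 0"
    and chi_deriv_lim: "\<exists>\<beta>. (deriv (\<lambda>s. 1 / (deriv ^^ 2) \<Phi> s) \<longlongrightarrow> \<beta>) (at_right 0)"
    and R: "R > 1"
    and Rs: "Rs > 1" "Rs \<ge> R_circ CARD('n) \<Phi> R"
    and H_ode: "solves_radial_ode CARD('n) \<Phi> H dH"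
    and H_bv: "H 1 = 1" "H R = Rs"
    and dH: "dH 1 = lam" "lam \<ge> 0" "\<And>t. t > 1 \<Longrightarrow> dH t > 0"
  shows "radial_map H \<in> (radial_class R Rs :: (real ^ 'n \<Rightarrow> real ^ 'n) set) \<and>
    (\<forall>h \<in> (radial_class R Rs :: (real ^ 'n \<Rightarrow> real ^ 'n) set).
       energy \<Phi> R (radial_map H :: real ^ 'n \<Rightarrow> real ^ 'n) \<le> energy \<Phi> R h)"
proof -
  let ?n = "CARD('n)"
  let ?F = "\<lambda>t. (H t - t * dH t) * M_coeff ?n \<Phi> t (H t) (dH t)"
  have der: "(((deriv ^^ k) \<Phi>) has_real_derivative (deriv ^^ Suc k) \<Phi> s) (at s)" if "k < 3" "0 < s" for k s
  proof -
    have "(deriv ^^ k) \<Phi> differentiable at s"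
      using Phi_C3(1)[OF that(1)] that(2) by (simp add: differentiable_on_eq_differentiable_at)
    then show ?thesis by (simp add: DERIV_deriv_iff_real_differentiable)
  qed
  have d1: "(\<Phi> has_real_derivative deriv \<Phi> s) (at s)" if "0 < s" for s using der[of 0 s] that by simp
  have d2: "(deriv \<Phi> has_real_derivative (deriv ^^ 2) \<Phi> s) (at s)" if "0 < s" for s
    using der[of 1 s] that by (simp add: numeral_2_eq_2)
  have ode: "0 \<le> dH t" "(H has_real_derivative dH t) (at t within {1..})" "(dH has_real_derivative ?F t) (at t within {1..})"
    if "1 \<le> t" for t using H_ode that by (auto simp: solves_radial_ode_def)
  have Hc1: "continuous_on {1..} H" by (rule DERIV_continuous_on, rule ode(2)) simp
  have dHc1: "continuous_on {1..} dH" 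
  proof (rule DERIV_continuous_on)
    show "(dH has_real_derivative ?F t) (at t within {1..})" if "t \<in> {1..}" for t
      by (rule ode(3)) (use that in simp)
  qed
  have ode': "(H has_real_derivative dH t) (at t)" "(dH has_real_derivative ?F t) (at t)" if "1 < t" for t
  proof -
    have "at t within {1..} = at t" by (rule at_within_interior) (use that in simp)
    then show "(H has_real_derivative dH t) (at t)" "(dH has_real_derivative ?F t) (at t)"
      using ode(2)[of t] ode(3)[of t] that by (simp_all only: less_imp_le)
  qed
  have mono: "H s < H t" if "1 \<le> s" "s < t" for s t
  proof (rule DERIV_pos_imp_increasing_open[OF that(2)])
    show "\<exists>z. DERIV H x :> z \<and> 0 < z" if "s < x" "x < t" for x
      using ode'(1)[of x] dH(3)[of x] that \<open>1 \<le> s\<close> by auto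
    show "continuous_on {s..t} H" by (rule continuous_on_subset[OF Hc1]) (use that in auto)
  qed
  have Hge: "1 \<le> H t" if "1 \<le> t" for t using mono[of 1 t] H_bv(1) that by (cases "t = 1") auto
  \<comment> \<open>the solution is continued to the line by its value at \<open>1\<close>, which changes nothing on the annulus\<close>
  define Hc dHc where "Hc t = H (max 1 t)" and "dHc t = dH (max 1 t)" for t
  have eq: "Hc t = H t" "dHc t = dH t" if "1 \<le> t" for t using that by (simp_all add: Hc_def dHc_def max_def)
  have Hc: "continuous_on UNIV Hc" "continuous_on UNIV dHc"
    unfolding Hc_def dHc_def
    by (rule continuous_on_compose2[OF Hc1] continuous_on_compose2[OF dHc1]; auto intro!: continuous_intros)+
  have Hc': "(Hc has_real_derivative dHc t) (at t)"
    "(dHc has_real_derivative (Hc t - t * dHc t) * M_coeff ?n \<Phi> t (Hc t) (dHc t)) (at t)" if t: "1 < t" for t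
  proof -
    have "(Hc has_real_derivative dH t) (at t)"
      by (rule has_field_derivative_transform_within_open[OF ode'(1)[OF t], of "{1<..}"]) (use t eq in auto)
    then show "(Hc has_real_derivative dHc t) (at t)" using t eq by simp
    have "(dHc has_real_derivative ?F t) (at t)"
      by (rule has_field_derivative_transform_within_open[OF ode'(2)[OF t], of "{1<..}"]) (use t eq in auto)
    then show "(dHc has_real_derivative (Hc t - t * dHc t) * M_coeff ?n \<Phi> t (Hc t) (dHc t)) (at t)" using t eq by simp
  qed
  have agree: "radial_map Hc x = radial_map H x" if "x \<in> annulus R" for x :: "real ^ 'n"
    using that eq by (simp add: radial_map_def annulus_def)
  have W: "(radial_map H :: real ^ 'n \<Rightarrow> _) \<in> sobolev_W1 ?n (annulus R)"
  proof -
    obtain G where G: "has_weak_derivative_on (radial_map Hc :: real ^ 'n \<Rightarrow> _) G (annulus R)"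
      "set_integrable lebesgue (annulus R) (\<lambda>x :: real ^ 'n. norm (radial_map Hc x) ^ ?n)"
      "set_integrable lebesgue (annulus R) (\<lambda>x. norm (G x) ^ ?n)"
      using C1_radial_map_in_sobolev_W1[OF R Hc Hc'(1), where 'n = 'n] by (auto simp: sobolev_W1_def)
    have "has_weak_derivative_on (radial_map H :: real ^ 'n \<Rightarrow> _) G (annulus R)"
      by (rule has_weak_derivative_on_cong[OF agree G(1)])
    moreover have "set_integrable lebesgue (annulus R) (\<lambda>x :: real ^ 'n. norm (radial_map H x) ^ ?n)"
    proof -
      have "(\<lambda>x :: real ^ 'n. indicator (annulus R) x *\<^sub>R norm (radial_map H x) ^ ?n) =
          (\<lambda>x. indicator (annulus R) x *\<^sub>R norm (radial_map Hc x) ^ ?n)"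
        using agree by (auto simp: fun_eq_iff indicator_def)
      then show ?thesis using G(2) by (simp only: set_integrable_def)
    qed
    ultimately show ?thesis using G(3) unfolding sobolev_W1_def by blast
  qed
  have member: "(radial_map H :: real ^ 'n \<Rightarrow> _) \<in> radial_class R Rs"
    by (rule radial_map_in_radial_class[OF R _ H_bv _ W])
      (auto intro: continuous_on_subset[OF Hc1] mono)
  have "energy \<Phi> R (radial_map H :: real ^ 'n \<Rightarrow> _) \<le> energy \<Phi> R h"
    if h: "h \<in> (radial_class R Rs :: (real ^ 'n \<Rightarrow> real ^ 'n) set)" for h
  proof -
    define y where "y t = t * dHc t / Hc t" for t
    define q where "q t = sqrt (real ?n - 1 + (y t)\<^sup>2)" for t
    define J where "J t = dHc t * (Hc t / t) ^ (?n - 1)" for t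
    have pos: "0 < Hc t" "0 < dHc t" if "1 < t" for t using Hge[of t] dH(3)[of t] eq[of t] that by auto
    have "energy \<Phi> R (radial_map Hc :: real ^ 'n \<Rightarrow> _) \<le> energy \<Phi> R h"
    proof (rule stationary_radial_map_minimizes[OF n R Phi_convex Phi_pos d1 Hc _ _ _ Hc'(1) pos(2) y_def q_def J_def _ h])
      show "1 \<le> Hc t" for t using Hge[of "max 1 t"] by (simp add: Hc_def)
      show "Hc 1 = 1" "Hc R = Rs" using eq H_bv R by auto
      fix t :: real assume t: "1 < t"
      have J0: "0 < J t" using pos[OF t] t by (simp add: J_def)
      show "((\<lambda>t. y t * q t ^ (?n - 2) + deriv \<Phi> (J t) / real ?n) has_real_derivative
          (real ?n - 1) / t * q t ^ (?n - 2) * (1 - (y t)\<^sup>2)) (at t)"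
        unfolding J_def
        by (rule Euler_Lagrange_equation[OF n _ pos[OF t] Hc'[OF t] d2[OF J0] Phi_dd_pos[OF J0] J_def y_def q_def])
          (use t in simp)
    qed
    moreover have "energy \<Phi> R (radial_map Hc :: real ^ 'n \<Rightarrow> _) = energy \<Phi> R (radial_map H :: real ^ 'n \<Rightarrow> _)"
      by (rule energy_cong[OF agree])
    ultimately show ?thesis by simp
  qed
  with member show ?thesis by blast
qed

end
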